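(* Suppose that all the eigenvalues of the boundary value problem $$-y''+q(x)y=\lambda y\ (0<x<1),\qquad y(0)\cos\beta=y'(0)\sin\beta,\qquad (a\lambda+b)y(1)=(c\lambda+d)y'(1)$$ are real and that, except for one triple eigenvalue $\lambda_k=\lambda_{k+1}=\lambda_{k+2}$, all of them are simple. Let $y_n=y(\cdot,\lambda_n)$ for $n\neq k+1,k+2$ be the eigenfunctions, and let $y_{k+1}=\tilde y_{k+1}+Cy_k$ and $y_{k+2}=\tilde y_{k+2}+C\tilde y_{k+1}+Dy_k$ with $C,D\in\mathbb{R}$ be the first and second associated functions. Then the system $$\{y_n\}\quad (n=0,1,\ldots;\ n\neq k+1)$$ is minimal in $L_2(0,1)$ if and only if $$C\neq-\frac{\omega^{IV}(\lambda_k)}{4\,\omega'''(\lambda_k)}.$$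
   Context: Here $q:[0,1]\to\mathbb{R}$ is continuous, $0\le\beta<\pi$, and $a,b,c,d\in\mathbb{R}$ satisfy $ad-bc<0$. For $\lambda\in\mathbb{C}$ let $y(x,\lambda)$ be the solution of $-y''+q(x)y=\lambda y$ on $[0,1]$ with $y(0,\lambda)=\sin\beta$, $y'(0,\lambda)=\cos\beta$ (prime on $y$ means $d/dx$), and define the characteristic function $$\omega(\lambda)=(a\lambda+b)y(1,\lambda)-(c\lambda+d)y'(1,\lambda).$$ Primes and roman superscripts on $\omega$ denote derivatives in $\lambda$. The eigenvalues are the zeros of $\omega$, counted with algebraic multiplicity (the order as a zero of $\omega$). They form an infinite sequence $\{\lambda_n\}_{n\ge0}$ indexed by non-decreasing real parts, whose only accumulation point is $+\infty$. If $\lambda_k=\lambda_{k+1}=\lambda_{k+2}$ is a triple eigenvalue, with eigenfunction $y_k=y(\cdot,\lambda_k)$, a first associated function $y_{k+1}$ of $y_k$ is a solution of $-y_{k+1}''+qy_{k+1}=\lambda_ky_{k+1}+y_k$, $y_{k+1}(0)\cos\beta=y_{k+1}'(0)\sin\beta$, $(a\lambda_k+b)y_{k+1}(1)+ay_k(1)=(c\lambda_k+d)y_{k+1}'(1)+cy_k'(1)$. A second associated function $y_{k+2}$, belonging to $y_{k+1}$, is a solution of $-y_{k+2}''+qy_{k+2}=\lambda_ky_{k+2}+y_{k+1}$, $y_{k+2}(0)\cos\beta=y_{k+2}'(0)\sin\beta$, $(a\lambda_k+b)y_{k+2}(1)+ay_{k+1}(1)=(c\lambda_k+d)y_{k+2}'(1)+cy_{k+1}'(1)$.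 Put $\tilde y_{k+1}(x)=\frac{\partial y}{\partial\lambda}(x,\lambda_k)$ and $\tilde y_{k+2}(x)=\frac12\frac{\partial^2y}{\partial\lambda^2}(x,\lambda_k)$. These are particular associated functions, and in general $y_{k+1}=\tilde y_{k+1}+Cy_k$, $y_{k+2}=\tilde y_{k+2}+C\tilde y_{k+1}+Dy_k$ for some constants $C,D$. A system in $L_2(0,1)$ is minimal if none of its elements lies in the closed linear span of the others. *)

theory Defs
  imports "HOL-Complex_Analysis.Complex_Analysis"
begin

text \<open>Derivative in x on [0,1]; one-sided at the endpoints.\<close>

definition dx :: "(real \<Rightarrow> complex) \<Rightarrow> real \<Rightarrow> complex" where
  "dx u x = vector_derivative u (at x within {0..1})"

definition solves_SL :: "(real \<Rightarrow> real) \<Rightarrow> complex \<Rightarrow> (real \<Rightarrow> complex) \<Rightarrow> bool" where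
  "solves_SL q z u \<longleftrightarrow>
     (\<forall>x\<in>{0..1}. u differentiable (at x within {0..1}) \<and>
                dx u differentiable (at x within {0..1}) \<and>
                - dx (dx u) x + complex_of_real (q x) * u x = z * u x)"

text \<open>
  \<open>y x z\<close> is the value at \<open>x\<close> of the solution for the spectral parameter \<open>z\<close>. The
  initial value problem determines it for \<open>x\<close> in [0,1]; it is arbitrary elsewhere,
  and nothing below depends on its values there.
\<close>

definition initial_solution ::
    "(real \<Rightarrow> real) \<Rightarrow> real \<Rightarrow> (real \<Rightarrow> complex \<Rightarrow> complex) \<Rightarrow> bool" where
  "initial_solution q \<beta> y \<longleftrightarrow>
     (\<forall>z. solves_SL q z (\<lambda>x. y x z) \<and>
          y 0 z = complex_of_real (sin \<beta>) \<and>
          dx (\<lambda>x. y x z) 0 = complex_of_real (cos \<beta>))"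

definition char_fun ::
    "real \<Rightarrow> real \<Rightarrow> real \<Rightarrow> real \<Rightarrow> (real \<Rightarrow> complex \<Rightarrow> complex) \<Rightarrow> complex \<Rightarrow> complex" where
  "char_fun a b c d y z =
     (complex_of_real a * z + complex_of_real b) * y 1 z
     - (complex_of_real c * z + complex_of_real d) * dx (\<lambda>x. y x z) 1"

text \<open>
  An enumeration of the zeros of \<open>w\<close> by non-decreasing real part, each listed as
  often as its order. Finiteness is explicit because \<open>card\<close> is 0 on infinite sets.
\<close>

definition eigenvalue_sequence :: "(complex \<Rightarrow> complex) \<Rightarrow> (nat \<Rightarrow> complex) \<Rightarrow> bool" where
  "eigenvalue_sequence w lam \<longleftrightarrow>
     range lam = {z. w z = 0} \<and>
     (\<forall>z. w z = 0 \<longrightarrow> finite {n. lam n = z} \<and> int (card {n. lam n = z}) = zorder w z) \<and>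
     incseq (\<lambda>n. Re (lam n))"

definition assoc1 :: "(real \<Rightarrow> complex \<Rightarrow> complex) \<Rightarrow> complex \<Rightarrow> real \<Rightarrow> complex" where
  "assoc1 y z x = deriv (\<lambda>t. y x t) z"

definition assoc2 :: "(real \<Rightarrow> complex \<Rightarrow> complex) \<Rightarrow> complex \<Rightarrow> real \<Rightarrow> complex" where
  "assoc2 y z x = (deriv ^^ 2) (\<lambda>t. y x t) z / 2"

definition root_function ::
    "(real \<Rightarrow> complex \<Rightarrow> complex) \<Rightarrow> (nat \<Rightarrow> complex) \<Rightarrow> nat \<Rightarrow> real \<Rightarrow> real
      \<Rightarrow> nat \<Rightarrow> real \<Rightarrow> complex" where
  "root_function y lam k C D n x =
     (if n = k + 1 then assoc1 y (lam k) x + complex_of_real C * y x (lam k)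
      else if n = k + 2 then
        assoc2 y (lam k) x + complex_of_real C * assoc1 y (lam k) x
          + complex_of_real D * y x (lam k)
      else y x (lam n))"

text \<open>
  Elements of \<open>L\<^sub>2(0,1)\<close> (complex scalars) are represented by functions; membership in
  a closed span respects almost-everywhere equality.
\<close>

definition L2_space :: "(real \<Rightarrow> complex) set" where
  "L2_space = {f \<in> borel_measurable (lebesgue_on {0<..<1}).
                 integrable (lebesgue_on {0<..<1}) (\<lambda>x. (cmod (f x))\<^sup>2)}"

definition L2_norm :: "(real \<Rightarrow> complex) \<Rightarrow> real" where
  "L2_norm f = sqrt (integral\<^sup>L (lebesgue_on {0<..<1}) (\<lambda>x. (cmod (f x))\<^sup>2))"

definition closed_span :: "(nat \<Rightarrow> real \<Rightarrow> complex) \<Rightarrow> nat set \<Rightarrow> (real \<Rightarrow> complex) set" where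
  "closed_span f J =
     {g \<in> L2_space. \<forall>e>0. \<exists>F s. finite F \<and> F \<subseteq> J \<and>
        L2_norm (\<lambda>x. g x - (\<Sum>m\<in>F. s m * f m x)) < e}"

definition minimal_system :: "(nat \<Rightarrow> real \<Rightarrow> complex) \<Rightarrow> nat set \<Rightarrow> bool" where
  "minimal_system f I \<longleftrightarrow>
     (\<forall>n\<in>I. f n \<in> L2_space) \<and> (\<forall>n\<in>I. f n \<notin> closed_span f (I - {n}))"

end

(*
Pass to L2(0,1) + C, where the boundary condition becomes part of an operator A that is symmetric
for the form <(u,m),(v,n)> = int u v + m n / (ad - bc), which has one negative square. The
functions y(.,z), completed by their boundary values a y(1) - c y'(1), form a holomorphic family
yhat z with (A - z) yhat z = - w z (0,1), so all Gram entries of the root functions come from the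
Taylor coefficients of w and of the boundary values.

If C differs from the critical value, then the vector of the triple root space that annihilates the
system has a nonzero scalar component; subtracting multiples of it from the dual vectors removes
their scalar components and leaves a biorthogonal system in L2(0,1).

If C equals the critical value, then the expansion of (0,1) in root vectors does not contain the
first associated function but does contain the second, so it suffices that this expansion
converges. The eigenfunction at the triple eigenvalue is neutral, hence <h, cnj h> is nonnegative
for h orthogonal to it. For a remainder e of the expansion this bounds
F z = <(A - z)^(-1) e, e> by const / |Im z|. As F is holomorphic in a disc of radius r around 0,
the maximum principle for (z^2 - r^2) F z makes F(i) small when r is large. Then (A - i)^(-1) e is
small, and e itself is small because (0,1) lies in the closure of the domain of A.
*)
theory Submission
  imports Defs
begin

section \<open>The inhomogeneous equation as a first-order system\<close>

text \<open>The critical value is a residue coefficient. As \<open>- yhat z / w z\<close> is the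
  resolvent of A applied to (0,1), the components of (0,1) along the root vectors are residues of
  \<open>yhat / w\<close>. At the triple zero this residue is a multiple of
  \<open>Y 2 + c1 * Y 1 + c0 * Y 0\<close>, where the \<open>Y j\<close> are the Taylor coefficients
  of \<open>yhat\<close> and c1 = - w4 / w3 for those of w; the quotient 3! / 4! of factorials is
  the 1/4 of the theorem. The vector (0,1) decides because it is what L2(0,1) cannot see: an
  expansion of (0,1) restricts to a relation among the functions on [0,1]. For C = c1 that relation
  involves \<open>Y 2 + C * Y 1\<close> as a block and so avoids the deleted function. The obstacle
  is convergence for an indefinite form. It is proved for the single vector (0,1) only, along the
  finite sets of zeros that fill large discs, from resolvent estimates and without eigenvalue
  asymptotics or a completeness theorem. The form of an eigenvector with itself contains the factor
  w', so a multiple zero makes it neutral; orthogonality of the remainders to it then gives them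
  Cauchy-Schwarz and Bessel inequalities as in a Hilbert space.\<close>

definition sl_system :: "(real \<Rightarrow> real) \<Rightarrow> complex \<Rightarrow> (real \<Rightarrow> complex) \<Rightarrow> (real \<Rightarrow> complex) \<Rightarrow> (real \<Rightarrow> complex) \<Rightarrow> bool"
  where "sl_system q z f u v \<longleftrightarrow>
    (\<forall>x\<in>{0..1}. (u has_vector_derivative v x) (at x within {0..1}) \<and>
       (v has_vector_derivative (of_real (q x) - z) * u x - f x) (at x within {0..1}))"

lemma sl_continuous:
  assumes "sl_system q z f u v"
  shows "continuous_on {0..1} u" "continuous_on {0..1} v"
  using assms unfolding sl_system_def
  by (meson continuous_on_eq_continuous_within has_vector_derivative_continuous)+

lemma sl_cong:
  assumes "sl_system q z f u v" "\<And>x. x \<in> {0..1} \<Longrightarrow> f x = g x"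
  shows "sl_system q z g u v"
  using assms by (simp add: sl_system_def)

lemma sl_linear:
  assumes "sl_system q z f u v" "sl_system q z g w p"
  shows "sl_system q z (\<lambda>x. s * f x + t * g x) (\<lambda>x. s * u x + t * w x) (\<lambda>x. s * v x + t * p x)"
  unfolding sl_system_def
proof (intro ballI conjI)
  fix x :: real assume x: "x \<in> {0..1}"
  have d: "(u has_vector_derivative v x) (at x within {0..1})"
    "(v has_vector_derivative (of_real (q x) - z) * u x - f x) (at x within {0..1})"
    "(w has_vector_derivative p x) (at x within {0..1})"
    "(p has_vector_derivative (of_real (q x) - z) * w x - g x) (at x within {0..1})"
    using assms x by (auto simp: sl_system_def)
  show "((\<lambda>x. s * u x + t * w x) has_vector_derivative s * v x + t * p x) (at x within {0..1})"
    by (intro has_vector_derivative_add has_vector_derivative_mult_right d)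
  have "((\<lambda>x. s * v x + t * p x) has_vector_derivative
      s * ((of_real (q x) - z) * u x - f x) + t * ((of_real (q x) - z) * w x - g x)) (at x within {0..1})"
    by (intro has_vector_derivative_add has_vector_derivative_mult_right d)
  then show "((\<lambda>x. s * v x + t * p x) has_vector_derivative
      (of_real (q x) - z) * (s * u x + t * w x) - (s * f x + t * g x)) (at x within {0..1})"
    by (simp add: algebra_simps)
qed

lemma sl_shift:
  assumes "sl_system q z f u v"
  shows "sl_system q z' (\<lambda>x. f x + (z - z') * u x) u v"
  using assms by (simp add: sl_system_def algebra_simps)

text \<open>A Gronwall estimate whose constant depends only on bounds for \<open>q\<close> and
  \<open>z\<close>, hence uniform for \<open>z\<close> in a disc. Uniqueness, limits and parameter
  dependence all reduce to it.\<close>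

lemma sl_bound:
  assumes sl: "sl_system q z f u v" and ic: "u 0 = 0" "v 0 = 0"
    and Q: "\<And>x. x \<in> {0..1} \<Longrightarrow> \<bar>q x\<bar> \<le> Q" and R: "cmod z \<le> R"
    and f: "\<And>x. x \<in> {0..1} \<Longrightarrow> cmod (f x) \<le> e" and x: "x \<in> {0..1}"
  shows "cmod (u x) \<le> e * exp (2 + Q + R)" "cmod (v x) \<le> e * exp (2 + Q + R)"
proof -
  \<comment> \<open>\<open>1 + Q + R\<close> comes from the mixed terms in \<open>u\<close> and
    \<open>v\<close>, the remaining 1 from splitting 2 |v| e into |v|^2 + e^2.\<close>
  define k where "k = 2 + Q + R"
  define E where "E t = u t \<bullet> u t + v t \<bullet> v t" for t
  define E' where "E' t = u t \<bullet> v t + v t \<bullet> u t + (v t \<bullet> ((of_real (q t) - z) * u t - f t)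
      + ((of_real (q t) - z) * u t - f t) \<bullet> v t)" for t
  have "0 \<le> \<bar>q 0\<bar>" "\<bar>q 0\<bar> \<le> Q" using Q[of 0] by auto
  moreover have "0 \<le> R" using R norm_ge_zero[of z] by linarith
  ultimately have k2: "2 \<le> k" by (simp add: k_def)
  have e0: "0 \<le> e" using order_trans[OF norm_ge_zero f[of 0]] by simp
  have dE: "(E has_vector_derivative E' t) (at t within {0..1})" if "t \<in> {0..1}" for t
  proof -
    have "(u has_vector_derivative v t) (at t within {0..1})"
      "(v has_vector_derivative (of_real (q t) - z) * u t - f t) (at t within {0..1})"
      using sl that by (auto simp: sl_system_def)
    then show ?thesis
      unfolding E_def E'_def
      by (intro has_vector_derivative_add bounded_bilinear.has_vector_derivative[OF bounded_bilinear_inner])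
  qed
  have E'_le: "E' t \<le> k * E t + e\<^sup>2" if t: "t \<in> {0..1}" for t
  proof -
    let ?a = "cmod (u t)" and ?b = "cmod (v t)"
    have "cmod (of_real (q t) - z) \<le> Q + R"
      using Q[OF t] R norm_triangle_ineq4[of "of_real (q t)" z] by simp
    then have "cmod ((of_real (q t) - z) * u t - f t) \<le> (Q + R) * ?a + e"
      using f[OF t] norm_triangle_ineq4[of "(of_real (q t) - z) * u t" "f t"]
        mult_right_mono[of "cmod (of_real (q t) - z)" "Q + R" ?a]
      by (simp add: norm_mult)
    then have "v t \<bullet> ((of_real (q t) - z) * u t - f t) \<le> ?b * ((Q + R) * ?a + e)"
      by (meson mult_left_mono norm_cauchy_schwarz norm_ge_zero order_trans)
    moreover have "u t \<bullet> v t \<le> ?a * ?b" by (rule norm_cauchy_schwarz)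
    moreover have "E' t = 2 * (u t \<bullet> v t) + 2 * (v t \<bullet> ((of_real (q t) - z) * u t - f t))"
      unfolding E'_def by (simp only: inner_commute)
    ultimately have "E' t \<le> 2 * (?a * ?b) + 2 * (?b * ((Q + R) * ?a + e))"
      by linarith
    also have "\<dots> = (1 + Q + R) * (2 * ?a * ?b) + 2 * ?b * e"
      by (simp add: algebra_simps)
    also have "\<dots> \<le> (1 + Q + R) * (?a\<^sup>2 + ?b\<^sup>2) + (?b\<^sup>2 + e\<^sup>2)"
      using k2 by (intro add_mono mult_left_mono sum_squares_bound) (auto simp: k_def)
    also have "\<dots> \<le> k * E t + e\<^sup>2"
      by (simp add: E_def k_def dot_square_norm algebra_simps)
    finally show ?thesis .
  qed
  define H where "H t = exp (- k * t) * (E t + e\<^sup>2 / k)" for t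
  have dH: "(H has_real_derivative exp (- k * t) * E' t - k * exp (- k * t) * (E t + e\<^sup>2 / k)) (at t within {0..1})"
    if "t \<in> {0..1}" for t
  proof -
    have "((\<lambda>t. exp (- k * t)) has_real_derivative - k * exp (- k * t)) (at t within {0..1})"
      by (auto intro!: derivative_eq_intros)
    moreover have "((\<lambda>t. E t + e\<^sup>2 / k) has_real_derivative E' t) (at t within {0..1})"
      using dE[OF that] by (auto intro!: derivative_eq_intros simp: has_real_derivative_iff_has_vector_derivative)
    ultimately have "(H has_real_derivative - k * exp (- k * t) * (E t + e\<^sup>2 / k) + E' t * exp (- k * t)) (at t within {0..1})"
      unfolding H_def[abs_def] by (rule DERIV_mult)
    then show ?thesis by (simp only: mult.commute[of "E' t"] minus_mult_left[symmetric] add.commute[of "- _"] diff_conv_add_uminus)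
  qed
  \<comment> \<open>Gronwall: \<open>E' \<le> k E + e\<^sup>2\<close> makes \<open>H\<close> nonincreasing.\<close>
  have "H 0 \<ge> H x"
  proof (rule DERIV_nonpos_imp_decreasing_open[where f = H and a = 0 and b = x])
    show "0 \<le> x" using x by simp
    show "continuous_on {0..x} H"
      by (rule continuous_on_subset[OF DERIV_continuous_on[OF dH]]) (use x in auto)
    fix t assume t: "0 < t" "t < x"
    then have "t \<in> {0..1}" "at t within {0..1} = at t"
      using x by (auto intro: at_within_Icc_at)
    moreover have "exp (- k * t) * E' t - k * exp (- k * t) * (E t + e\<^sup>2 / k)
        = exp (- k * t) * (E' t - (k * E t + e\<^sup>2))"
      using k2 by (simp add: field_simps)
    moreover have "exp (- k * t) * (E' t - (k * E t + e\<^sup>2)) \<le> 0"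
      using E'_le[OF \<open>t \<in> {0..1}\<close>] by (simp add: mult_le_0_iff)
    ultimately show "\<exists>y. DERIV H t :> y \<and> y \<le> 0"
      using dH[of t] by (intro exI[of _ "exp (- k * t) * E' t - k * exp (- k * t) * (E t + e\<^sup>2 / k)"]) simp
  qed
  then have "exp (- k * x) * (E x + e\<^sup>2 / k) \<le> e\<^sup>2 / k"
    by (simp add: H_def E_def ic)
  then have "E x + e\<^sup>2 / k \<le> e\<^sup>2 / k * exp (k * x)"
    by (simp add: exp_minus pos_divide_le_eq divide_inverse[symmetric] inverse_eq_divide mult.commute[of "1 / _"])
  also have "\<dots> \<le> e\<^sup>2 / k * exp k"
    using k2 x by (intro mult_left_mono) auto
  also have "\<dots> \<le> e\<^sup>2 * exp k"
    using k2 by (intro mult_right_mono) (auto simp: divide_le_eq mult_le_cancel_left1)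
  also have "\<dots> \<le> (e * exp k)\<^sup>2"
    unfolding power_mult_distrib
    using self_le_power[of "exp k" 2] k2 by (intro mult_left_mono) auto
  finally have "E x \<le> (e * exp k)\<^sup>2"
    using k2 divide_nonneg_nonneg[of "e\<^sup>2" k] zero_le_power2[of e] by linarith
  then have "(cmod (u x))\<^sup>2 \<le> (e * exp k)\<^sup>2" "(cmod (v x))\<^sup>2 \<le> (e * exp k)\<^sup>2"
    unfolding E_def dot_square_norm using zero_le_power2[of "cmod (u x)"] zero_le_power2[of "cmod (v x)"]
    by linarith+
  then show "cmod (u x) \<le> e * exp (2 + Q + R)" "cmod (v x) \<le> e * exp (2 + Q + R)"
    using e0 unfolding k_def[symmetric] by (auto intro: power2_le_imp_le)
qed

lemma sl_diff:
  assumes "sl_system q z f u v" "sl_system q z g w p"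
  shows "sl_system q z (\<lambda>x. f x - g x) (\<lambda>x. u x - w x) (\<lambda>x. v x - p x)"
  using sl_linear[OF assms, of 1 "-1"] by simp

lemma sl_unique:
  assumes q: "continuous_on {0..1} q" and sl: "sl_system q z f u v" "sl_system q z f w p"
    and ic: "u 0 = w 0" "v 0 = p 0" and x: "x \<in> {0..1}"
  shows "u x = w x" "v x = p x"
proof -
  obtain Q where Q: "\<And>x. x \<in> {0..1} \<Longrightarrow> \<bar>q x\<bar> \<le> Q"
    using continuous_on_compact_bound[OF compact_Icc q] by (auto simp: real_norm_def)
  show "u x = w x" "v x = p x"
    using sl_bound[OF sl_diff[OF sl], of Q "cmod z" 0 x] ic x Q by auto
qed

text \<open>By \<open>sl_bound\<close> applied to differences, a uniformly Cauchy sequence of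
  sources makes \<open>u n\<close> and \<open>v n\<close> uniformly Cauchy. Their derivatives then
  converge uniformly as well, so the limits solve the limiting system.\<close>

lemma sl_limit:
  assumes q: "continuous_on {0..1} q" and sl: "\<And>n. sl_system q z (f n) (u n) (v n)"
    and ic: "\<And>n. u n 0 = 0" "\<And>n. v n 0 = 0"
    and lim: "uniform_limit {0..1} f g sequentially"
  obtains w p where "sl_system q z g w p" "w 0 = 0" "p 0 = 0"
proof -
  obtain Q where Q: "\<And>x. x \<in> {0..1} \<Longrightarrow> \<bar>q x\<bar> \<le> Q"
    using continuous_on_compact_bound[OF compact_Icc q] by (auto simp: real_norm_def)
  define L where "L = exp (2 + Q + cmod z)"
  have L: "L > 0" by (simp add: L_def)
  have bound: "cmod (u m x - u n x) \<le> e * L \<and> cmod (v m x - v n x) \<le> e * L"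
    if "\<And>x. x \<in> {0..1} \<Longrightarrow> cmod (f m x - f n x) \<le> e" "x \<in> {0..1}" for m n e x
    using sl_bound[OF sl_diff[OF sl[of m] sl[of n]], of Q "cmod z" e x] that ic Q by (auto simp: L_def)
  have "uniformly_Cauchy_on {0..1} f"
    using lim uniformly_convergent_Cauchy unfolding uniformly_convergent_on_def by blast
  then have cau: "\<exists>N. \<forall>m\<ge>N. \<forall>n\<ge>N. \<forall>x\<in>{0..1}. cmod (f m x - f n x) < e" if "e > 0" for e
    using that unfolding uniformly_Cauchy_on_def dist_norm by meson
  have "uniformly_Cauchy_on {0..1} u \<and> uniformly_Cauchy_on {0..1} v"
    unfolding uniformly_Cauchy_on_def
  proof (intro conjI allI impI)
    fix e :: real assume e: "e > 0"
    have "e / (2 * L) > 0" using e L by simp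
    from cau[OF this] obtain N where
      N: "\<And>m n x. m \<ge> N \<Longrightarrow> n \<ge> N \<Longrightarrow> x \<in> {0..1} \<Longrightarrow> cmod (f m x - f n x) < e / (2 * L)"
      by blast
    have "cmod (u m x - u n x) < e \<and> cmod (v m x - v n x) < e"
      if "m \<ge> N" "n \<ge> N" "x \<in> {0..1}" for m n x
    proof -
      have "cmod (u m x - u n x) \<le> e / 2 \<and> cmod (v m x - v n x) \<le> e / 2"
        using bound[of m n "e / (2 * L)" x] N[OF that(1,2)] that(3) L by (simp add: less_imp_le)
      then show ?thesis using e by linarith
    qed
    then show "\<exists>M. \<forall>x\<in>{0..1}. \<forall>m\<ge>M. \<forall>n\<ge>M. dist (u m x) (u n x) < e"
      "\<exists>M. \<forall>x\<in>{0..1}. \<forall>m\<ge>M. \<forall>n\<ge>M. dist (v m x) (v n x) < e"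
      unfolding dist_norm by blast+
  qed
  then obtain w p where w: "uniform_limit {0..1} u w sequentially" and p: "uniform_limit {0..1} v p sequentially"
    using Cauchy_uniformly_convergent unfolding uniformly_convergent_on_def by blast
  have lims: "(\<lambda>n. u n x) \<longlonglongrightarrow> w x" "(\<lambda>n. v n x) \<longlonglongrightarrow> p x" if "x \<in> {0..1}" for x
    using w p that by (auto intro: tendsto_uniform_limitI)
  have deriv_limit: "(h has_vector_derivative h' x) (at x within {0..1})"
    if d: "\<And>n x. x \<in> {0..1} \<Longrightarrow> (hn n has_vector_derivative hn' n x) (at x within {0..1})"
      and h': "uniform_limit {0..1} hn' h' sequentially"
      and h: "\<And>x. x \<in> {0..1} \<Longrightarrow> (\<lambda>n. hn n x) \<longlonglongrightarrow> h x" and x: "x \<in> {0..1}"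
    for hn hn' :: "nat \<Rightarrow> real \<Rightarrow> complex" and h h' x
  proof -
    have "\<exists>g. \<forall>x\<in>{0..1}. (\<lambda>n. hn n x) \<longlonglongrightarrow> g x \<and> (g has_derivative (\<lambda>t. t *\<^sub>R h' x)) (at x within {0..1})"
    proof (rule has_derivative_sequence)
      show "convex {0..1::real}" by simp
      show "(hn n has_derivative (\<lambda>t. t *\<^sub>R hn' n x)) (at x within {0..1})" if "x \<in> {0..1}" for n x
        using d[OF that] by (simp add: has_vector_derivative_def)
      show "(0::real) \<in> {0..1}" by simp
      show "(\<lambda>n. hn n 0) \<longlonglongrightarrow> h 0" by (rule h) simp
      fix e :: real assume e: "e > 0"
      have "\<forall>\<^sub>F n in sequentially. \<forall>x\<in>{0..1}. dist (hn' n x) (h' x) < e"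
        using h' e by (simp add: uniform_limit_iff)
      then show "\<forall>\<^sub>F n in sequentially. \<forall>x\<in>{0..1}. \<forall>t. norm (t *\<^sub>R hn' n x - t *\<^sub>R h' x) \<le> e * norm t"
      proof eventually_elim
        case (elim n)
        then show ?case
          by (auto simp: dist_norm mult.commute[of e] mult_left_mono less_imp_le simp flip: scaleR_diff_right)
      qed
    qed
    then obtain g where g: "\<And>x. x \<in> {0..1} \<Longrightarrow> (\<lambda>n. hn n x) \<longlonglongrightarrow> g x"
      "\<And>x. x \<in> {0..1} \<Longrightarrow> (g has_vector_derivative h' x) (at x within {0..1})"
      unfolding has_vector_derivative_def by blast
    have "g x = h x" if "x \<in> {0..1}" for x
      using LIMSEQ_unique[OF g(1) h] that by blast
    then show ?thesis
      using g(2)[OF x] x by (rule_tac has_vector_derivative_transform[of _ _ h g]) auto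
  qed
  have "sl_system q z g w p"
    unfolding sl_system_def
  proof (intro ballI conjI)
    fix x :: real assume x: "x \<in> {0..1}"
    show "(w has_vector_derivative p x) (at x within {0..1})"
      by (rule deriv_limit[of u v]) (use sl p lims x in \<open>auto simp: sl_system_def\<close>)
    have wc: "continuous_on {0..1} w"
      by (rule uniform_limit_theorem[OF _ w]) (use sl_continuous[OF sl] in auto)
    have "uniform_limit {0..1} (\<lambda>n x. (of_real (q x) - z) * u n x - f n x) (\<lambda>x. (of_real (q x) - z) * w x - g x) sequentially"
      by (intro uniform_limit_intros bounded_bilinear.bounded_uniform_limit[OF bounded_bilinear_mult] w lim
          compact_imp_bounded compact_continuous_image wc) (use q in \<open>auto intro!: continuous_intros\<close>)
    then show "(p has_vector_derivative (of_real (q x) - z) * w x - g x) (at x within {0..1})"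
      by (intro deriv_limit[of v "\<lambda>n x. (of_real (q x) - z) * u n x - f n x" "\<lambda>x. (of_real (q x) - z) * w x - g x" p])
        (use sl lims x in \<open>auto simp: sl_system_def\<close>)
  qed
  moreover have "w 0 = 0" "p 0 = 0"
    using lims[of 0] LIMSEQ_unique[OF _ tendsto_const[of 0 sequentially]] by (auto simp: ic LIMSEQ_const_iff)
  ultimately show ?thesis by (rule that)
qed

section \<open>Dependence on the spectral parameter\<close>

text \<open>Uniformity in x lets the difference quotients serve as sources in
  \<open>sl_limit\<close>, so that differentiation in the parameter can be iterated.\<close>

definition uniformly_differentiable :: "(complex \<Rightarrow> real \<Rightarrow> complex) \<Rightarrow> (complex \<Rightarrow> real \<Rightarrow> complex) \<Rightarrow> bool" where
  "uniformly_differentiable F F' \<longleftrightarrow> (\<forall>z. uniform_limit {0..1} (\<lambda>h x. (F (z + h) x - F z x) / h) (F' z) (at 0))"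

lemma uniformly_differentiable_imp_DERIV:
  assumes "uniformly_differentiable F F'" "x \<in> {0..1}"
  shows "((\<lambda>z. F z x) has_field_derivative F' z x) (at z)"
proof -
  have "uniform_limit {0..1} (\<lambda>h x. (F (z + h) x - F z x) / h) (F' z) (at 0)"
    using assms(1) by (simp add: uniformly_differentiable_def)
  from tendsto_uniform_limitI[OF this assms(2)] show ?thesis
    unfolding DERIV_def .
qed

lemma uniformly_differentiable_mult:
  assumes "uniformly_differentiable F F'"
  shows "uniformly_differentiable (\<lambda>z x. s * F z x) (\<lambda>z x. s * F' z x)"
  unfolding uniformly_differentiable_def
proof
  fix z
  have "uniform_limit {0..1} (\<lambda>h x. s * ((F (z + h) x - F z x) / h)) (\<lambda>x. s * F' z x) (at 0)"
    using assms unfolding uniformly_differentiable_def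
    by (intro bounded_linear.uniform_limit[OF bounded_linear_mult_right]) blast
  then show "uniform_limit {0..1} (\<lambda>h x. (s * F (z + h) x - s * F z x) / h) (\<lambda>x. s * F' z x) (at 0)"
    by (simp add: right_diff_distrib)
qed

text \<open>
  The derivative in the parameter is obtained as a uniform limit of difference quotients, which
  solve the same equation with convergent right-hand sides; no existence theorem is needed.
\<close>

lemma sl_param_derivative_at:
  assumes q: "continuous_on {0..1} q" and sol: "\<And>z. sl_system q z (f z) (u z) (v z)"
    and ic: "\<And>z z'. u z 0 = u z' 0" "\<And>z z'. v z 0 = v z' 0"
    and fc: "\<And>z. continuous_on {0..1} (f z)" and fd: "uniformly_differentiable f f'"
  shows "\<exists>w p. sl_system q z (\<lambda>x. u z x + f' z x) w p \<and> w 0 = 0 \<and> p 0 = 0 \<and>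
    uniform_limit {0..1} (\<lambda>h x. (u (z + h) x - u z x) / h) w (at 0) \<and>
    uniform_limit {0..1} (\<lambda>h x. (v (z + h) x - v z x) / h) p (at 0)"
proof -
  define dq where "dq F h x = (F (z + h) x - F z x) / h" for F :: "complex \<Rightarrow> real \<Rightarrow> complex" and h x
  obtain Q where Q: "\<And>x. x \<in> {0..1} \<Longrightarrow> \<bar>q x\<bar> \<le> Q"
    using continuous_on_compact_bound[OF compact_Icc q] by (auto simp: real_norm_def)
  have fl: "uniform_limit {0..1} (dq f) (f' z) (at 0)"
    using fd unfolding uniformly_differentiable_def dq_def[abs_def] by blast
  have "continuous_on {0..1} (f' z)"
    by (rule uniform_limit_theorem[OF _ fl]) (auto simp: dq_def[abs_def] divide_inverse intro!: always_eventually continuous_intros fc)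
  then obtain A where A: "\<And>x. x \<in> {0..1} \<Longrightarrow> cmod (f' z x) \<le> A"
    using continuous_on_compact_bound[OF compact_Icc] by metis
  obtain B where B: "\<And>x. x \<in> {0..1} \<Longrightarrow> cmod (u z x) \<le> B"
    using continuous_on_compact_bound[OF compact_Icc sl_continuous(1)[OF sol]] by metis
  \<comment> \<open>The same difference quotient is written at two parameters. At
    \<open>z + h\<close> its source contains only \<open>u z\<close>, which gives a bound and hence
    \<open>u (z + h)\<close> tending to \<open>u z\<close>. At the fixed \<open>z\<close>
    (\<open>S2\<close>) the source contains \<open>u (z + h)\<close>, and its convergence can then
    be used.\<close>
  have S1: "sl_system q (z + h) (\<lambda>x. u z x + dq f h x) (dq u h) (dq v h)" if h: "h \<noteq> 0" for h
  proof -
    have "sl_system q (z + h) (\<lambda>x. f z x + (z - (z + h)) * u z x) (u z) (v z)"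
      by (rule sl_shift[OF sol])
    from sl_linear[OF sol[of "z + h"] this, of "1 / h" "- 1 / h"]
    have "sl_system q (z + h) (\<lambda>x. 1 / h * f (z + h) x + - 1 / h * (f z x + (z - (z + h)) * u z x)) (dq u h) (dq v h)"
      by (simp add: dq_def[abs_def] diff_divide_distrib)
    then show ?thesis
      by (rule sl_cong) (use h in \<open>simp add: dq_def field_simps\<close>)
  qed
  have S2: "sl_system q z (\<lambda>x. u (z + h) x + dq f h x) (dq u h) (dq v h)" if h: "h \<noteq> 0" for h
    using sl_shift[OF S1[OF h], of z] by (rule sl_cong) (use h in \<open>simp add: dq_def\<close>)
  define W where "W = (B + (A + 1)) * exp (2 + Q + (cmod z + 1))"
  have near: "\<forall>\<^sub>F h in at 0. \<forall>x\<in>{0..1}. cmod (dq u h x) \<le> W"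
  proof -
    have "\<forall>\<^sub>F h in at 0. \<forall>x\<in>{0..1}. dist (dq f h x) (f' z x) < 1"
      using fl unfolding uniform_limit_iff by (meson zero_less_one)
    moreover have "\<forall>\<^sub>F h::complex in at 0. h \<noteq> 0 \<and> cmod h < 1"
      unfolding eventually_at by (rule exI[of _ 1]) auto
    ultimately show ?thesis
    proof eventually_elim
      case (elim h)
      have "cmod (u z x + dq f h x) \<le> B + (A + 1)" if "x \<in> {0..1}" for x
      proof -
        have "cmod (dq f h x) \<le> cmod (f' z x) + cmod (dq f h x - f' z x)"
          using norm_triangle_ineq[of "f' z x" "dq f h x - f' z x"] by simp
        then show ?thesis
          using elim(1) A[OF that] B[OF that] that norm_triangle_ineq[of "u z x" "dq f h x"]
          by (fastforce simp: dist_norm)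
      qed
      moreover have "cmod (z + h) \<le> cmod z + 1"
        using norm_triangle_ineq[of z h] elim(2) by linarith
      ultimately show ?case
        using sl_bound(1)[OF S1, of h Q "cmod z + 1" "B + (A + 1)"] elim(2) Q
        by (auto simp: W_def dq_def ic(1)[of "z + h" z] ic(2)[of "z + h" z])
    qed
  qed
  have ul: "uniform_limit {0..1} (\<lambda>h. u (z + h)) (u z) (at 0)"
    unfolding uniform_limit_iff
  proof (intro allI impI)
    fix e :: real assume e: "e > 0"
    define r where "r = e / (\<bar>W\<bar> + 1)"
    have "r > 0" using e by (auto simp: r_def)
    then have "\<forall>\<^sub>F h::complex in at 0. h \<noteq> 0 \<and> cmod h < r"
      unfolding eventually_at by (intro exI[of _ r]) auto
    with near show "\<forall>\<^sub>F h in at 0. \<forall>x\<in>{0..1}. dist (u (z + h) x) (u z x) < e"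
    proof eventually_elim
      case (elim h)
      show ?case
      proof
        fix x :: real assume x: "x \<in> {0..1}"
        have "dist (u (z + h) x) (u z x) = cmod h * cmod (dq u h x)"
          using elim by (simp add: dq_def dist_norm norm_divide)
        also have "\<dots> \<le> cmod h * (\<bar>W\<bar> + 1)"
          using elim(1)[rule_format, OF x] by (intro mult_left_mono) auto
        also have "\<dots> < r * (\<bar>W\<bar> + 1)"
          using elim by (intro mult_strict_right_mono) auto
        finally show "dist (u (z + h) x) (u z x) < e" by (simp add: r_def)
      qed
    qed
  qed
  have src: "uniform_limit {0..1} (\<lambda>h x. u (z + h) x + dq f h x) (\<lambda>x. u z x + f' z x) (at 0)"
    by (intro uniform_limit_intros ul fl)
  \<comment> \<open>A sequence tending to 0 only serves to produce the limit functions; convergence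
    along all h follows afterwards by comparing with them through \<open>sl_bound\<close>.\<close>
  define hn where "hn n = complex_of_real (inverse (real (Suc n)))" for n
  have hn0: "hn n \<noteq> 0" for n by (simp only: hn_def of_real_eq_0_iff) simp
  have "hn \<longlonglongrightarrow> complex_of_real 0"
    unfolding hn_def[abs_def] by (intro tendsto_of_real LIMSEQ_inverse_real_of_nat)
  then have "filterlim hn (at 0) sequentially"
    by (intro filterlim_atI) (use hn0 in auto)
  from filterlim_compose[OF src this]
  have "uniform_limit {0..1} (\<lambda>n x. u (z + hn n) x + dq f (hn n) x) (\<lambda>x. u z x + f' z x) sequentially" .
  then obtain w p where wp: "sl_system q z (\<lambda>x. u z x + f' z x) w p" "w 0 = 0" "p 0 = 0"
    by (rule sl_limit[OF q S2[OF hn0], rotated 2])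
      (auto simp: dq_def ic(1)[of "z + _" z] ic(2)[of "z + _" z])
  define L where "L = exp (2 + Q + cmod z)"
  have L: "L > 0" by (simp add: L_def)
  have conv: "\<forall>\<^sub>F h in at 0. \<forall>x\<in>{0..1}. dist (dq u h x) (w x) < e \<and> dist (dq v h x) (p x) < e" if e: "e > 0" for e
  proof -
    have "\<forall>\<^sub>F h in at 0. \<forall>x\<in>{0..1}. dist (u (z + h) x + dq f h x) (u z x + f' z x) < e / (2 * L)"
      using src e L unfolding uniform_limit_iff by simp
    moreover have "\<forall>\<^sub>F h::complex in at 0. h \<noteq> 0"
      by (simp add: eventually_at_filter)
    ultimately show ?thesis
    proof eventually_elim
      case (elim h)
      have "cmod (dq u h x - w x) \<le> e / (2 * L) * L \<and> cmod (dq v h x - p x) \<le> e / (2 * L) * L"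
        if "x \<in> {0..1}" for x
        using sl_bound[OF sl_diff[OF S2[OF elim(2)] wp(1)], of Q "cmod z" "e / (2 * L)" x] that elim Q wp(2,3)
        by (auto simp: L_def dq_def ic(1)[of "z + h" z] ic(2)[of "z + h" z] dist_norm less_imp_le)
      moreover have "e / (2 * L) * L < e" using e L by simp
      ultimately show ?case by (force simp: dist_norm)
    qed
  qed
  have "uniform_limit {0..1} (dq u) w (at 0)" "uniform_limit {0..1} (dq v) p (at 0)"
    unfolding uniform_limit_iff by (auto elim: eventually_mono dest!: conv)
  then show ?thesis
    using wp unfolding dq_def[abs_def] by blast
qed

lemma sl_param_derivative:
  assumes q: "continuous_on {0..1} q" and sol: "\<And>z. sl_system q z (f z) (u z) (v z)"
    and ic: "\<And>z z'. u z 0 = u z' 0" "\<And>z z'. v z 0 = v z' 0"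
    and fc: "\<And>z. continuous_on {0..1} (f z)" and fd: "uniformly_differentiable f f'"
  obtains u' v' where "\<And>z. sl_system q z (\<lambda>x. u z x + f' z x) (u' z) (v' z)" "\<And>z. u' z 0 = 0"
    "\<And>z. v' z 0 = 0" "uniformly_differentiable u u'" "uniformly_differentiable v v'"
proof -
  have "\<forall>z. \<exists>w p. sl_system q z (\<lambda>x. u z x + f' z x) w p \<and> w 0 = 0 \<and> p 0 = 0 \<and>
    uniform_limit {0..1} (\<lambda>h x. (u (z + h) x - u z x) / h) w (at 0) \<and>
    uniform_limit {0..1} (\<lambda>h x. (v (z + h) x - v z x) / h) p (at 0)"
    by (intro allI sl_param_derivative_at[OF q sol ic fc fd])
  then obtain u' v' where uv: "\<forall>z. sl_system q z (\<lambda>x. u z x + f' z x) (u' z) (v' z) \<and> u' z 0 = 0 \<and> v' z 0 = 0 \<and>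
    uniform_limit {0..1} (\<lambda>h x. (u (z + h) x - u z x) / h) (u' z) (at 0) \<and>
    uniform_limit {0..1} (\<lambda>h x. (v (z + h) x - v z x) / h) (v' z) (at 0)"
    unfolding choice_iff by blast
  show ?thesis by (rule that[of u' v']) (use uv in \<open>simp_all add: uniformly_differentiable_def\<close>)
qed

text \<open>Differentiating the equation j times in \<open>z\<close> leaves, by Leibniz, j times the
  previous derivative as source. The initial data are constant in \<open>z\<close>, so those of
  every derivative vanish.\<close>

lemma sl_param_derivatives:
  assumes q: "continuous_on {0..1} q" and sol: "\<And>z. sl_system q z (\<lambda>x. 0) (u z) (v z)"
    and ic: "\<And>z z'. u z 0 = u z' 0" "\<And>z z'. v z 0 = v z' 0"
  obtains U V where "U 0 = u" "V 0 = v"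
    "\<And>j z. sl_system q z (\<lambda>x. of_nat j * U (j - 1) z x) (U j z) (V j z)"
    "\<And>j. uniformly_differentiable (U j) (U (Suc j))" "\<And>j. uniformly_differentiable (V j) (V (Suc j))"
    "\<And>j z. U (Suc j) z 0 = 0" "\<And>j z. V (Suc j) z 0 = 0"
proof -
  \<comment> \<open>The state carries \<open>S\<close> besides \<open>U\<close> and \<open>V\<close>
    because the next equation arises by differentiating the source too. At n = 0 the factor
    \<open>of_nat n\<close> removes the dummy source.\<close>
  define P where "P n t \<longleftrightarrow> (case t of (S, U, V) \<Rightarrow>
      (\<forall>z. sl_system q z (\<lambda>x. of_nat n * S z x) (U z) (V z)) \<and> (\<forall>z z'. U z 0 = U z' 0 \<and> V z 0 = V z' 0) \<and>
      (n > 0 \<longrightarrow> uniformly_differentiable S U \<and> (\<forall>z. U z 0 = 0 \<and> V z 0 = 0)) \<and> (\<forall>z. continuous_on {0..1} (S z)) \<and>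
      (n = 0 \<longrightarrow> U = u \<and> V = v))" for n and t :: "(complex \<Rightarrow> real \<Rightarrow> complex) \<times> (complex \<Rightarrow> real \<Rightarrow> complex) \<times> (complex \<Rightarrow> real \<Rightarrow> complex)"
  define R where "R t t' \<longleftrightarrow> (case t of (S, U, V) \<Rightarrow> case t' of (S', U', V') \<Rightarrow> S' = U \<and> uniformly_differentiable U U' \<and> uniformly_differentiable V V')"
    for t t' :: "(complex \<Rightarrow> real \<Rightarrow> complex) \<times> (complex \<Rightarrow> real \<Rightarrow> complex) \<times> (complex \<Rightarrow> real \<Rightarrow> complex)"
  have "\<exists>F. \<forall>n. P n (F n) \<and> R (F n) (F (Suc n))"
  proof (rule dependent_nat_choice)
    show "\<exists>t. P 0 t"
      by (rule exI[of _ "(\<lambda>z x. 0, u, v)"]) (use sol ic in \<open>auto simp: P_def\<close>)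
    fix t n assume "P n t"
    moreover obtain S U V where t: "t = (S, U, V)" by (cases t) auto
    ultimately have p: "\<And>z. sl_system q z (\<lambda>x. of_nat n * S z x) (U z) (V z)" "\<And>z z'. U z 0 = U z' 0" "\<And>z z'. V z 0 = V z' 0"
      "n > 0 \<Longrightarrow> uniformly_differentiable S U" "\<And>z. continuous_on {0..1} (S z)"
      by (auto simp: P_def)
    have "uniformly_differentiable (\<lambda>z x. of_nat n * S z x) (\<lambda>z x. of_nat n * U z x)"
    proof (cases "n = 0")
      case True
      then show ?thesis by (simp add: uniformly_differentiable_def uniform_limit_const)
    qed (use p(4) uniformly_differentiable_mult in blast)
    moreover have "continuous_on {0..1} (\<lambda>x. of_nat n * S z x)" for z
      by (intro continuous_intros p)
    ultimately obtain U' V' where d: "\<And>z. sl_system q z (\<lambda>x. U z x + of_nat n * U z x) (U' z) (V' z)" "\<And>z. U' z 0 = 0"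
        "\<And>z. V' z 0 = 0" "uniformly_differentiable U U'" "uniformly_differentiable V V'"
      using sl_param_derivative[OF q p(1-3)] by blast
    have "P (Suc n) (U, U', V') \<and> R t (U, U', V')"
      using d sl_continuous[OF p(1)] by (auto simp: P_def R_def t algebra_simps)
    then show "\<exists>y. P (Suc n) y \<and> R t y" by blast
  qed
  then obtain F where F: "\<And>n. P n (F n)" "\<And>n. R (F n) (F (Suc n))" by blast
  define S where "S n = fst (F n)" for n
  define U where "U n = fst (snd (F n))" for n
  define V where "V n = snd (snd (F n))" for n
  have Fn: "F n = (S n, U n, V n)" for n by (simp add: S_def U_def V_def)
  note P = F(1)[unfolded Fn P_def prod.case] and R = F(2)[unfolded Fn R_def prod.case]
  show ?thesis
  proof (rule that[of U V])
    show "U 0 = u" "V 0 = v" using P[of 0] by auto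
    show "sl_system q z (\<lambda>x. of_nat j * U (j - 1) z x) (U j z) (V j z)" for j z
      using P[of j] R[of "j - 1"] by (cases j) auto
    show "uniformly_differentiable (U j) (U (Suc j))" "uniformly_differentiable (V j) (V (Suc j))" for j using R[of j] by auto
    show "U (Suc j) z 0 = 0" "V (Suc j) z 0 = 0" for j z using P[of "Suc j"] by auto
  qed
qed

lemma sl_cnj:
  assumes "sl_system q z f u v"
  shows "sl_system q (cnj z) (\<lambda>x. cnj (f x)) (\<lambda>x. cnj (u x)) (\<lambda>x. cnj (v x))"
  unfolding sl_system_def
proof (intro ballI conjI)
  fix x :: real assume x: "x \<in> {0..1}"
  show "((\<lambda>x. cnj (u x)) has_vector_derivative cnj (v x)) (at x within {0..1})"
    using assms x by (intro has_vector_derivative_cnj) (auto simp: sl_system_def)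
  have "((\<lambda>x. cnj (v x)) has_vector_derivative cnj ((of_real (q x) - z) * u x - f x)) (at x within {0..1})"
    using assms x by (intro has_vector_derivative_cnj) (auto simp: sl_system_def)
  then show "((\<lambda>x. cnj (v x)) has_vector_derivative (of_real (q x) - cnj z) * cnj (u x) - cnj (f x)) (at x within {0..1})"
    by simp
qed

section \<open>The symmetric operator on \<open>L\<^sub>2(0,1) + C\<close>\<close>

locale sl_problem =
  fixes q :: "real \<Rightarrow> real" and \<beta> a b c d :: real
  assumes q_cont: "continuous_on {0..1} q"
    and det_neg: "a * d - b * c < 0"
begin

text \<open>
  An element \<open>(u, m)\<close> of \<open>L\<^sub>2(0,1) + C\<close> is encoded as one function \<open>h\<close> that is \<open>u\<close> on [0,1] and
  has the value \<open>m\<close> at the point 2, so that linear combinations are pointwise. With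
  \<open>A(u, a u(1) - c u'(1)) = (- u'' + q u, - (b u(1) - d u'(1)))\<close>, \<open>resolvent_eq z f u\<close> says
  \<open>(A - z) u = f\<close>.
\<close>

definition Delta :: complex where "Delta = of_real (a * d - b * c)"

lemma Delta_nonzero: "Delta \<noteq> 0"
  using det_neg unfolding Delta_def by (simp only: of_real_eq_0_iff)

definition indef_form :: "(real \<Rightarrow> complex) \<Rightarrow> (real \<Rightarrow> complex) \<Rightarrow> complex" where
  "indef_form h g = integral {0..1} (\<lambda>x. h x * g x) + h 2 * g 2 / Delta"

definition resolvent_eq :: "complex \<Rightarrow> (real \<Rightarrow> complex) \<Rightarrow> (real \<Rightarrow> complex) \<Rightarrow> bool" where
  "resolvent_eq z f u \<longleftrightarrow> continuous_on {0..1} f \<and>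
     (\<exists>v. sl_system q z f u v \<and> u 0 * of_real (cos \<beta>) = v 0 * of_real (sin \<beta>) \<and>
        u 2 = of_real a * u 1 - of_real c * v 1 \<and>
        f 2 = - (of_real b * u 1 - of_real d * v 1) - z * u 2)"

lemma resolvent_eq_continuous:
  assumes "resolvent_eq z f u"
  shows "continuous_on {0..1} f" "continuous_on {0..1} u"
  using assms sl_continuous(1) by (auto simp: resolvent_eq_def)

lemma resolvent_eq_cong:
  assumes "resolvent_eq z f u" and eq: "\<And>x. x \<in> {0..1} \<union> {2} \<Longrightarrow> f x = g x" "\<And>x. x \<in> {0..1} \<union> {2} \<Longrightarrow> u x = w x"
  shows "resolvent_eq z g w"
proof -
  obtain v where v: "sl_system q z f u v" "u 0 * of_real (cos \<beta>) = v 0 * of_real (sin \<beta>)"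
    "u 2 = of_real a * u 1 - of_real c * v 1" "f 2 = - (of_real b * u 1 - of_real d * v 1) - z * u 2"
    using assms(1) by (auto simp: resolvent_eq_def)
  have "continuous_on {0..1} f" using assms(1) by (simp add: resolvent_eq_def)
  then have "continuous_on {0..1} g" by (rule continuous_on_eq) (simp add: eq)
  moreover have "sl_system q z g w v"
    unfolding sl_system_def
  proof (intro ballI conjI)
    fix x :: real assume x: "x \<in> {0..1}"
    show "(w has_vector_derivative v x) (at x within {0..1})"
      by (rule has_vector_derivative_transform[OF x, of w u]) (use v(1) x eq in \<open>auto simp: sl_system_def\<close>)
    show "(v has_vector_derivative (of_real (q x) - z) * w x - g x) (at x within {0..1})"
      using v(1) x eq(1)[of x, symmetric] eq(2)[of x, symmetric] by (simp add: sl_system_def)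
  qed
  ultimately show ?thesis
    unfolding resolvent_eq_def using v(2-4) eq[of 0] eq[of 1] eq[of 2] by auto
qed

lemma resolvent_eq_linear:
  assumes "resolvent_eq z f u" "resolvent_eq z g w"
  shows "resolvent_eq z (\<lambda>x. s * f x + t * g x) (\<lambda>x. s * u x + t * w x)"
proof -
  obtain v p where "sl_system q z f u v" "u 0 * of_real (cos \<beta>) = v 0 * of_real (sin \<beta>)"
    "u 2 = of_real a * u 1 - of_real c * v 1" "f 2 = - (of_real b * u 1 - of_real d * v 1) - z * u 2"
    "sl_system q z g w p" "w 0 * of_real (cos \<beta>) = p 0 * of_real (sin \<beta>)"
    "w 2 = of_real a * w 1 - of_real c * p 1" "g 2 = - (of_real b * w 1 - of_real d * p 1) - z * w 2"
    using assms by (auto simp: resolvent_eq_def)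
  note h = this
  show ?thesis
    unfolding resolvent_eq_def
  proof (intro conjI exI)
    show "continuous_on {0..1} (\<lambda>x. s * f x + t * g x)"
      using assms by (intro continuous_intros resolvent_eq_continuous)
    show "sl_system q z (\<lambda>x. s * f x + t * g x) (\<lambda>x. s * u x + t * w x) (\<lambda>x. s * v x + t * p x)"
      using h by (intro sl_linear)
    have "(s * u 0 + t * w 0) * of_real (cos \<beta>) = s * (u 0 * of_real (cos \<beta>)) + t * (w 0 * of_real (cos \<beta>))"
      by (simp add: algebra_simps)
    also have "\<dots> = (s * v 0 + t * p 0) * of_real (sin \<beta>)"
      unfolding h(2) h(6) by (simp add: algebra_simps)
    finally show "(s * u 0 + t * w 0) * of_real (cos \<beta>) = (s * v 0 + t * p 0) * of_real (sin \<beta>)" .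
    show "s * u 2 + t * w 2 = of_real a * (s * u 1 + t * w 1) - of_real c * (s * v 1 + t * p 1)"
      unfolding h(3) h(7) by (simp add: algebra_simps)
    show "s * f 2 + t * g 2 = - (of_real b * (s * u 1 + t * w 1) - of_real d * (s * v 1 + t * p 1)) - z * (s * u 2 + t * w 2)"
      unfolding h(4) h(8) by (simp add: algebra_simps)
  qed
qed

lemma resolvent_eq_shift:
  assumes "resolvent_eq z f u"
  shows "resolvent_eq z' (\<lambda>x. f x + (z - z') * u x) u"
proof -
  obtain v where v: "sl_system q z f u v" "u 0 * of_real (cos \<beta>) = v 0 * of_real (sin \<beta>)"
    "u 2 = of_real a * u 1 - of_real c * v 1" "f 2 = - (of_real b * u 1 - of_real d * v 1) - z * u 2"
    using assms by (auto simp: resolvent_eq_def)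
  have "continuous_on {0..1} (\<lambda>x. f x + (z - z') * u x)"
    using assms by (intro continuous_intros resolvent_eq_continuous)
  moreover have "f 2 + (z - z') * u 2 = - (of_real b * u 1 - of_real d * v 1) - z' * u 2"
    unfolding v(4) by (simp add: algebra_simps)
  ultimately show ?thesis
    unfolding resolvent_eq_def using v(2,3) sl_shift[OF v(1), of z'] by blast
qed

lemma resolvent_eq_zero: "resolvent_eq z (\<lambda>x. 0) (\<lambda>x. 0)"
  unfolding resolvent_eq_def sl_system_def by (auto intro!: exI[of _ "\<lambda>x. 0"])

lemma resolvent_eq_sum:
  assumes "finite I" "\<And>i. i \<in> I \<Longrightarrow> resolvent_eq z (f i) (u i)"
  shows "resolvent_eq z (\<lambda>x. \<Sum>i\<in>I. s i * f i x) (\<lambda>x. \<Sum>i\<in>I. s i * u i x)"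
  using assms
proof (induction I rule: finite_induct)
  case empty
  then show ?case using resolvent_eq_zero by simp
next
  case (insert i I)
  then have "resolvent_eq z (\<lambda>x. s i * f i x + 1 * (\<Sum>i\<in>I. s i * f i x)) (\<lambda>x. s i * u i x + 1 * (\<Sum>i\<in>I. s i * u i x))"
    by (intro resolvent_eq_linear) auto
  with insert(1,2) show ?case by simp
qed

lemma resolvent_eq_cnj:
  assumes "resolvent_eq z f u"
  shows "resolvent_eq (cnj z) (\<lambda>x. cnj (f x)) (\<lambda>x. cnj (u x))"
proof -
  obtain v where v: "sl_system q z f u v" "u 0 * of_real (cos \<beta>) = v 0 * of_real (sin \<beta>)"
    "u 2 = of_real a * u 1 - of_real c * v 1" "f 2 = - (of_real b * u 1 - of_real d * v 1) - z * u 2"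
    using assms by (auto simp: resolvent_eq_def)
  have "sl_system q (cnj z) (\<lambda>x. cnj (f x)) (\<lambda>x. cnj (u x)) (\<lambda>x. cnj (v x))"
    by (rule sl_cnj[OF v(1)])
  moreover have "cnj (u 0) * of_real (cos \<beta>) = cnj (v 0) * of_real (sin \<beta>)"
    using arg_cong[OF v(2), of cnj] by simp
  moreover have "continuous_on {0..1} (\<lambda>x. cnj (f x))"
    using resolvent_eq_continuous(1)[OF assms] by (rule continuous_on_cnj)
  ultimately show ?thesis
    unfolding resolvent_eq_def by (intro conjI exI[of _ "\<lambda>x. cnj (v x)"]) (auto simp: v(3) v(4))
qed

text \<open>Symmetry of A for the bilinear form, by Lagrange's identity. The Wronskian at 0 vanishes
  by the boundary condition. At 1 it equals the scalar terms up to the determinant ad - bc of the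
  two boundary functionals, which is why the form weights them by \<open>1 / Delta\<close>.\<close>

lemma resolvent_eq_form:
  assumes "resolvent_eq z f u" "resolvent_eq z' g w"
  shows "(z - z') * indef_form u w + indef_form f w - indef_form u g = 0"
proof -
  obtain v p where "sl_system q z f u v" "u 0 * of_real (cos \<beta>) = v 0 * of_real (sin \<beta>)"
    "u 2 = of_real a * u 1 - of_real c * v 1" "f 2 = - (of_real b * u 1 - of_real d * v 1) - z * u 2"
    "sl_system q z' g w p" "w 0 * of_real (cos \<beta>) = p 0 * of_real (sin \<beta>)"
    "w 2 = of_real a * w 1 - of_real c * p 1" "g 2 = - (of_real b * w 1 - of_real d * p 1) - z' * w 2"
    using assms by (auto simp: resolvent_eq_def)
  note h = this
  note cont = resolvent_eq_continuous[OF assms(1)] resolvent_eq_continuous[OF assms(2)]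
  have wronskian: "((\<lambda>x. u x * p x - v x * w x) has_vector_derivative
      ((z - z') * (u x * w x) + f x * w x - u x * g x)) (at x within {0..1})" if "x \<in> {0..1}" for x
  proof -
    have "((\<lambda>x. u x * p x - v x * w x) has_vector_derivative
       (u x * ((of_real (q x) - z') * w x - g x) + v x * p x)
        - (v x * p x + ((of_real (q x) - z) * u x - f x) * w x)) (at x within {0..1})"
      using h(1,5) that unfolding sl_system_def
      by (intro has_vector_derivative_diff has_vector_derivative_mult) auto
    then show ?thesis by (simp add: algebra_simps)
  qed
  have "((\<lambda>x. (z - z') * (u x * w x) + f x * w x - u x * g x) has_integral
      (u 1 * p 1 - v 1 * w 1) - (u 0 * p 0 - v 0 * w 0)) {0..1}"
    by (rule fundamental_theorem_of_calculus) (use wronskian in auto)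
  then have "(u 1 * p 1 - v 1 * w 1) - (u 0 * p 0 - v 0 * w 0) =
      integral {0..1} (\<lambda>x. (z - z') * (u x * w x) + f x * w x - u x * g x)"
    by (simp add: integral_unique)
  also have "\<dots> = (z - z') * integral {0..1} (\<lambda>x. u x * w x) + integral {0..1} (\<lambda>x. f x * w x)
      - integral {0..1} (\<lambda>x. u x * g x)"
    by (intro integral_unique has_integral_diff has_integral_add has_integral_mult_right
        integrable_integral integrable_continuous_real continuous_intros cont)
  finally have 1: "(u 1 * p 1 - v 1 * w 1) - (u 0 * p 0 - v 0 * w 0) =
      (z - z') * integral {0..1} (\<lambda>x. u x * w x) + integral {0..1} (\<lambda>x. f x * w x)
      - integral {0..1} (\<lambda>x. u x * g x)" .
  \<comment> \<open>The boundary condition kills this expression times sin \<beta> and times cos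
    \<beta>; since the squares add up to 1, no case distinction on which of them vanishes is
    made.\<close>
  have "u 0 * p 0 - v 0 * w 0 = 0"
  proof -
    let ?s = "complex_of_real (sin \<beta>)" and ?c = "complex_of_real (cos \<beta>)"
    have "?s * ?s + ?c * ?c = 1"
      using arg_cong[OF sin_cos_squared_add3[of \<beta>], of complex_of_real]
      by (simp only: of_real_add of_real_mult of_real_1 add.commute)
    moreover have "?s * (u 0 * p 0 - v 0 * w 0) = 0" "?c * (u 0 * p 0 - v 0 * w 0) = 0"
      using h(2,6) by algebra+
    ultimately show ?thesis by algebra
  qed
  moreover have "Delta * (u 1 * p 1 - v 1 * w 1) = - ((z - z') * (u 2 * w 2) + f 2 * w 2 - u 2 * g 2)"
    unfolding h(4,8) unfolding h(3,7) by (simp add: Delta_def algebra_simps)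
  then have "u 1 * p 1 - v 1 * w 1 = - ((z - z') * (u 2 * w 2) + f 2 * w 2 - u 2 * g 2) / Delta"
    using Delta_nonzero by (simp only: nonzero_eq_divide_eq mult.commute not_False_eq_True)
  ultimately show ?thesis
    using 1 by (simp add: indef_form_def add_divide_distrib diff_divide_distrib distrib_left)
      (simp add: algebra_simps)
qed

lemma indef_form_commute: "indef_form h g = indef_form g h"
  by (simp add: indef_form_def mult.commute)

lemma indef_form_linear:
  assumes "continuous_on {0..1} h" "continuous_on {0..1} h'" "continuous_on {0..1} g"
  shows "indef_form (\<lambda>x. s * h x + t * h' x) g = s * indef_form h g + t * indef_form h' g"
proof -
  have "integral {0..1} (\<lambda>x. (s * h x + t * h' x) * g x) = integral {0..1} (\<lambda>x. s * (h x * g x) + t * (h' x * g x))"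
    by (simp add: algebra_simps)
  also have "\<dots> = s * integral {0..1} (\<lambda>x. h x * g x) + t * integral {0..1} (\<lambda>x. h' x * g x)"
    by (intro integral_unique has_integral_add has_integral_mult_right
        integrable_integral integrable_continuous_real continuous_intros assms)
  finally show ?thesis by (simp add: indef_form_def algebra_simps add_divide_distrib)
qed

lemma indef_form_sum:
  assumes "finite I" "\<And>i. i \<in> I \<Longrightarrow> continuous_on {0..1} (h i)" "continuous_on {0..1} g"
  shows "indef_form (\<lambda>x. \<Sum>i\<in>I. s i * h i x) g = (\<Sum>i\<in>I. s i * indef_form (h i) g)"
  using assms(1,2)
proof (induction I rule: finite_induct)
  case empty
  then show ?case by (simp add: indef_form_def)
next
  case (insert i I)
  have "indef_form (\<lambda>x. s i * h i x + 1 * (\<Sum>i\<in>I. s i * h i x)) g = s i * indef_form (h i) g + 1 * indef_form (\<lambda>x. \<Sum>i\<in>I. s i * h i x) g"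
    using insert assms(3) by (intro indef_form_linear continuous_intros) auto
  with insert show ?case by simp
qed

lemma indef_form_cnj:
  assumes "continuous_on {0..1} h" "continuous_on {0..1} g"
  shows "indef_form (\<lambda>x. cnj (h x)) (\<lambda>x. cnj (g x)) = cnj (indef_form h g)"
proof -
  have "((\<lambda>x. h x * g x) has_integral integral {0..1} (\<lambda>x. h x * g x)) {0..1}"
    using assms by (intro integrable_integral integrable_continuous_real continuous_intros)
  from has_integral_linear[OF this bounded_linear_cnj]
  have "integral {0..1} (\<lambda>x. cnj (h x) * cnj (g x)) = cnj (integral {0..1} (\<lambda>x. h x * g x))"
    by (simp add: o_def integral_unique)
  then show ?thesis by (simp add: indef_form_def Delta_def)
qed

end

section \<open>Holomorphy and reality in the spectral parameter\<close>

lemma higher_deriv_cnj_real: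
  assumes f: "f holomorphic_on UNIV" and sym: "\<And>z. cnj (f (cnj z)) = f z"
  shows "cnj ((deriv ^^ n) f (cnj z)) = (deriv ^^ n) f z"
proof (induction n arbitrary: z)
  case (Suc n)
  have "(deriv ^^ n) f holomorphic_on UNIV"
    by (intro holomorphic_higher_deriv f) simp
  then have "((deriv ^^ n) f has_field_derivative deriv ((deriv ^^ n) f) (cnj z)) (at (cnj z))"
    by (auto intro: holomorphic_derivI)
  from has_field_derivative_cnj_cnj[OF this]
  have "((deriv ^^ n) f has_field_derivative cnj (deriv ((deriv ^^ n) f) (cnj z))) (at z)"
    by (simp add: o_def Suc.IH)
  from DERIV_imp_deriv[OF this] show ?case by simp
qed (simp add: sym)

lemma DERIV_imp_higher_deriv:
  assumes "\<And>j z. (F j has_field_derivative F (Suc j) z) (at z)"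
  shows "(deriv ^^ j) (F 0) = F j"
proof (induction j)
  case (Suc j)
  then show ?case using assms DERIV_imp_deriv by fastforce
qed simp

locale sl_char = sl_problem +
  fixes y :: "real \<Rightarrow> complex \<Rightarrow> complex"
  assumes y: "initial_solution q \<beta> y"
begin

abbreviation w :: "complex \<Rightarrow> complex" where "w \<equiv> char_fun a b c d y"

definition yhat :: "complex \<Rightarrow> real \<Rightarrow> complex" where
  "yhat z x = (if x = 2 then of_real a * y 1 z - of_real c * dx (\<lambda>x. y x z) 1 else y x z)"

definition yder :: "nat \<Rightarrow> complex \<Rightarrow> real \<Rightarrow> complex" where
  "yder j z x = (deriv ^^ j) (\<lambda>t. yhat t x) z"

text \<open>The vector (0,1) of the extended space.\<close>

definition unit_at_2 :: "real \<Rightarrow> complex" where "unit_at_2 x = (if x = 2 then 1 else 0)"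

lemma sl_y: "sl_system q z (\<lambda>x. 0) (\<lambda>x. y x z) (dx (\<lambda>x. y x z))"
  unfolding sl_system_def
proof (intro ballI conjI)
  fix x :: real assume x: "x \<in> {0..1}"
  let ?u = "\<lambda>x. y x z"
  have s: "?u differentiable (at x within {0..1})" "dx ?u differentiable (at x within {0..1})"
      "- dx (dx ?u) x + complex_of_real (q x) * ?u x = z * ?u x"
    using y x unfolding initial_solution_def solves_SL_def by auto
  show "(?u has_vector_derivative dx ?u x) (at x within {0..1})"
    using s(1) unfolding dx_def by (simp add: vector_derivative_works)
  have "(dx ?u has_vector_derivative dx (dx ?u) x) (at x within {0..1})"
    using s(2) vector_derivative_works unfolding dx_def[of "dx ?u"] by blast
  moreover have "dx (dx ?u) x = (of_real (q x) - z) * ?u x - 0"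
    using s(3) by (simp add: algebra_simps)
  ultimately show "(dx ?u has_vector_derivative (of_real (q x) - z) * ?u x - 0) (at x within {0..1})"
    by simp
qed

lemma y_ic: "y 0 z = of_real (sin \<beta>)" "dx (\<lambda>x. y x z) 0 = of_real (cos \<beta>)"
  using y by (auto simp: initial_solution_def)

text \<open>The j-fold parameter derivative of \<open>(A - z) yhat z = - w z (0,1)\<close>. Explicit
  families \<open>U\<close>, \<open>V\<close>, \<open>W\<close> are built first and then identified
  with the iterated \<open>deriv\<close>, which keeps differentiability out of the later
  arguments.\<close>

lemma w_yhat_derivatives:
  obtains W where "\<And>j. (deriv ^^ j) w = W j"
    "\<And>j z. (W j has_field_derivative W (Suc j) z) (at z)"
    "\<And>j z x. x \<in> {0..1} \<union> {2} \<Longrightarrow> ((\<lambda>z. yder j z x) has_field_derivative yder (Suc j) z x) (at z)"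
    "\<And>j z. resolvent_eq z (\<lambda>x. of_nat j * yder (j - 1) z x - W j z * unit_at_2 x) (yder j z)"
proof -
  obtain U V where U0: "U 0 = (\<lambda>z x. y x z)" and V0: "V 0 = (\<lambda>z. dx (\<lambda>x. y x z))"
    and sl: "\<And>j z. sl_system q z (\<lambda>x. of_nat j * U (j - 1) z x) (U j z) (V j z)"
    and dU: "\<And>j. uniformly_differentiable (U j) (U (Suc j))" and dV: "\<And>j. uniformly_differentiable (V j) (V (Suc j))"
    and ic: "\<And>j z. U (Suc j) z 0 = 0" "\<And>j z. V (Suc j) z 0 = 0"
    using sl_param_derivatives[OF q_cont sl_y] y_ic by auto
  define M where "M j z = of_real a * U j z 1 - of_real c * V j z 1" for j z
  define N where "N j z = of_real b * U j z 1 - of_real d * V j z 1" for j z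
  define Y where "Y j z x = (if x = 2 then M j z else U j z x)" for j z x
  \<comment> \<open>Leibniz for \<open>z * M 0 z + N 0 z\<close>, which is \<open>w z\<close>; the
    factor j makes the truncated index \<open>j - 1\<close> harmless at j = 0.\<close>
  define W where "W j z = z * M j z + of_nat j * M (j - 1) z + N j z" for j z
  have dU1: "((\<lambda>z. U j z x) has_field_derivative U (Suc j) z x) (at z)" if "x \<in> {0..1}" for j z x
    using uniformly_differentiable_imp_DERIV[OF dU that] .
  have dV1: "((\<lambda>z. V j z x) has_field_derivative V (Suc j) z x) (at z)" if "x \<in> {0..1}" for j z x
    using uniformly_differentiable_imp_DERIV[OF dV that] .
  have dM: "(M j has_field_derivative M (Suc j) z) (at z)" for j z
    unfolding M_def[abs_def] by (intro DERIV_diff DERIV_cmult dU1 dV1) auto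
  have dN: "(N j has_field_derivative N (Suc j) z) (at z)" for j z
    unfolding N_def[abs_def] by (intro DERIV_diff DERIV_cmult dU1 dV1) auto
  have dW: "(W j has_field_derivative W (Suc j) z) (at z)" for j z
  proof -
    have "((\<lambda>z. of_nat j * M (j - 1) z) has_field_derivative of_nat j * M j z) (at z)"
    proof (cases j)
      case (Suc i)
      then show ?thesis using DERIV_cmult[OF dM, of _ i z] by simp
    qed simp
    then have "(W j has_field_derivative (1 * M j z + M (Suc j) z * z) + of_nat j * M j z + N (Suc j) z) (at z)"
      unfolding W_def[abs_def] by (intro DERIV_add DERIV_mult DERIV_ident dM dN)
    then show ?thesis by (simp add: W_def algebra_simps)
  qed
  have dY: "((\<lambda>z. Y j z x) has_field_derivative Y (Suc j) z x) (at z)" if "x \<in> {0..1} \<union> {2}" for j z x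
    using that dM dU1 by (auto simp: Y_def)
  have "w = W 0"
    by (rule ext) (simp add: char_fun_def W_def M_def N_def U0 V0 algebra_simps)
  then have Wj: "(deriv ^^ j) w = W j" for j
    using DERIV_imp_higher_deriv[of W, OF dW] by simp
  have yderY: "yder j z x = Y j z x" if "x \<in> {0..1} \<union> {2}" for j z x
  proof -
    have "(\<lambda>t. yhat t x) = (\<lambda>t. Y 0 t x)"
      by (auto simp: yhat_def Y_def M_def U0 V0 fun_eq_iff)
    then show ?thesis
      unfolding yder_def using DERIV_imp_higher_deriv[of "\<lambda>j z. Y j z x"] dY[OF that] by metis
  qed
  have relY: "resolvent_eq z (\<lambda>x. of_nat j * Y (j - 1) z x - W j z * unit_at_2 x) (Y j z)" for j z
    unfolding resolvent_eq_def
  proof (intro conjI exI)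
    have "continuous_on {0..1} (\<lambda>x. of_nat j * U (j - 1) z x)"
      by (intro continuous_intros sl_continuous(1)[OF sl])
    then show "continuous_on {0..1} (\<lambda>x. of_nat j * Y (j - 1) z x - W j z * unit_at_2 x)"
      by (rule continuous_on_eq) (auto simp: Y_def unit_at_2_def)
    have "sl_system q z (\<lambda>x. of_nat j * Y (j - 1) z x - W j z * unit_at_2 x) (U j z) (V j z)"
      by (rule sl_cong[OF sl]) (auto simp: Y_def unit_at_2_def)
    moreover have "(Y j z has_vector_derivative D) (at x within {0..1}) \<longleftrightarrow>
      (U j z has_vector_derivative D) (at x within {0..1})" if "x \<in> {0..1}" for D x
      by (rule has_vector_derivative_cong_ev[OF always_eventually]) (use that in \<open>auto simp: Y_def\<close>)
    ultimately show "sl_system q z (\<lambda>x. of_nat j * Y (j - 1) z x - W j z * unit_at_2 x) (Y j z) (V j z)"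
      by (auto simp: sl_system_def Y_def)
    show "Y j z 0 * of_real (cos \<beta>) = V j z 0 * of_real (sin \<beta>)"
      by (cases j) (simp_all add: Y_def U0 V0 y_ic ic)
    show "Y j z 2 = of_real a * Y j z 1 - of_real c * V j z 1"
      by (simp add: Y_def M_def)
    show "of_nat j * Y (j - 1) z 2 - W j z * unit_at_2 2 = - (of_real b * Y j z 1 - of_real d * V j z 1) - z * Y j z 2"
      by (simp add: Y_def W_def N_def unit_at_2_def)
  qed
  show ?thesis
  proof (rule that[of W])
    fix j z
    show "resolvent_eq z (\<lambda>x. of_nat j * yder (j - 1) z x - W j z * unit_at_2 x) (yder j z)"
      by (rule resolvent_eq_cong[OF relY]) (simp_all add: yderY)
  next
    fix j z x assume x: "x \<in> {0..1::real} \<union> {2}"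
    show "((\<lambda>z. yder j z x) has_field_derivative yder (Suc j) z x) (at z)"
      using dY[OF x, of j z] yderY[OF x] by simp
  qed (use Wj dW in auto)
qed

lemma DERIV_w: "((deriv ^^ j) w has_field_derivative (deriv ^^ Suc j) w z) (at z)"
  by (rule w_yhat_derivatives) metis

lemma DERIV_yder:
  "x \<in> {0..1} \<union> {2} \<Longrightarrow> ((\<lambda>z. yder j z x) has_field_derivative yder (Suc j) z x) (at z)"
  by (rule w_yhat_derivatives) blast

lemma resolvent_eq_yder: "resolvent_eq z (\<lambda>x. of_nat j * yder (j - 1) z x - (deriv ^^ j) w z * unit_at_2 x) (yder j z)"
  by (rule w_yhat_derivatives) simp

lemma yder_0: "yder 0 = yhat"
  by (simp add: yder_def fun_eq_iff)

lemma resolvent_eq_yhat: "resolvent_eq z (\<lambda>x. - w z * unit_at_2 x) (yhat z)"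
  using resolvent_eq_yder[of z 0] by (simp add: yder_0)

lemma w_holomorphic: "w holomorphic_on A"
proof (rule holomorphic_onI)
  fix z
  have "w field_differentiable at z"
    using DERIV_w[of 0 z] unfolding field_differentiable_def by auto
  then show "w field_differentiable at z within A"
    by (rule field_differentiable_at_within)
qed

lemma yhat_holomorphic:
  assumes "x \<in> {0..1} \<union> {2}"
  shows "(\<lambda>z. yhat z x) holomorphic_on A"
proof (rule holomorphic_onI)
  fix z
  have "(\<lambda>z. yhat z x) field_differentiable at z"
    using DERIV_yder[OF assms, of 0 z] unfolding field_differentiable_def yder_0 by blast
  then show "(\<lambda>z. yhat z x) field_differentiable at z within A"
    by (rule field_differentiable_at_within)
qed

text \<open>All data are real, so conjugating the solution at \<open>cnj z\<close> gives a solution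
  at \<open>z\<close> with the same initial values, and uniqueness applies.\<close>

lemma yhat_w_cnj:
  shows "x \<in> {0..1} \<union> {2} \<Longrightarrow> cnj (yhat (cnj z) x) = yhat z x" "cnj (w (cnj z)) = w z"
proof -
  have sl: "sl_system q z (\<lambda>x. 0) (\<lambda>x. cnj (y x (cnj z))) (\<lambda>x. cnj (dx (\<lambda>x. y x (cnj z)) x))"
    using sl_cnj[OF sl_y[of "cnj z"]] by simp
  have eq: "cnj (y x (cnj z)) = y x z" "cnj (dx (\<lambda>x. y x (cnj z)) x) = dx (\<lambda>x. y x z) x" if "x \<in> {0..1}" for x
    using sl_unique[OF q_cont sl sl_y[of z] _ _ that] by (simp_all add: y_ic)
  show "x \<in> {0..1} \<union> {2} \<Longrightarrow> cnj (yhat (cnj z) x) = yhat z x" "cnj (w (cnj z)) = w z"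
    using eq by (auto simp: yhat_def char_fun_def)
qed

lemma yder_w_real:
  assumes "z \<in> \<real>"
  shows "x \<in> {0..1} \<union> {2} \<Longrightarrow> cnj (yder j z x) = yder j z x" "cnj ((deriv ^^ j) w z) = (deriv ^^ j) w z"
proof -
  have z: "cnj z = z" using assms by (simp add: Reals_cnj_iff)
  show "x \<in> {0..1} \<union> {2} \<Longrightarrow> cnj (yder j z x) = yder j z x"
    using higher_deriv_cnj_real[OF yhat_holomorphic yhat_w_cnj(1), of x j z] by (simp add: yder_def z)
  show "cnj ((deriv ^^ j) w z) = (deriv ^^ j) w z"
    using higher_deriv_cnj_real[OF w_holomorphic yhat_w_cnj(2), of j z] by (simp add: z)
qed

end

section \<open>Square-integrable functions and the indefinite form\<close>

definition sq_norm :: "(real \<Rightarrow> complex) \<Rightarrow> real" where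
  "sq_norm h = integral {0..1} (\<lambda>x. (cmod (h x))\<^sup>2)"

lemma sq_norm_nonneg: "sq_norm h \<ge> 0"
  unfolding sq_norm_def
  by (cases "(\<lambda>x. (cmod (h x))\<^sup>2) integrable_on {0..1}")
    (auto simp: not_integrable_integral intro: Henstock_Kurzweil_Integration.integral_nonneg)

lemma sq_norm_cmult: "sq_norm (\<lambda>x. s * h x) = (cmod s)\<^sup>2 * sq_norm h"
  by (simp add: sq_norm_def norm_mult power_mult_distrib)

lemma sq_norm_cong: "(\<And>x. x \<in> {0..1} \<Longrightarrow> h x = g x) \<Longrightarrow> sq_norm h = sq_norm g"
  unfolding sq_norm_def by (rule integral_cong) simp

lemma sq_norm_add_le:
  assumes "continuous_on {0..1} h" "continuous_on {0..1} g"
  shows "sq_norm (\<lambda>x. h x + g x) \<le> 2 * sq_norm h + 2 * sq_norm g"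
proof -
  have "sq_norm (\<lambda>x. h x + g x) \<le> integral {0..1} (\<lambda>x. 2 * (cmod (h x))\<^sup>2 + 2 * (cmod (g x))\<^sup>2)"
    unfolding sq_norm_def
  proof (intro integral_le integrable_continuous_real continuous_intros assms)
    fix x
    have "(cmod (h x + g x))\<^sup>2 \<le> (cmod (h x) + cmod (g x))\<^sup>2"
      by (intro power_mono norm_triangle_ineq) simp
    then show "(cmod (h x + g x))\<^sup>2 \<le> 2 * (cmod (h x))\<^sup>2 + 2 * (cmod (g x))\<^sup>2"
      using sum_squares_bound[of "cmod (h x)" "cmod (g x)"] by (simp add: power2_sum)
  qed
  also have "\<dots> = 2 * sq_norm h + 2 * sq_norm g"
    unfolding sq_norm_def
    by (intro integral_unique has_integral_add has_integral_mult_right integrable_integral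
        integrable_continuous_real continuous_intros assms)
  finally show ?thesis .
qed

lemma integral_mult_cnj:
  assumes "continuous_on {0..1} h"
  shows "integral {0..1} (\<lambda>x. h x * cnj (h x)) = complex_of_real (sq_norm h)"
proof -
  have "((\<lambda>x. (cmod (h x))\<^sup>2) has_integral sq_norm h) {0..1}"
    unfolding sq_norm_def by (intro integrable_integral integrable_continuous_real continuous_intros assms)
  then have "(complex_of_real \<circ> (\<lambda>x. (cmod (h x))\<^sup>2) has_integral complex_of_real (sq_norm h)) {0..1}"
    by (rule has_integral_linear[OF _ bounded_linear_of_real])
  then show ?thesis by (intro integral_unique) (simp add: o_def complex_norm_square del: of_real_power)
qed

lemma integral_Cauchy_Schwarz:
  assumes "continuous_on {0..1} h" "continuous_on {0..1} g"
  shows "(cmod (integral {0..1} (\<lambda>x. h x * g x)))\<^sup>2 \<le> sq_norm h * sq_norm g"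
proof -
  define X where "X = integral {0..1} (\<lambda>x. cmod (h x) * cmod (g x))"
  let ?A = "sq_norm h" and ?B = "sq_norm g"
  have "cmod (integral {0..1} (\<lambda>x. h x * g x)) \<le> X"
    unfolding X_def
    by (intro integral_norm_bound_integral integrable_continuous_real continuous_intros assms)
      (simp add: norm_mult)
  moreover have "X\<^sup>2 \<le> ?A * ?B"
  proof -
    have quad: "0 \<le> s\<^sup>2 * ?A - 2 * s * X + ?B" for s
    proof -
      have "0 \<le> integral {0..1} (\<lambda>x. (s * cmod (h x) - cmod (g x))\<^sup>2)"
        by (intro integral_nonneg integrable_continuous_real continuous_intros assms) simp
      also have "\<dots> = integral {0..1} (\<lambda>x. s\<^sup>2 * (cmod (h x))\<^sup>2 - 2 * s * (cmod (h x) * cmod (g x)) + (cmod (g x))\<^sup>2)"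
        by (simp add: power2_diff power_mult_distrib algebra_simps)
      also have "\<dots> = s\<^sup>2 * ?A - 2 * s * X + ?B"
        unfolding sq_norm_def X_def
        by (intro integral_unique has_integral_add has_integral_diff has_integral_mult_right integrable_integral
            integrable_continuous_real continuous_intros assms)
      finally show ?thesis .
    qed
    show ?thesis
    proof (cases "?A = 0")
      case True
      have "X = 0"
      proof (rule ccontr)
        assume "X \<noteq> 0"
        \<comment> \<open>With leading coefficient 0 this s gives the quadratic the value
          -1.\<close>
        then show False using quad[of "(?B + 1) / (2 * X)"] True by (simp add: field_simps)
      qed
      then show ?thesis using True by simp
    next
      case False
      then have A: "?A > 0" using sq_norm_nonneg[of h] by simp
      have "(X / ?A)\<^sup>2 * ?A - 2 * (X / ?A) * X = - (X\<^sup>2 / ?A)"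
        using A by (simp add: field_simps power2_eq_square)
      then have "X\<^sup>2 / ?A \<le> ?B" using quad[of "X / ?A"] by linarith
      then show ?thesis using A by (simp add: pos_divide_le_eq mult.commute)
    qed
  qed
  ultimately show ?thesis by (meson norm_ge_zero order_trans power_mono)
qed

lemma sq_norm_eq_0:
  assumes "continuous_on {0..1} h" "sq_norm h = 0" "x \<in> {0..1}"
  shows "h x = 0"
proof -
  have "((\<lambda>x. (cmod (h x))\<^sup>2) has_integral 0) {0..1}"
    using assms(2) unfolding sq_norm_def
    by (metis assms(1) continuous_on_norm continuous_on_power integrable_continuous_real integrable_integral)
  then have "(cmod (h x))\<^sup>2 = 0"
    using has_integral_0_cbox_imp_0[of 0 1 "\<lambda>x. (cmod (h x))\<^sup>2" x] assms
    by (simp add: continuous_on_norm continuous_on_power)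
  then show ?thesis by simp
qed

context sl_char
begin

lemma continuous_yder [continuous_intros]: "continuous_on {0..1} (yder j z)"
  using resolvent_eq_continuous(2)[OF resolvent_eq_yder] .

lemma continuous_yhat [continuous_intros]: "continuous_on {0..1} (yhat z)"
  using continuous_yder[of 0] by (simp add: yder_0)

lemma continuous_unit_at_2 [continuous_intros]: "continuous_on {0..1} unit_at_2"
  by (rule continuous_on_eq[of _ "\<lambda>x. 0"]) (auto simp: unit_at_2_def)

lemma indef_form_unit_at_2: "indef_form unit_at_2 h = h 2 / Delta"
proof -
  have "integral {0..1} (\<lambda>x. unit_at_2 x * h x) = integral {0..1} (\<lambda>x::real. 0)"
    by (rule integral_cong) (auto simp: unit_at_2_def)
  then show ?thesis by (simp add: indef_form_def unit_at_2_def)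
qed

lemma indef_form_cong:
  assumes "\<And>x. x \<in> {0..1} \<union> {2} \<Longrightarrow> h x = h' x" "\<And>x. x \<in> {0..1} \<union> {2} \<Longrightarrow> g x = g' x"
  shows "indef_form h g = indef_form h' g'"
proof -
  have "integral {0..1} (\<lambda>x. h x * g x) = integral {0..1} (\<lambda>x. h' x * g' x)"
    by (rule integral_cong) (simp add: assms)
  then show ?thesis using assms by (simp add: indef_form_def)
qed

lemma indef_form_yhat_eq_0:
  assumes "w z = 0" "w z' = 0" "z \<noteq> z'"
  shows "indef_form (yhat z) (yhat z') = 0"
proof -
  have "indef_form (\<lambda>x. 0) h = 0" for h by (simp add: indef_form_def)
  then show ?thesis
    using resolvent_eq_form[OF resolvent_eq_yhat resolvent_eq_yhat, of z z'] assms by (simp add: indef_form_commute[of "yhat z" "\<lambda>x. 0"])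
qed

text \<open>Symmetry with both spectral parameters equal to \<open>z\<close>: the term with their
  difference drops out, and what remains is a recursion along antidiagonals of the Gram
  matrix.\<close>

lemma indef_form_yder_yder:
  assumes "i > 0"
  shows "of_nat i * indef_form (yder (i - 1) z) (yder j z) - (deriv ^^ i) w z * yder j z 2 / Delta =
    of_nat j * indef_form (yder i z) (yder (j - 1) z) - (deriv ^^ j) w z * yder i z 2 / Delta"
proof -
  have "indef_form (\<lambda>x. of_nat n * yder (n - 1) z x - s * unit_at_2 x) (yder m z) =
      of_nat n * indef_form (yder (n - 1) z) (yder m z) - s * yder m z 2 / Delta" for n m s
    using indef_form_linear[of "yder (n - 1) z" unit_at_2 "yder m z" "of_nat n" "- s"]
    by (simp add: continuous_intros indef_form_unit_at_2)
  then show ?thesis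
    using resolvent_eq_form[OF resolvent_eq_yder[of z i] resolvent_eq_yder[of z j]]
    by (simp add: indef_form_commute[of "yder i z" "\<lambda>x. _ x"])
qed

text \<open>The case (1, 0) of the recursion. It shows that an eigenvector at a multiple zero is
  neutral.\<close>

lemma indef_form_yhat_self:
  assumes "w z = 0"
  shows "indef_form (yhat z) (yhat z) = deriv w z * yhat z 2 / Delta"
  using indef_form_yder_yder[of 1 z 0] assms by (simp add: yder_0)

text \<open>Induction along the chain: symmetry expresses \<open>z - z'\<close> times one entry
  through the entry one level lower.\<close>

lemma indef_form_yder_yhat_eq_0:
  assumes "\<And>i. i \<le> j \<Longrightarrow> (deriv ^^ i) w z = 0" "w z' = 0" "z \<noteq> z'"
  shows "indef_form (yder j z) (yhat z') = 0"
  using assms(1)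
proof (induction j)
  case 0
  then show ?case using indef_form_yhat_eq_0[of z z'] assms by (auto simp: yder_0)
next
  case (Suc j)
  have "indef_form (\<lambda>x. of_nat (Suc j) * yder j z x) (yhat z') = of_nat (Suc j) * indef_form (yder j z) (yhat z')"
    using indef_form_linear[of "yder j z" "yder j z" "yhat z'" "of_nat (Suc j)" 0] by (simp add: continuous_intros)
  also have "\<dots> = 0" using Suc by simp
  finally show ?case
    using resolvent_eq_form[OF resolvent_eq_yder[of z "Suc j"] resolvent_eq_yhat[of z']] assms(2,3) Suc.prems[of "Suc j"]
    by (simp add: indef_form_def)
qed

text \<open>Were the scalar component 0, the form of the real eigenvector with itself would be its
  squared L2 norm and, by \<open>indef_form_yhat_self\<close>, also 0. The vanishing eigenfunction
  contradicts the initial data, as sine and cosine have no common zero.\<close>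

lemma yhat_2_nonzero:
  assumes z: "z \<in> \<real>" and zero: "w z = 0"
  shows "yhat z 2 \<noteq> 0"
proof
  assume 0: "yhat z 2 = 0"
  have "indef_form (yhat z) (yhat z) = integral {0..1} (\<lambda>x. yhat z x * cnj (yhat z x))"
    unfolding indef_form_def using 0 yder_w_real(1)[OF z, of _ 0]
    by (auto simp: yder_0 intro!: Henstock_Kurzweil_Integration.integral_cong)
  then have "complex_of_real (sq_norm (yhat z)) = 0"
    using indef_form_yhat_self[OF zero] 0 integral_mult_cnj[OF continuous_yhat, of z] by simp
  then have "yhat z x = 0" if "x \<in> {0..1}" for x
    using sq_norm_eq_0[OF continuous_yhat _ that] by simp
  then have y0: "y x z = 0" if "x \<in> {0..1}" for x
    using that by (force simp: yhat_def)
  have "((\<lambda>x. y x z) has_vector_derivative 0) (at 0 within {0..1})"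
    by (rule has_vector_derivative_transform[of 0 _ _ "\<lambda>x. 0"]) (auto simp: y0)
  then have "dx (\<lambda>x. y x z) 0 = 0"
    unfolding dx_def by (intro vector_derivative_within_cbox[of 0 1, simplified]) auto
  then have "cos \<beta> = 0" "sin \<beta> = 0"
    using y_ic[of z] y0[of 0] by auto
  then show False using sin_cos_squared_add[of \<beta>] by simp
qed

end

section \<open>A triple zero\<close>

locale sl_triple = sl_char +
  fixes l :: complex
  assumes l_real: "l \<in> \<real>"
    and w_low: "\<And>i. i < 3 \<Longrightarrow> (deriv ^^ i) w l = 0"
    and w_3: "(deriv ^^ 3) w l \<noteq> 0"
begin

text \<open>Taylor coefficients instead of derivatives: they agree with \<open>assoc1\<close> and
  \<open>assoc2\<close> on [0,1], and A - l maps \<open>Y 2\<close> to \<open>Y 1\<close>,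
  \<open>Y 1\<close> to \<open>Y 0\<close> and \<open>Y 0\<close> to 0.\<close>

definition Y :: "nat \<Rightarrow> real \<Rightarrow> complex" where "Y j x = yder j l x / fact j"
definition w_coeff :: "nat \<Rightarrow> complex" where "w_coeff j = (deriv ^^ j) w l / fact j"

lemma w_coeff_low: "w_coeff 0 = 0" "w_coeff (Suc 0) = 0" "w_coeff 2 = 0" and w_coeff_3: "w_coeff 3 \<noteq> 0"
  using w_low[of 0] w_low[of 1] w_low[of 2] w_3 by (simp_all add: w_coeff_def)

lemma continuous_Y [continuous_intros]: "continuous_on {0..1} (Y j)"
  unfolding Y_def[abs_def] divide_inverse by (intro continuous_intros)

lemma cnj_Y: "x \<in> {0..1} \<union> {2} \<Longrightarrow> cnj (Y j x) = Y j x" and cnj_w_coeff: "cnj (w_coeff j) = w_coeff j"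
  using yder_w_real(1)[OF l_real, of x j] yder_w_real(2)[OF l_real, of j] by (simp_all add: Y_def w_coeff_def)

lemma indef_form_Y_yder: "indef_form (Y i) (Y j) = indef_form (yder i l) (yder j l) / (fact i * fact j)"
proof -
  have "indef_form (Y i) g = indef_form (yder i l) g / fact i" if "continuous_on {0..1} g" for i g
    using indef_form_linear[of "yder i l" "yder i l" g "1 / fact i" 0] that
    by (simp add: continuous_intros Y_def[abs_def])
  from this[OF continuous_Y, of i j] this[OF continuous_yder, of j i l] show ?thesis
    by (simp add: indef_form_commute[of "yder i l"])
qed

lemma indef_form_Y_Suc: "indef_form (Y i) (Y (Suc j)) - w_coeff (Suc i) * Y (Suc j) 2 / Delta
    = indef_form (Y (Suc i)) (Y j) - w_coeff (Suc j) * Y (Suc i) 2 / Delta"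
proof -
  have eq: "F / (p * r) - W / (n * p) * (M / r) / Delta = (n * F - W * M / Delta) / (n * p * r)"
    if "n \<noteq> 0" "p \<noteq> 0" "r \<noteq> 0" for n p r F W M :: complex
    using that Delta_nonzero by (simp add: field_simps)
  have "indef_form (Y i) (Y (Suc j)) - w_coeff (Suc i) * Y (Suc j) 2 / Delta =
     (of_nat (Suc i) * indef_form (yder i l) (yder (Suc j) l) - (deriv ^^ Suc i) w l * yder (Suc j) l 2 / Delta)
       / (of_nat (Suc i) * fact i * fact (Suc j))"
    unfolding indef_form_Y_yder w_coeff_def Y_def fact_Suc[of i]
    by (rule eq) (simp_all del: of_nat_Suc)
  also have "\<dots> = (of_nat (Suc j) * indef_form (yder j l) (yder (Suc i) l) - (deriv ^^ Suc j) w l * yder (Suc i) l 2 / Delta)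
       / (of_nat (Suc j) * fact j * fact (Suc i))"
    using indef_form_yder_yder[of "Suc i" l "Suc j"]
    by (simp add: indef_form_commute[of "yder j l"] mult_ac del: of_nat_Suc funpow.simps)
  also have "\<dots> = indef_form (Y j) (Y (Suc i)) - w_coeff (Suc j) * Y (Suc i) 2 / Delta"
    unfolding indef_form_Y_yder w_coeff_def Y_def fact_Suc[of j]
    by (rule eq[symmetric]) (simp_all del: of_nat_Suc)
  finally show ?thesis by (simp add: indef_form_commute)
qed

lemma indef_form_Y_0: "indef_form (Y i) (Y 0) = w_coeff (Suc i) * Y 0 2 / Delta"
proof -
  have "of_nat (Suc i) * indef_form (yder i l) (yder 0 l) = (deriv ^^ Suc i) w l * yder 0 l 2 / Delta"
    using indef_form_yder_yder[of "Suc i" l 0] w_low[of 0] by simp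
  then have "indef_form (yder i l) (yder 0 l) = (deriv ^^ Suc i) w l * yder 0 l 2 / Delta / of_nat (Suc i)"
    by (metis nonzero_mult_div_cancel_left of_nat_eq_0_iff nat.distinct(1))
  then show ?thesis unfolding indef_form_Y_yder w_coeff_def Y_def
    by (simp del: of_nat_Suc funpow.simps)
qed

text \<open>The recursion moves each entry along its antidiagonal to the column of
  \<open>Y 0\<close>, where it is explicit. The entry (2, 2) passes through (3, 1) and (4, 0), so
  \<open>Y 3\<close> and \<open>Y 4\<close> occur although they lie outside the Jordan
  chain.\<close>

lemma gram:
  "indef_form (Y 0) (Y 0) = 0" "indef_form (Y 1) (Y 0) = 0" "indef_form (Y 2) (Y 0) = w_coeff 3 * Y 0 2 / Delta"
  "indef_form (Y 1) (Y 1) = w_coeff 3 * Y 0 2 / Delta"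
  "indef_form (Y 2) (Y 1) = (w_coeff 4 * Y 0 2 + w_coeff 3 * Y 1 2) / Delta"
  "indef_form (Y 2) (Y 2) = (w_coeff 5 * Y 0 2 + w_coeff 4 * Y 1 2 + w_coeff 3 * Y 2 2) / Delta"
proof -
  have n: "Suc 0 = 1" "Suc 1 = 2" "Suc 2 = 3" "Suc 3 = 4" "Suc 4 = 5" by simp_all
  have 0: "indef_form (Y 0) (Y 0) = 0" "indef_form (Y 1) (Y 0) = 0" "indef_form (Y 2) (Y 0) = w_coeff 3 * Y 0 2 / Delta"
    "indef_form (Y 3) (Y 0) = w_coeff 4 * Y 0 2 / Delta" "indef_form (Y 4) (Y 0) = w_coeff 5 * Y 0 2 / Delta"
    using indef_form_Y_0[of 0] indef_form_Y_0[of 1] indef_form_Y_0[of 2] indef_form_Y_0[of 3] indef_form_Y_0[of 4] w_coeff_low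
    unfolding n by simp_all
  have 1: "indef_form (Y 1) (Y 1) = w_coeff 3 * Y 0 2 / Delta" "indef_form (Y 2) (Y 1) = (w_coeff 4 * Y 0 2 + w_coeff 3 * Y 1 2) / Delta"
    "indef_form (Y 3) (Y 1) = (w_coeff 5 * Y 0 2 + w_coeff 4 * Y 1 2) / Delta"
    using indef_form_Y_Suc[of 1 0] indef_form_Y_Suc[of 2 0] indef_form_Y_Suc[of 3 0] w_coeff_low 0
    unfolding n by (simp_all add: add_divide_distrib algebra_simps)
  have 2: "indef_form (Y 2) (Y 2) = (w_coeff 5 * Y 0 2 + w_coeff 4 * Y 1 2 + w_coeff 3 * Y 2 2) / Delta"
    using indef_form_Y_Suc[of 2 1] w_coeff_low 1
    unfolding n by (simp add: add_divide_distrib algebra_simps)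
  show "indef_form (Y 0) (Y 0) = 0" "indef_form (Y 1) (Y 0) = 0" "indef_form (Y 2) (Y 0) = w_coeff 3 * Y 0 2 / Delta"
    "indef_form (Y 1) (Y 1) = w_coeff 3 * Y 0 2 / Delta"
    "indef_form (Y 2) (Y 1) = (w_coeff 4 * Y 0 2 + w_coeff 3 * Y 1 2) / Delta"
    "indef_form (Y 2) (Y 2) = (w_coeff 5 * Y 0 2 + w_coeff 4 * Y 1 2 + w_coeff 3 * Y 2 2) / Delta"
    using 0 1 2 by simp_all
qed

lemma Y_0_2: "Y 0 2 \<noteq> 0"
  using yhat_2_nonzero[OF l_real] w_low[of 0] by (simp add: Y_def yder_0)

lemma indef_form_Y_yhat_eq_0:
  assumes "w z = 0" "z \<noteq> l" "j < 3"
  shows "indef_form (Y j) (yhat z) = 0"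
proof -
  have "indef_form (yder j l) (yhat z) = 0"
    using assms w_low by (intro indef_form_yder_yhat_eq_0) auto
  then show ?thesis
    using indef_form_linear[of "yder j l" "yder j l" "yhat z" "1 / fact j" 0]
    by (simp add: continuous_intros Y_def[abs_def])
qed

text \<open>
  \<open>Y 0\<close> is neutral, so on its orthogonal complement the form only sees the part \<open>perp h\<close>, which
  lives in \<open>L\<^sub>2(0,1)\<close>; hence the form is nonnegative there.
\<close>

definition perp :: "(real \<Rightarrow> complex) \<Rightarrow> real \<Rightarrow> complex" where
  "perp h x = h x - h 2 / Y 0 2 * Y 0 x"

definition E :: "(real \<Rightarrow> complex) \<Rightarrow> real" where "E h = sq_norm (perp h)"

lemma E_nonneg: "E h \<ge> 0"
  by (simp add: E_def sq_norm_nonneg)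

lemma continuous_perp: "continuous_on {0..1} h \<Longrightarrow> continuous_on {0..1} (perp h)"
  unfolding perp_def[abs_def] by (intro continuous_intros)

lemma perp_2: "perp h 2 = 0"
  using Y_0_2 by (simp add: perp_def)

lemma indef_form_perp:
  assumes "continuous_on {0..1} h" "continuous_on {0..1} g"
  shows "indef_form (perp h) g = indef_form h g - h 2 / Y 0 2 * indef_form (Y 0) g"
  using indef_form_linear[of h "Y 0" g 1 "- (h 2 / Y 0 2)"] assms
  by (simp add: continuous_intros perp_def[abs_def])

lemma indef_form_eq_integral_perp:
  assumes "continuous_on {0..1} h" "continuous_on {0..1} g" "indef_form h (Y 0) = 0" "indef_form g (Y 0) = 0"
  shows "indef_form h g = integral {0..1} (\<lambda>x. perp h x * perp g x)"
proof -
  have 0: "indef_form (perp g) (Y 0) = 0"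
    using indef_form_perp[OF assms(2) continuous_Y, of 0] assms(4) gram(1) by simp
  have "indef_form (perp h) (perp g) = indef_form h (perp g)"
    using indef_form_perp[OF assms(1) continuous_perp[OF assms(2)]] 0 by (simp add: indef_form_commute[of "Y 0"])
  also have "\<dots> = indef_form (perp g) h" by (rule indef_form_commute)
  also have "\<dots> = indef_form g h"
    using indef_form_perp[OF assms(2,1)] assms(3) by (simp add: indef_form_commute[of "Y 0"])
  finally have "indef_form h g = indef_form (perp h) (perp g)" by (simp add: indef_form_commute)
  also have "\<dots> = integral {0..1} (\<lambda>x. perp h x * perp g x)"
    by (simp add: indef_form_def perp_2)
  finally show ?thesis .
qed

lemma indef_form_perp_Cauchy_Schwarz:
  assumes "continuous_on {0..1} h" "continuous_on {0..1} g" "indef_form h (Y 0) = 0" "indef_form g (Y 0) = 0"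
  shows "(cmod (indef_form h g))\<^sup>2 \<le> E h * E g"
  unfolding indef_form_eq_integral_perp[OF assms] E_def
  by (intro integral_Cauchy_Schwarz continuous_perp assms)

lemma indef_form_perp_cnj:
  assumes "continuous_on {0..1} h" "indef_form h (Y 0) = 0"
  shows "indef_form h (\<lambda>x. cnj (h x)) = of_real (E h)"
proof -
  have "indef_form (\<lambda>x. cnj (h x)) (Y 0) = indef_form (\<lambda>x. cnj (h x)) (\<lambda>x. cnj (Y 0 x))"
    by (rule indef_form_cong) (simp_all add: cnj_Y)
  also have "\<dots> = 0" using indef_form_cnj[OF assms(1) continuous_Y] assms(2) by simp
  finally have "indef_form h (\<lambda>x. cnj (h x)) = integral {0..1} (\<lambda>x. perp h x * perp (\<lambda>x. cnj (h x)) x)"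
    using assms by (intro indef_form_eq_integral_perp continuous_intros)
  also have "\<dots> = integral {0..1} (\<lambda>x. perp h x * cnj (perp h x))"
    by (intro Henstock_Kurzweil_Integration.integral_cong) (simp add: perp_def cnj_Y)
  also have "\<dots> = of_real (E h)"
    unfolding E_def by (intro integral_mult_cnj continuous_perp assms)
  finally show ?thesis .
qed

text \<open>\<open>E\<close> ignores multiples of \<open>Y 0\<close> and controls \<open>h\<close>
  only modulo them. Orthogonality to \<open>Y 2\<close> fixes the multiple, because
  \<open>Y 2\<close> and \<open>Y 0\<close> have a nonzero pairing.\<close>

lemma E_coercive:
  obtains K where "K > 0"
    "\<And>h. continuous_on {0..1} h \<Longrightarrow> indef_form h (Y 0) = 0 \<Longrightarrow> indef_form h (Y 2) = 0 \<Longrightarrow>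
        (cmod (h 2))\<^sup>2 \<le> K * E h \<and> sq_norm h \<le> K * E h"
proof -
  define g where "g = indef_form (Y 2) (Y 0)"
  have g: "g \<noteq> 0" using gram(3) w_coeff_3 Y_0_2 Delta_nonzero by (simp add: g_def)
  \<comment> \<open>From Cauchy-Schwarz for \<open>perp h\<close> and \<open>Y 2\<close>: the
    squared coefficient of \<open>Y 0\<close> in \<open>h\<close> is at most
    \<open>K1 * E h\<close>. \<open>K\<close> adds up what the two claims need.\<close>
  define K1 where "K1 = sq_norm (Y 2) / (cmod g)\<^sup>2"
  have K1: "K1 \<ge> 0" using sq_norm_nonneg by (simp add: K1_def)
  define K where "K = 2 + 2 * K1 * sq_norm (Y 0) + (cmod (Y 0 2))\<^sup>2 * K1"
  have K_pos: "K > 0" using K1 sq_norm_nonneg[of "Y 0"] by (simp add: K_def add_pos_nonneg)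
  have "(cmod (h 2))\<^sup>2 \<le> K * E h \<and> sq_norm h \<le> K * E h"
    if h: "continuous_on {0..1} h" "indef_form h (Y 0) = 0" "indef_form h (Y 2) = 0" for h
  proof -
    define t where "t = h 2 / Y 0 2"
    have "indef_form (perp h) (Y 2) = - (t * g)"
      using indef_form_perp[OF h(1) continuous_Y, of 2] h(3) by (simp add: t_def g_def indef_form_commute[of "Y 0"])
    moreover have "indef_form (perp h) (Y 2) = integral {0..1} (\<lambda>x. perp h x * Y 2 x)"
      by (simp add: indef_form_def perp_2)
    ultimately have "(cmod (t * g))\<^sup>2 \<le> E h * sq_norm (Y 2)"
      using integral_Cauchy_Schwarz[OF continuous_perp[OF h(1)] continuous_Y, of 2] by (simp add: E_def)
    then have t: "(cmod t)\<^sup>2 \<le> K1 * E h"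
      using g by (simp add: K1_def norm_mult power_mult_distrib field_simps)
    have "(cmod (h 2))\<^sup>2 = (cmod (Y 0 2))\<^sup>2 * (cmod t)\<^sup>2"
      using Y_0_2 by (simp add: t_def norm_divide power_divide)
    also have "\<dots> \<le> (cmod (Y 0 2))\<^sup>2 * (K1 * E h)"
      using t by (intro mult_left_mono) auto
    also have "\<dots> \<le> K * E h"
      using K1 E_nonneg[of h] sq_norm_nonneg[of "Y 0"] by (simp add: K_def algebra_simps)
    finally have "(cmod (h 2))\<^sup>2 \<le> K * E h" .
    moreover have "sq_norm h \<le> K * E h"
    proof -
      have "sq_norm h = sq_norm (\<lambda>x. perp h x + t * Y 0 x)"
        by (intro sq_norm_cong) (simp add: perp_def t_def)
      also have "\<dots> \<le> 2 * sq_norm (perp h) + 2 * sq_norm (\<lambda>x. t * Y 0 x)"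
        by (intro sq_norm_add_le continuous_perp h continuous_intros)
      also have "\<dots> = 2 * E h + 2 * (cmod t)\<^sup>2 * sq_norm (Y 0)"
        by (simp add: E_def sq_norm_cmult)
      also have "\<dots> \<le> 2 * E h + 2 * (K1 * E h) * sq_norm (Y 0)"
        using t sq_norm_nonneg[of "Y 0"] by (intro add_left_mono mult_right_mono mult_left_mono) auto
      also have "\<dots> \<le> K * E h"
        using K1 E_nonneg[of h] by (simp add: K_def algebra_simps)
      finally show ?thesis .
    qed
    ultimately show ?thesis by blast
  qed
  with K_pos show ?thesis by (rule that)
qed

section \<open>The remainder of the root vector expansion and its resolvent\<close>

definition simple_zeros :: "complex set \<Rightarrow> bool" where
  "simple_zeros L \<longleftrightarrow> finite L \<and> (\<forall>m\<in>L. m \<in> \<real> \<and> w m = 0 \<and> m \<noteq> l \<and> deriv w m \<noteq> 0)"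

text \<open>
  \<open>(z - l)\<^sup>3 / w z = (1 + c1 (z - l) + c0 (z - l)\<^sup>2 + \<dots>) / w_coeff 3\<close>, so the combination of the \<open>Y j\<close>
  in \<open>residual\<close> is the residue of \<open>yhat z / w z\<close> at \<open>l\<close>. The other summands are the residues at
  simple zeros: \<open>residual L\<close> is the remainder of the expansion of \<open>unit_at_2\<close> in root vectors.
\<close>

definition c1 :: complex where "c1 = - w_coeff 4 / w_coeff 3"
definition c0 :: complex where "c0 = (w_coeff 4 / w_coeff 3)\<^sup>2 - w_coeff 5 / w_coeff 3"

definition residual :: "complex set \<Rightarrow> real \<Rightarrow> complex" where
  "residual L x = unit_at_2 x - (Y 2 x + c1 * Y 1 x + c0 * Y 0 x) / w_coeff 3 - (\<Sum>m\<in>L. 1 / deriv w m * yhat m x)"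

text \<open>\<open>G L z\<close> is \<open>(A - z)\<^sup>-\<^sup>1\<close> applied to \<open>residual L\<close>; the coefficients invert the Jordan block at \<open>l\<close>.\<close>

definition a2 :: "complex \<Rightarrow> complex" where "a2 z = 1 / (w_coeff 3 * (z - l))"
definition a1 :: "complex \<Rightarrow> complex" where "a1 z = (1 / (z - l)\<^sup>2 + c1 / (z - l)) / w_coeff 3"
definition a0 :: "complex \<Rightarrow> complex" where "a0 z = (1 / (z - l) ^ 3 + c1 / (z - l)\<^sup>2 + c0 / (z - l)) / w_coeff 3"

definition G :: "complex set \<Rightarrow> complex \<Rightarrow> real \<Rightarrow> complex" where
  "G L z x = a2 z * Y 2 x + a1 z * Y 1 x + a0 z * Y 0 x - yhat z x / w z
     - (\<Sum>m\<in>L. 1 / (deriv w m * (m - z)) * yhat m x)"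

lemma indef_form_residual:
  assumes h: "continuous_on {0..1} h" and L: "finite L"
  shows "indef_form (residual L) h = h 2 / Delta - (indef_form (Y 2) h + c1 * indef_form (Y 1) h + c0 * indef_form (Y 0) h) / w_coeff 3
    - (\<Sum>m\<in>L. 1 / deriv w m * indef_form (yhat m) h)"
proof -
  define S where "S x = (\<Sum>m\<in>L. 1 / deriv w m * yhat m x)" for x
  have S: "continuous_on {0..1} S" unfolding S_def[abs_def] by (intro continuous_intros)
  have 1: "indef_form (\<lambda>x. 1 * Y 2 x + c1 * Y 1 x) h = 1 * indef_form (Y 2) h + c1 * indef_form (Y 1) h"
    by (intro indef_form_linear continuous_intros h)
  have 2: "indef_form (\<lambda>x. 1 / w_coeff 3 * (1 * Y 2 x + c1 * Y 1 x) + c0 / w_coeff 3 * Y 0 x) h =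
      1 / w_coeff 3 * indef_form (\<lambda>x. 1 * Y 2 x + c1 * Y 1 x) h + c0 / w_coeff 3 * indef_form (Y 0) h"
    by (intro indef_form_linear continuous_intros h)
  have 3: "indef_form (\<lambda>x. 1 * (1 / w_coeff 3 * (1 * Y 2 x + c1 * Y 1 x) + c0 / w_coeff 3 * Y 0 x) + 1 * S x) h =
      1 * indef_form (\<lambda>x. 1 / w_coeff 3 * (1 * Y 2 x + c1 * Y 1 x) + c0 / w_coeff 3 * Y 0 x) h + 1 * indef_form S h"
    by (intro indef_form_linear continuous_intros h S)
  have 4: "indef_form (\<lambda>x. 1 * unit_at_2 x + (-1) * (1 * (1 / w_coeff 3 * (1 * Y 2 x + c1 * Y 1 x) + c0 / w_coeff 3 * Y 0 x) + 1 * S x)) h =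
      1 * indef_form unit_at_2 h + (-1) * indef_form (\<lambda>x. 1 * (1 / w_coeff 3 * (1 * Y 2 x + c1 * Y 1 x) + c0 / w_coeff 3 * Y 0 x) + 1 * S x) h"
    by (intro indef_form_linear continuous_intros h S)
  have "residual L = (\<lambda>x. 1 * unit_at_2 x + (-1) * (1 * (1 / w_coeff 3 * (1 * Y 2 x + c1 * Y 1 x) + c0 / w_coeff 3 * Y 0 x) + 1 * S x))"
    by (simp add: residual_def S_def fun_eq_iff add_divide_distrib algebra_simps)
  moreover have "indef_form S h = (\<Sum>m\<in>L. 1 / deriv w m * indef_form (yhat m) h)"
    unfolding S_def[abs_def] by (intro indef_form_sum L h continuous_intros)
  ultimately show ?thesis
    using 4 unfolding 3 2 1 indef_form_unit_at_2 by (simp add: add_divide_distrib algebra_simps)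
qed

lemma continuous_residual [continuous_intros]: "continuous_on {0..1} (residual L)"
  unfolding residual_def[abs_def] divide_inverse by (intro continuous_intros)

text \<open>Subtracting the residue at \<open>l\<close> is the form-orthogonal projection along the
  root space: \<open>c1\<close> and \<open>c0\<close> solve the triangular system given by the Gram
  matrix with right-hand side \<open>Y j 2 / Delta\<close>.\<close>

lemma residual_perp_Y:
  assumes L: "simple_zeros L" and j: "j < 3"
  shows "indef_form (residual L) (Y j) = 0"
proof -
  have "(\<Sum>m\<in>L. 1 / deriv w m * indef_form (yhat m) (Y j)) = 0"
    using L j indef_form_Y_yhat_eq_0 by (intro sum.neutral) (auto simp: simple_zeros_def indef_form_commute[of "yhat _"])
  then have *: "indef_form (residual L) (Y j) = Y j 2 / Delta - (indef_form (Y 2) (Y j) + c1 * indef_form (Y 1) (Y j) + c0 * indef_form (Y 0) (Y j)) / w_coeff 3"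
    using indef_form_residual[OF continuous_Y, of L j] L by (simp add: simple_zeros_def)
  note comm = indef_form_commute[of "Y 0" "Y 1"] indef_form_commute[of "Y 0" "Y 2"] indef_form_commute[of "Y 1" "Y 2"]
  have "j = 0 \<or> j = 1 \<or> j = 2" using j by linarith
  then show ?thesis
  proof (elim disjE)
    assume j: "j = 0"
    show ?thesis using w_coeff_3 unfolding *[unfolded j] j gram by simp
  next
    assume j: "j = 1"
    show ?thesis using w_coeff_3 Delta_nonzero unfolding *[unfolded j] j comm gram c1_def c0_def
      by (simp add: field_simps)
  next
    assume j: "j = 2"
    show ?thesis using w_coeff_3 Delta_nonzero unfolding *[unfolded j] j comm gram c1_def c0_def
      by (simp add: field_simps power2_eq_square)
  qed
qed

lemma residual_perp_yhat:
  assumes L: "simple_zeros L" and m: "m \<in> L"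
  shows "indef_form (residual L) (yhat m) = 0"
proof -
  have fin: "finite L" and z: "w m = 0" "m \<noteq> l" "deriv w m \<noteq> 0"
    using assms by (auto simp: simple_zeros_def)
  have "(\<Sum>n\<in>L. 1 / deriv w n * indef_form (yhat n) (yhat m)) = (\<Sum>n\<in>L. if n = m then yhat m 2 / Delta else 0)"
  proof (rule sum.cong)
    fix n assume "n \<in> L"
    then show "1 / deriv w n * indef_form (yhat n) (yhat m) = (if n = m then yhat m 2 / Delta else 0)"
      using indef_form_yhat_eq_0[of n m] indef_form_yhat_self[OF z(1)] z L by (auto simp: simple_zeros_def)
  qed simp
  also have "\<dots> = yhat m 2 / Delta" using fin m by simp
  finally show ?thesis
    using indef_form_residual[OF continuous_yhat fin, of m] indef_form_Y_yhat_eq_0[OF z(1,2)] by simp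
qed

text \<open>Against such \<open>h\<close> only the summand \<open>unit_at_2\<close> of the remainder
  survives. With \<open>h\<close> equal to \<open>G L z\<close> or to the remainder itself, the
  quantities to be estimated become scalar components.\<close>

lemma indef_form_residual_collapse:
  assumes L: "simple_zeros L" and h: "continuous_on {0..1} h"
    and perp: "\<And>j. j < 3 \<Longrightarrow> indef_form h (Y j) = 0" "\<And>m. m \<in> L \<Longrightarrow> indef_form h (yhat m) = 0"
  shows "indef_form (residual L) h = h 2 / Delta"
  using indef_form_residual[OF h, of L] L perp(1)[of 0] perp(1)[of 1] perp(1)[of 2] perp(2)
  by (simp add: simple_zeros_def indef_form_commute[of _ h])

lemma residual_cnj:
  assumes L: "simple_zeros L" and x: "x \<in> {0..1} \<union> {2}"
  shows "cnj (residual L x) = residual L x"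
proof -
  have "cnj (deriv w m) = deriv w m \<and> cnj (yhat m x) = yhat m x" if "m \<in> L" for m
    using yder_w_real(1)[of m x 0] yder_w_real(2)[of m 1] x L that by (auto simp: simple_zeros_def yder_0)
  then show ?thesis
    unfolding residual_def by (simp add: cnj_Y[OF x] cnj_w_coeff c1_def c0_def unit_at_2_def)
qed

lemma resolvent_eq_Y: "resolvent_eq l (\<lambda>x. 0) (Y 0)" "resolvent_eq l (Y 0) (Y 1)" "resolvent_eq l (Y 1) (Y 2)"
proof -
  have Yd: "resolvent_eq l (\<lambda>x. of_nat j * (yder (j - 1) l x / fact j) - w_coeff j * unit_at_2 x) (Y j)" for j
    using resolvent_eq_linear[OF resolvent_eq_yder[of l j] resolvent_eq_yder[of l j], of "1 / fact j" 0]
    unfolding Y_def[abs_def] w_coeff_def by (simp add: diff_divide_distrib)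
  show "resolvent_eq l (\<lambda>x. 0) (Y 0)" by (rule resolvent_eq_cong[OF Yd[of 0]]) (simp_all add: w_coeff_low)
  show "resolvent_eq l (Y 0) (Y 1)" by (rule resolvent_eq_cong[OF Yd[of 1]]) (simp_all add: w_coeff_low Y_def)
  show "resolvent_eq l (Y 1) (Y 2)" by (rule resolvent_eq_cong[OF Yd[of 2]]) (simp_all add: w_coeff_low Y_def)
qed

text \<open>\<open>- yhat z / w z\<close> accounts for (0,1), each eigenvector is scaled by 1 / (m -
  z), and the three identities for \<open>a2\<close>, \<open>a1\<close>, \<open>a0\<close> compare
  the coefficients of \<open>Y 2\<close>, \<open>Y 1\<close>, \<open>Y 0\<close>.\<close>

lemma resolvent_eq_residual_G:
  assumes L: "simple_zeros L" and z: "w z \<noteq> 0"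
  shows "resolvent_eq z (residual L) (G L z)"
proof -
  have zl: "z \<noteq> l" using z w_low[of 0] by auto
  have fin: "finite L" and zL: "z \<notin> L" using L z by (auto simp: simple_zeros_def)
  note resolvent_eq_Y[THEN resolvent_eq_shift, of z]
  then
  have r: "resolvent_eq z (\<lambda>x. (l - z) * Y 0 x) (Y 0)" "resolvent_eq z (\<lambda>x. Y 0 x + (l - z) * Y 1 x) (Y 1)"
    "resolvent_eq z (\<lambda>x. Y 1 x + (l - z) * Y 2 x) (Y 2)" by simp_all
  have rm: "resolvent_eq z (\<lambda>x. (m - z) * yhat m x) (yhat m)" if "m \<in> L" for m
    using resolvent_eq_shift[OF resolvent_eq_yhat[of m], of z] that L by (simp add: simple_zeros_def)
  have sum: "resolvent_eq z (\<lambda>x. \<Sum>m\<in>L. 1 / (deriv w m * (m - z)) * ((m - z) * yhat m x))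
      (\<lambda>x. \<Sum>m\<in>L. 1 / (deriv w m * (m - z)) * yhat m x)"
    by (rule resolvent_eq_sum[OF fin rm])
  note r2 = resolvent_eq_linear[OF resolvent_eq_linear[OF r(3,2), of "a2 z" "a1 z"] r(1), of 1 "a0 z"]
  note r3 = resolvent_eq_linear[OF resolvent_eq_linear[OF r2 resolvent_eq_yhat[of z], of 1 "- 1 / w z"] sum, of 1 "- 1"]
  show ?thesis
  proof (rule resolvent_eq_cong[OF r3])
    fix x
    have "(\<Sum>m\<in>L. 1 / (deriv w m * (m - z)) * ((m - z) * yhat m x)) = (\<Sum>m\<in>L. 1 / deriv w m * yhat m x)"
      using zL by (intro sum.cong) (auto simp: divide_simps)
    moreover have "a2 z * (l - z) = - 1 / w_coeff 3" "a2 z + a1 z * (l - z) = - c1 / w_coeff 3"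
      "a1 z + a0 z * (l - z) = - c0 / w_coeff 3"
    proof -
      define t where "t = z - l"
      have t: "t \<noteq> 0" "l - z = - t" "z - l = t" using zl by (simp_all add: t_def)
      show "a2 z * (l - z) = - 1 / w_coeff 3" "a2 z + a1 z * (l - z) = - c1 / w_coeff 3"
        "a1 z + a0 z * (l - z) = - c0 / w_coeff 3"
        unfolding a2_def a1_def a0_def t(2,3) using t(1) w_coeff_3
        by (simp_all add: field_simps power2_eq_square power3_eq_cube)
    qed
    then have "1 * (a2 z * (Y 1 x + (l - z) * Y 2 x) + a1 z * (Y 0 x + (l - z) * Y 1 x)) + a0 z * ((l - z) * Y 0 x)
       = - (Y 2 x + c1 * Y 1 x + c0 * Y 0 x) / w_coeff 3"
      by (simp add: divide_inverse) algebra
    ultimately show "1 * (1 * (1 * (a2 z * (Y 1 x + (l - z) * Y 2 x) + a1 z * (Y 0 x + (l - z) * Y 1 x)) + a0 z * ((l - z) * Y 0 x)) +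
             - 1 / w z * (- w z * unit_at_2 x)) + - 1 * (\<Sum>m\<in>L. 1 / (deriv w m * (m - z)) * ((m - z) * yhat m x)) = residual L x"
      using z by (simp add: residual_def add_divide_distrib diff_divide_distrib)
  qed (simp add: G_def)
qed

text \<open>By symmetry the resolvent preserves orthogonality to an invariant subspace; on the
  Jordan chain the claim climbs from \<open>Y 0\<close> to \<open>Y 2\<close>.\<close>

lemma G_perp:
  assumes L: "simple_zeros L" and z: "w z \<noteq> 0"
  shows "j < 3 \<Longrightarrow> indef_form (G L z) (Y j) = 0" "m \<in> L \<Longrightarrow> indef_form (G L z) (yhat m) = 0"
proof -
  have zl: "z \<noteq> l" using z w_low[of 0] by auto
  have 0: "indef_form h (\<lambda>x. 0) = 0" for h by (simp add: indef_form_def)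
  note r = resolvent_eq_Y
  note rp = residual_perp_Y[OF L]
  have g0: "indef_form (G L z) (Y 0) = 0"
    using resolvent_eq_form[OF resolvent_eq_residual_G[OF L z] r(1)] rp[of 0] zl by (simp add: 0)
  have g1: "indef_form (G L z) (Y 1) = 0"
    using resolvent_eq_form[OF resolvent_eq_residual_G[OF L z] r(2)] rp[of 1] zl by (simp add: g0 del: One_nat_def)
  have g2: "indef_form (G L z) (Y 2) = 0"
    using resolvent_eq_form[OF resolvent_eq_residual_G[OF L z] r(3)] rp[of 2] zl by (simp add: g1 del: One_nat_def)
  show "indef_form (G L z) (Y j) = 0" if "j < 3"
  proof -
    have "j = 0 \<or> j = 1 \<or> j = 2" using that by linarith
    then show ?thesis using g0 g1 g2 by auto
  qed
  show "indef_form (G L z) (yhat m) = 0" if "m \<in> L"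
  proof -
    have "w m = 0" "m \<noteq> z" using that L z by (auto simp: simple_zeros_def)
    then show ?thesis
      using resolvent_eq_form[OF resolvent_eq_residual_G[OF L z] resolvent_eq_yhat[of m]] residual_perp_yhat[OF L that] by (simp add: 0)
  qed
qed

lemma continuous_G:
  assumes "simple_zeros L" "w z \<noteq> 0"
  shows "continuous_on {0..1} (G L z)"
  using resolvent_eq_continuous(2)[OF resolvent_eq_residual_G[OF assms]] .

lemma indef_form_residual_G:
  assumes L: "simple_zeros L" and z: "w z \<noteq> 0"
  shows "indef_form (residual L) (G L z) = G L z 2 / Delta"
  using indef_form_residual_collapse[OF L continuous_G[OF L z] G_perp[OF L z]] .

lemma indef_form_residual_residual:
  assumes L: "simple_zeros L"
  shows "indef_form (residual L) (residual L) = of_real (E (residual L))"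
proof -
  have "indef_form (residual L) (residual L) = indef_form (residual L) (\<lambda>x. cnj (residual L x))"
    by (rule indef_form_cong) (simp_all add: residual_cnj[OF L])
  then show ?thesis using indef_form_perp_cnj[OF continuous_residual residual_perp_Y[OF L]] by simp
qed

text \<open>The remainder is real, so the conjugate of \<open>G L z\<close> solves the equation at
  \<open>cnj z\<close>. Pairing the two solutions gives the Nevanlinna identity for the resolvent
  function F z = <(A - z)^(-1) e, e>, which is \<open>G L z 2 / Delta\<close>.\<close>

lemma Im_E_G:
  assumes L: "simple_zeros L" and z: "w z \<noteq> 0"
  shows "Im z * E (G L z) = Im (G L z 2 / Delta)"
proof -
  let ?c = "\<lambda>x. cnj (G L z x)"
  have "resolvent_eq (cnj z) (residual L) ?c"
    by (rule resolvent_eq_cong[OF resolvent_eq_cnj[OF resolvent_eq_residual_G[OF L z]]]) (simp_all add: residual_cnj[OF L])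
  from resolvent_eq_form[OF resolvent_eq_residual_G[OF L z] this]
  have 1: "(z - cnj z) * indef_form (G L z) ?c + indef_form (residual L) ?c - indef_form (G L z) (residual L) = 0" .
  have "indef_form (residual L) ?c = indef_form (\<lambda>x. cnj (residual L x)) ?c"
    by (rule indef_form_cong) (simp_all add: residual_cnj[OF L])
  also have "\<dots> = cnj (indef_form (residual L) (G L z))"
    by (intro indef_form_cnj continuous_residual continuous_G L z)
  finally have 2: "indef_form (residual L) ?c = cnj (G L z 2 / Delta)" using indef_form_residual_G[OF L z] by simp
  have 3: "indef_form (G L z) (residual L) = G L z 2 / Delta" using indef_form_residual_G[OF L z] by (simp add: indef_form_commute)
  have 4: "indef_form (G L z) ?c = of_real (E (G L z))"
    using indef_form_perp_cnj[OF continuous_G[OF L z]] G_perp(1)[OF L z, of 0] by simp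
  have "Im z * e = Im F" if "(z - cnj z) * of_real e + cnj F - F = 0" for e F
    using that by (simp add: complex_eq_iff)
  then show ?thesis using 1 unfolding 2 3 4 by blast
qed

text \<open>Cauchy-Schwarz bounds |F|^2 by the product of the two energies. Multiplied by |Im z|,
  the energy of \<open>G L z\<close> becomes |Im F|, and one factor |F| cancels.\<close>

lemma norm_G_2_le:
  assumes L: "simple_zeros L" and z: "w z \<noteq> 0"
  shows "cmod (G L z 2 / Delta) * \<bar>Im z\<bar> \<le> E (residual L)"
proof -
  let ?F = "G L z 2 / Delta"
  have "(cmod ?F)\<^sup>2 \<le> E (residual L) * E (G L z)"
    using indef_form_perp_Cauchy_Schwarz[OF continuous_residual continuous_G[OF L z] residual_perp_Y[OF L] G_perp(1)[OF L z]]
      indef_form_residual_G[OF L z] by simp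
  then have "(cmod ?F)\<^sup>2 * \<bar>Im z\<bar> \<le> E (residual L) * E (G L z) * \<bar>Im z\<bar>"
    by (rule mult_right_mono) simp
  also have "\<dots> = E (residual L) * \<bar>Im ?F\<bar>"
    unfolding Im_E_G[OF L z, symmetric] by (simp add: abs_mult E_nonneg mult_ac)
  also have "\<dots> \<le> E (residual L) * cmod ?F"
    by (intro mult_left_mono E_nonneg abs_Im_le_cmod)
  finally have "cmod ?F * (cmod ?F * \<bar>Im z\<bar>) \<le> cmod ?F * E (residual L)"
    by (simp add: power2_eq_square mult_ac)
  then show ?thesis
    using E_nonneg by (cases "?F = 0") (auto simp: mult_le_cancel_left)
qed

text \<open>Bessel's inequality: the subtracted part \<open>p\<close> is orthogonal to
  \<open>residual L\<close>, so the energies add. This makes all later bounds uniform in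
  \<open>L\<close>.\<close>

lemma E_residual_le:
  assumes L: "simple_zeros L"
  shows "E (residual L) \<le> E (residual {})"
proof -
  have fin: "finite L" using L by (simp add: simple_zeros_def)
  define p where "p x = (\<Sum>m\<in>L. 1 / deriv w m * yhat m x)" for x
  have p: "continuous_on {0..1} p" unfolding p_def[abs_def] by (intro continuous_intros)
  have e: "simple_zeros {}" by (simp add: simple_zeros_def)
  have indef_form_p: "indef_form p h = (\<Sum>m\<in>L. 1 / deriv w m * indef_form (yhat m) h)" if "continuous_on {0..1} h" for h
    unfolding p_def[abs_def] by (intro indef_form_sum fin that continuous_intros)
  have pY: "indef_form p (Y 0) = 0"
    unfolding indef_form_p[OF continuous_Y] using L indef_form_Y_yhat_eq_0[of _ 0]
    by (intro sum.neutral) (auto simp: simple_zeros_def indef_form_commute[of "yhat _"])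
  have prv: "indef_form p (residual L) = 0"
    unfolding indef_form_p[OF continuous_residual] using residual_perp_yhat[OF L]
    by (intro sum.neutral) (auto simp: indef_form_commute[of "yhat _"])
  have sum: "residual {} = (\<lambda>x. 1 * residual L x + 1 * p x)" by (simp add: residual_def p_def fun_eq_iff)
  have "cnj (p x) = p x" if "x \<in> {0..1} \<union> {2}" for x
  proof -
    have "p x = residual {} x - residual L x" by (simp add: sum)
    then show ?thesis using residual_cnj[OF L that] residual_cnj[OF e that] by simp
  qed
  then have "indef_form p p = indef_form p (\<lambda>x. cnj (p x))" by (intro indef_form_cong) simp_all
  then have pp: "indef_form p p = of_real (E p)" using indef_form_perp_cnj[OF p pY] by simp
  have "indef_form (residual {}) (residual {}) = 1 * indef_form (residual L) (residual {}) + 1 * indef_form p (residual {})"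
    by (subst sum) (intro indef_form_linear continuous_intros p)
  also have "indef_form (residual L) (residual {}) = indef_form (residual {}) (residual L)" by (rule indef_form_commute)
  also have "\<dots> = 1 * indef_form (residual L) (residual L) + 1 * indef_form p (residual L)"
    by (subst sum) (intro indef_form_linear continuous_intros p)
  also have "indef_form p (residual {}) = indef_form (residual {}) p" by (rule indef_form_commute)
  also have "\<dots> = 1 * indef_form (residual L) p + 1 * indef_form p p"
    by (subst sum) (intro indef_form_linear continuous_intros p)
  finally have "complex_of_real (E (residual {})) = of_real (E (residual L) + E p)"
    unfolding indef_form_residual_residual[OF L] indef_form_residual_residual[OF e] pp prv indef_form_commute[of "residual L" p] by simp
  then have "E (residual {}) = E (residual L) + E p" by (simp only: of_real_eq_iff)
  then show ?thesis using E_nonneg[of p] by simp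
qed

end

section \<open>Convergence of the expansion\<close>

lemma removable_singularities_lim:
  fixes f :: "complex \<Rightarrow> complex"
  assumes X: "finite X" "X \<subseteq> D" and D: "open D" and f: "f holomorphic_on D - X"
    and lim: "\<And>s. s \<in> X \<Longrightarrow> ((\<lambda>z. (z - s) * f z) \<longlongrightarrow> 0) (at s)"
  obtains g where "g holomorphic_on D" "\<And>z. z \<in> D - X \<Longrightarrow> g z = f z"
proof -
  have "\<exists>g. g holomorphic_on D \<and> (\<forall>z\<in>D - X. g z = f z)"
  proof (rule removable_singularities)
    show "X \<subseteq> interior D" using X D by (simp add: interior_open)
    fix s assume s: "s \<in> X"
    let ?D = "D - (X - {s})"
    have "open ?D" using X D by (intro open_Diff finite_imp_closed) auto
    then have i: "s \<in> interior ?D" using s X by (simp add: interior_open) blast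
    have h: "f holomorphic_on ?D - {s}"
      using f by (rule holomorphic_on_subset) auto
    obtain B where "eventually (\<lambda>z. norm (f z) \<le> B) (at s)"
      using lim[OF s] holomorphic_on_extend_lim[OF h i] holomorphic_on_extend_bounded[OF h i] by blast
    then show "f \<in> O[at s](\<lambda>_. 1)" by (intro bigoI[of _ B]) simp
  qed (use X f in auto)
  then show ?thesis using that by blast
qed

lemma Taylor_remainder_lim:
  fixes F :: "nat \<Rightarrow> complex \<Rightarrow> complex"
  assumes F: "\<And>i z. (F i has_field_derivative F (Suc i) z) (at z)"
  shows "((\<lambda>z. (F 0 z - (\<Sum>i\<le>n. F i l * (z - l) ^ i / fact i)) / (z - l) ^ n) \<longlongrightarrow> 0) (at l)"
proof -
  have "continuous_on (cball l 1) (F (Suc n))"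
    using F DERIV_isCont by (intro continuous_at_imp_continuous_on) blast
  then obtain B where B: "\<And>z. z \<in> cball l 1 \<Longrightarrow> cmod (F (Suc n) z) \<le> B"
    using continuous_on_compact_bound[OF compact_cball] by metis
  show ?thesis
  proof (rule Lim_null_comparison)
    have "\<forall>\<^sub>F z in at l. z \<noteq> l \<and> dist z l < 1"
      unfolding eventually_at by (intro exI[of _ 1]) auto
    then show "\<forall>\<^sub>F z in at l. norm ((F 0 z - (\<Sum>i\<le>n. F i l * (z - l) ^ i / fact i)) / (z - l) ^ n)
        \<le> B * cmod (z - l) / fact n"
    proof eventually_elim
      case (elim z)
      have "cmod (F 0 z - (\<Sum>i\<le>n. F i l * (z - l) ^ i / fact i)) \<le> B * cmod (z - l) ^ Suc n / fact n"
        using elim by (intro complex_Taylor[of "cball l 1"] B has_field_derivative_at_within[OF F])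
          (auto simp: dist_commute)
      also have "\<dots> = B * cmod (z - l) / fact n * cmod ((z - l) ^ n)"
        by (simp add: norm_power)
      finally show ?case using elim by (simp add: norm_divide pos_divide_le_eq)
    qed
    have "((\<lambda>z. B * cmod (z - l) / fact n) \<longlongrightarrow> B * cmod (l - l) / fact n) (at l)"
      by (intro tendsto_intros) simp
    then show "((\<lambda>z. B * cmod (z - l) / fact n) \<longlongrightarrow> 0) (at l)" by simp
  qed
qed

locale sl_triple_real = sl_triple +
  assumes zeros_real: "\<And>z. w z = 0 \<Longrightarrow> z \<in> \<real>"
    and zeros_simple: "\<And>z. w z = 0 \<Longrightarrow> z \<noteq> l \<Longrightarrow> deriv w z \<noteq> 0"
begin

text \<open>The coefficients \<open>a2\<close>, \<open>a1\<close>, \<open>a0\<close> cancel the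
  principal part at \<open>l\<close>. For removability the limit 0 of (z - l) F suffices, so Taylor
  remainders of little-o type are enough. As w vanishes to order 3, the three coefficients of the
  principal part require w up to order 5 and \<open>yhat\<close> up to order 2.\<close>

lemma G_2_lim_triple:
  assumes L: "simple_zeros L"
  shows "((\<lambda>z. (z - l) * (G L z 2 / Delta)) \<longlongrightarrow> 0) (at l)"
proof -
  define m where "m j = Y j 2" for j
  define eM where "eM z = (yhat z 2 - (m 0 + m 1 * (z - l) + m 2 * (z - l)\<^sup>2)) / (z - l)\<^sup>2" for z
  define ew where "ew z = (w z - (w_coeff 3 * (z - l) ^ 3 + w_coeff 4 * (z - l) ^ 4 + w_coeff 5 * (z - l) ^ 5)) / (z - l) ^ 5" for z
  have eM: "(eM \<longlongrightarrow> 0) (at l)"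
    using Taylor_remainder_lim[where F = "\<lambda>j z. yder j z 2" and n = 2 and l = l, OF DERIV_yder]
    by (simp add: eM_def[abs_def] m_def Y_def yder_0 numeral_2_eq_2 mult_ac)
  have "(\<Sum>i\<le>5. (deriv ^^ i) w l * t ^ i / fact i) = w_coeff 3 * t ^ 3 + w_coeff 4 * t ^ 4 + w_coeff 5 * t ^ 5" for t
  proof -
    have "(\<Sum>i\<le>5. (deriv ^^ i) w l * t ^ i / fact i) = (\<Sum>i\<le>5. w_coeff i * t ^ i)"
      by (simp add: w_coeff_def)
    also have "\<dots> = w_coeff 0 + w_coeff (Suc 0) * t + w_coeff 2 * t\<^sup>2 + w_coeff 3 * t ^ 3 + w_coeff 4 * t ^ 4 + w_coeff 5 * t ^ 5"
      by (simp add: eval_nat_numeral)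
    finally show ?thesis by (simp only: w_coeff_low mult_zero_left add_0_left)
  qed
  then have ew: "(ew \<longlongrightarrow> 0) (at l)"
    using Taylor_remainder_lim[where F = "\<lambda>j. (deriv ^^ j) w" and n = 5 and l = l, OF DERIV_w] by (simp add: ew_def[abs_def])
  \<comment> \<open>With t = z - l, \<open>V\<close> is w / t^3, and
    \<open>m 0 + p1 * t + p2 * t^2\<close> is \<open>w_coeff 3 * t^3\<close> times the combination
    of the \<open>m j\<close> with coefficients \<open>a2\<close>, \<open>a1\<close>,
    \<open>a0\<close>. Over a common denominator the difference has numerator t^2 *
    \<open>X\<close>: by the choice of \<open>c1\<close> and \<open>c0\<close> the lower powers of t
    cancel.\<close>
  define V where "V z = w_coeff 3 + w_coeff 4 * (z - l) + w_coeff 5 * (z - l)\<^sup>2 + (z - l)\<^sup>2 * ew z" for z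
  define p1 where "p1 = m 1 + c1 * m 0"
  define p2 where "p2 = m 2 + c1 * m 1 + c0 * m 0"
  define X where "X z = (w_coeff 4 * p2 + w_coeff 5 * p1) * (z - l) + w_coeff 5 * p2 * (z - l)\<^sup>2
      + (m 0 + p1 * (z - l) + p2 * (z - l)\<^sup>2) * ew z - w_coeff 3 * eM z" for z
  have "(V \<longlongrightarrow> w_coeff 3 + w_coeff 4 * (l - l) + w_coeff 5 * (l - l)\<^sup>2 + (l - l)\<^sup>2 * 0) (at l)"
    unfolding V_def[abs_def] by (intro tendsto_intros ew)
  then have V: "(V \<longlongrightarrow> w_coeff 3) (at l)" by simp
  have "(X \<longlongrightarrow> (w_coeff 4 * p2 + w_coeff 5 * p1) * (l - l) + w_coeff 5 * p2 * (l - l)\<^sup>2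
      + (m 0 + p1 * (l - l) + p2 * (l - l)\<^sup>2) * 0 - w_coeff 3 * 0) (at l)"
    unfolding X_def[abs_def] by (intro tendsto_intros ew eM)
  then have X: "(X \<longlongrightarrow> 0) (at l)" by simp
  define S where "S z = (\<Sum>m\<in>L. 1 / (deriv w m * (m - z)) * yhat m 2)" for z
  have S: "(S \<longlongrightarrow> S l) (at l)"
    unfolding S_def using L by (intro tendsto_intros) (auto simp: simple_zeros_def)
  have "((\<lambda>z. (X z / (w_coeff 3 * V z) - (z - l) * S z) / Delta) \<longlongrightarrow> (0 / (w_coeff 3 * w_coeff 3) - (l - l) * S l) / Delta) (at l)"
    by (intro tendsto_intros X V S) (simp_all add: w_coeff_3 Delta_nonzero)
  then have "((\<lambda>z. (X z / (w_coeff 3 * V z) - (z - l) * S z) / Delta) \<longlongrightarrow> 0) (at l)" by simp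
  moreover have "\<forall>\<^sub>F z in at l. (X z / (w_coeff 3 * V z) - (z - l) * S z) / Delta = (z - l) * (G L z 2 / Delta)"
  proof -
    have "\<forall>\<^sub>F z in at l. V z \<noteq> 0" by (rule tendsto_imp_eventually_ne[OF V w_coeff_3])
    moreover have "\<forall>\<^sub>F z in at l. z \<noteq> l" by (simp add: eventually_at_filter)
    ultimately show ?thesis
    proof eventually_elim
      case (elim z)
      define t where "t = z - l"
      have t: "t \<noteq> 0" using elim by (simp add: t_def)
      have wV: "w z = t ^ 3 * V z"
        using t unfolding V_def ew_def t_def[symmetric]
        by (simp add: field_simps power2_eq_square eval_nat_numeral)
      have M: "yhat z 2 = m 0 + m 1 * t + m 2 * t\<^sup>2 + t\<^sup>2 * eM z"
        using t unfolding eM_def t_def[symmetric] by simp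
      have o4: "w_coeff 4 = - c1 * w_coeff 3" and o5: "w_coeff 5 = (c1\<^sup>2 - c0) * w_coeff 3"
        using w_coeff_3 by (simp_all add: c1_def c0_def power_divide)
      have Vt: "V z = w_coeff 3 + w_coeff 4 * t + w_coeff 5 * t\<^sup>2 + t\<^sup>2 * ew z" by (simp add: V_def t_def)
      have Xt: "X z = (w_coeff 4 * p2 + w_coeff 5 * p1) * t + w_coeff 5 * p2 * t\<^sup>2
          + (m 0 + p1 * t + p2 * t\<^sup>2) * ew z - w_coeff 3 * eM z" by (simp add: X_def t_def)
      have "t * (a2 z * m 2 + a1 z * m 1 + a0 z * m 0 - yhat z 2 / w z)
          = ((m 0 + p1 * t + p2 * t\<^sup>2) * V z - w_coeff 3 * yhat z 2) / (t\<^sup>2 * (w_coeff 3 * V z))"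
        unfolding wV a2_def a1_def a0_def t_def[symmetric] p1_def p2_def
        using t elim w_coeff_3 by (simp add: field_simps power2_eq_square power3_eq_cube)
      also have "(m 0 + p1 * t + p2 * t\<^sup>2) * V z - w_coeff 3 * yhat z 2 = t\<^sup>2 * X z"
        unfolding M Vt Xt o4 o5 p1_def p2_def by algebra
      finally have "t * (a2 z * m 2 + a1 z * m 1 + a0 z * m 0 - yhat z 2 / w z) = X z / (w_coeff 3 * V z)"
        using t by simp
      moreover have "G L z 2 = (a2 z * m 2 + a1 z * m 1 + a0 z * m 0 - yhat z 2 / w z) - S z"
        by (simp only: G_def S_def m_def)
      ultimately have "t * G L z 2 = X z / (w_coeff 3 * V z) - t * S z"
        by (simp only: right_diff_distrib[of t _ "S z"])
      then show ?case
        by (simp only: t_def[symmetric] times_divide_eq_right)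
    qed
  qed
  ultimately show ?thesis by (rule Lim_transform_eventually)
qed

text \<open>The pole of \<open>yhat / w\<close> at \<open>n\<close> is simple, with residue
  \<open>yhat n / deriv w n\<close>, and the summand for \<open>n\<close> cancels it.\<close>

lemma G_2_lim_simple:
  assumes L: "simple_zeros L" and n: "n \<in> L"
  shows "((\<lambda>z. (z - n) * (G L z 2 / Delta)) \<longlongrightarrow> 0) (at n)"
proof -
  have wn: "w n = 0" "n \<noteq> l" "deriv w n \<noteq> 0" and fin: "finite L" using L n by (auto simp: simple_zeros_def)
  define S where "S z = (\<Sum>m\<in>L - {n}. 1 / (deriv w m * (m - z)) * yhat m 2)" for z
  define P where "P z = a2 z * Y 2 2 + a1 z * Y 1 2 + a0 z * Y 0 2" for z
  have S: "(S \<longlongrightarrow> S n) (at n)"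
    unfolding S_def using L by (intro tendsto_intros) (auto simp: simple_zeros_def)
  have P: "(P \<longlongrightarrow> P n) (at n)"
    unfolding P_def a2_def a1_def a0_def using wn w_coeff_3 by (intro tendsto_intros) auto
  have "((\<lambda>z. (w z - w n) / (z - n)) \<longlongrightarrow> deriv w n) (at n)"
    using DERIV_w[of 0 n] by (simp add: has_field_derivative_iff)
  from tendsto_inverse[OF this wn(3)]
  have q: "((\<lambda>z. (z - n) / w z) \<longlongrightarrow> inverse (deriv w n)) (at n)"
    by (simp add: wn)
  have M: "((\<lambda>z. yhat z 2) \<longlongrightarrow> yhat n 2) (at n)"
    using DERIV_isCont[OF DERIV_yder[of 2 0 n]] by (simp add: yder_0 isCont_def)
  have "((\<lambda>z. ((z - n) * P z - (z - n) / w z * yhat z 2 + yhat n 2 / deriv w n - (z - n) * S z) / Delta) \<longlongrightarrow>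
      ((n - n) * P n - inverse (deriv w n) * yhat n 2 + yhat n 2 / deriv w n - (n - n) * S n) / Delta) (at n)"
    by (intro tendsto_intros S P q M Delta_nonzero wn)
  then have "((\<lambda>z. ((z - n) * P z - (z - n) / w z * yhat z 2 + yhat n 2 / deriv w n - (z - n) * S z) / Delta) \<longlongrightarrow> 0) (at n)"
    by (simp add: divide_inverse mult.commute)
  moreover have "\<forall>\<^sub>F z in at n. ((z - n) * P z - (z - n) / w z * yhat z 2 + yhat n 2 / deriv w n - (z - n) * S z) / Delta
     = (z - n) * (G L z 2 / Delta)"
  proof -
    have "\<forall>\<^sub>F z in at n. z \<noteq> n" by (simp add: eventually_at_filter)
    then show ?thesis
    proof eventually_elim
      case (elim z)
      have "(\<Sum>m\<in>L. 1 / (deriv w m * (m - z)) * yhat m 2) = 1 / (deriv w n * (n - z)) * yhat n 2 + S z"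
        unfolding S_def by (rule sum.remove[OF fin n])
      moreover have "(z - n) * (1 / (deriv w n * (n - z)) * yhat n 2) = - yhat n 2 / deriv w n"
        using elim wn by (simp add: field_simps)
      ultimately have "(z - n) * (\<Sum>m\<in>L. 1 / (deriv w m * (m - z)) * yhat m 2) = - yhat n 2 / deriv w n + (z - n) * S z"
        by (simp only: distrib_left)
      then have "(z - n) * G L z 2 = (z - n) * P z - (z - n) / w z * yhat z 2 + yhat n 2 / deriv w n - (z - n) * S z"
        unfolding G_def P_def right_diff_distrib by simp
      then show ?case by simp
    qed
  qed
  ultimately show ?thesis by (rule Lim_transform_eventually)
qed

lemma w_nonzero: "Im z \<noteq> 0 \<Longrightarrow> w z \<noteq> 0"
  using zeros_real complex_is_Real_iff by blast

text \<open>On the circle of radius r the product (z^2 - r^2) F z is bounded by a constant times r,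
  while at i the factor has modulus r^2 + 1. Hence F at i is of order 1 / r.\<close>

lemma G_2_bound:
  assumes r: "r \<ge> 1"
  obtains L where "simple_zeros L" "cmod (G L \<i> 2 / Delta) * (r\<^sup>2 + 1) \<le> 2 * r * E (residual {})"
proof -
  \<comment> \<open>The closed disc of radius r + 1 gives finiteness of the zeros by compactness.
    Its interior is an open neighbourhood of the disc of radius r, and \<open>L\<close> takes all
    its zeros except \<open>l\<close>, so every singularity there is removable.\<close>
  define Z where "Z = {z \<in> cball 0 (r + 1). w z = 0}"
  have "\<not> w constant_on UNIV"
    using w_nonzero[of \<i>] w_low[of 0] unfolding constant_on_def by fastforce
  then have "finite Z"
    unfolding Z_def by (intro holomorphic_compact_finite_zeros[OF w_holomorphic open_UNIV]) auto
  define L where "L = (Z \<inter> ball 0 (r + 1)) - {l}"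
  have L: "simple_zeros L"
    unfolding simple_zeros_def using \<open>finite Z\<close> zeros_real zeros_simple by (auto simp: L_def Z_def)
  define D where "D = ball (0::complex) (r + 1)"
  define X where "X = Z \<inter> D"
  define F where "F z = G L z 2 / Delta" for z
  have X: "finite X" "X \<subseteq> D" using \<open>finite Z\<close> by (auto simp: X_def)
  have X_iff: "z \<in> X \<longleftrightarrow> w z = 0" if "z \<in> D" for z using that by (auto simp: X_def Z_def D_def)
  have X_L: "X \<subseteq> insert l L" "L \<subseteq> X" by (auto simp: X_def L_def D_def)
  have nz: "w z \<noteq> 0" "z \<noteq> l" "m \<in> L \<Longrightarrow> m \<noteq> z" if "z \<in> D - X" for z m
  proof -
    show "w z \<noteq> 0" using that X_iff by blast
    then show "z \<noteq> l" using w_low[of 0] by auto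
    show "m \<in> L \<Longrightarrow> m \<noteq> z" using that X_L by blast
  qed
  have dw: "deriv w m \<noteq> 0" if "m \<in> L" for m using that L by (simp add: simple_zeros_def)
  have "F holomorphic_on D - X"
    unfolding F_def G_def a2_def a1_def a0_def
    by (intro holomorphic_intros w_holomorphic yhat_holomorphic)
      (simp_all add: nz dw w_coeff_3 Delta_nonzero)
  moreover have "((\<lambda>z. (z - s) * F z) \<longlongrightarrow> 0) (at s)" if "s \<in> X" for s
    using that X_L G_2_lim_triple[OF L] G_2_lim_simple[OF L, of s] unfolding F_def by blast
  ultimately obtain g where g: "g holomorphic_on D" "\<And>z. z \<in> D - X \<Longrightarrow> g z = F z"
    using removable_singularities_lim[OF X] by (metis D_def open_ball)
  \<comment> \<open>On \<open>|z| = r\<close> the factor \<open>z\<^sup>2 - r\<^sup>2 = 2 i z Im z\<close> cancels the singularity of the bound at real \<open>z\<close>.\<close>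
  have "cmod ((\<i>\<^sup>2 - of_real (r\<^sup>2)) * g \<i>) \<le> 2 * r * E (residual {})"
  proof (rule maximum_modulus_frontier[of "\<lambda>z. (z\<^sup>2 - of_real (r\<^sup>2)) * g z" "cball 0 r"])
    have sub: "cball 0 r \<subseteq> D" by (auto simp: D_def)
    show "(\<lambda>z. (z\<^sup>2 - of_real (r\<^sup>2)) * g z) holomorphic_on interior (cball 0 r)"
      using sub by (intro holomorphic_intros holomorphic_on_subset[OF g(1)]) auto
    show "continuous_on (closure (cball 0 r)) (\<lambda>z. (z\<^sup>2 - of_real (r\<^sup>2)) * g z)"
      using sub by (intro continuous_intros continuous_on_subset[OF holomorphic_on_imp_continuous_on[OF g(1)]]) auto
    show "bounded (cball (0::complex) r)" by simp
    show "\<i> \<in> cball 0 r" using r by simp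
    fix z :: complex assume "z \<in> frontier (cball 0 r)"
    then have z: "cmod z = r" using r by (simp add: frontier_cball)
    then have "of_real (r\<^sup>2) = z * cnj z" by (metis complex_norm_square)
    then have "z\<^sup>2 - of_real (r\<^sup>2) = z * (2 * of_real (Im z) * \<i>)"
      by (simp add: complex_eq_iff power2_eq_square algebra_simps)
    then have n: "cmod (z\<^sup>2 - of_real (r\<^sup>2)) = 2 * r * \<bar>Im z\<bar>"
      by (simp add: norm_mult z)
    show "cmod ((z\<^sup>2 - of_real (r\<^sup>2)) * g z) \<le> 2 * r * E (residual {})"
    proof (cases "Im z = 0")
      case True
      then show ?thesis using r E_nonneg[of "residual {}"] by (simp add: norm_mult n del: of_real_power)
    next
      case False
      then have wz: "w z \<noteq> 0" by (rule w_nonzero)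
      then have "g z = F z" using g(2)[of z] X_iff[of z] z by (simp add: D_def)
      then have "cmod ((z\<^sup>2 - of_real (r\<^sup>2)) * g z) = 2 * r * (cmod (F z) * \<bar>Im z\<bar>)"
        by (simp only: norm_mult n mult_ac)
      also have "\<dots> \<le> 2 * r * E (residual L)"
        using norm_G_2_le[OF L wz] r unfolding F_def by (intro mult_left_mono) auto
      also have "\<dots> \<le> 2 * r * E (residual {})"
        using E_residual_le[OF L] r by (intro mult_left_mono) auto
      finally show ?thesis .
    qed
  qed
  moreover have "g \<i> = F \<i>"
    using g(2)[of \<i>] X_iff[of \<i>] w_nonzero[of \<i>] r by (simp add: D_def)
  moreover have "cmod (\<i>\<^sup>2 - of_real (r\<^sup>2)) = r\<^sup>2 + 1"
  proof -
    have "\<i>\<^sup>2 - complex_of_real (r\<^sup>2) = - of_real (r\<^sup>2 + 1)" by simp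
    then show ?thesis by (simp only: norm_minus_cancel norm_of_real) simp
  qed
  ultimately have "cmod (G L \<i> 2 / Delta) * (r\<^sup>2 + 1) \<le> 2 * r * E (residual {})"
    unfolding F_def by (simp only: norm_mult mult.commute)
  with L show ?thesis by (rule that)
qed

end

section \<open>(0,1) in the closure of the domain of A\<close>

context sl_problem
begin

text \<open>Zero Cauchy data at 0 satisfy the left boundary condition for every \<beta>, and the
  right-hand side is defined by the equation, so only the functional at 1 has to be
  prescribed.\<close>

lemma resolvent_eq_of_real_function:
  fixes f f' f'' :: "real \<Rightarrow> real"
  assumes d: "\<And>x. (f has_real_derivative f' x) (at x)" "\<And>x. (f' has_real_derivative f'' x) (at x)"
    and c: "continuous_on UNIV f''" and ic: "f 0 = 0" "f' 0 = 0" and bc: "a * f 1 - c * f' 1 = 1"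
  obtains g where "resolvent_eq z g (\<lambda>x. if x = 2 then 1 else of_real (f x))"
proof -
  define h where "h x = (if x = 2 then 1 else complex_of_real (f x))" for x :: real
  define g where "g x = (if x = 2 then - (of_real b * of_real (f 1) - of_real d * of_real (f' 1)) - z
      else (of_real (q x) - z) * of_real (f x) - of_real (f'' x))" for x :: real
  have "sl_system q z (\<lambda>x. (of_real (q x) - z) * of_real (f x) - of_real (f'' x)) (\<lambda>x. of_real (f x)) (\<lambda>x. of_real (f' x))"
    unfolding sl_system_def
    by (auto intro!: has_vector_derivative_of_real has_field_derivative_at_within[OF d(1)]
        has_field_derivative_at_within[OF d(2)])
  then have sl: "sl_system q z g (\<lambda>x. of_real (f x)) (\<lambda>x. of_real (f' x))"
    by (rule sl_cong) (simp add: g_def)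
  have "continuous_on {0..1} (\<lambda>x. (of_real (q x) - z) * of_real (f x) - complex_of_real (f'' x))"
    using DERIV_continuous_on[OF has_field_derivative_at_within[OF d(1)]]
    by (intro continuous_intros q_cont continuous_on_subset[OF c]) auto
  then have g: "continuous_on {0..1} g" by (rule continuous_on_eq) (simp add: g_def)
  have "of_real a * of_real (f 1) - of_real c * of_real (f' 1) = complex_of_real 1"
    using arg_cong[OF bc, of complex_of_real] by simp
  moreover have "sl_system q z g h (\<lambda>x. of_real (f' x))"
    unfolding sl_system_def
  proof (intro ballI conjI)
    fix x :: real assume x: "x \<in> {0..1}"
    show "(h has_vector_derivative of_real (f' x)) (at x within {0..1})"
      by (rule has_vector_derivative_transform[OF x, of h "\<lambda>x. of_real (f x)"])
        (use sl x in \<open>auto simp: sl_system_def h_def\<close>)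
    show "((\<lambda>x. of_real (f' x)) has_vector_derivative (of_real (q x) - z) * h x - g x) (at x within {0..1})"
      using sl x by (auto simp: sl_system_def h_def)
  qed
  ultimately have "resolvent_eq z g h"
    unfolding resolvent_eq_def using g ic
    by (intro conjI exI[of _ "\<lambda>x. complex_of_real (f' x)"]) (auto simp: h_def g_def)
  then show ?thesis unfolding h_def[abs_def] by (rule that)
qed

text \<open>High powers of x concentrate at 1: they keep the boundary functional equal to 1 while
  the squared norm is at most M^2 / (p + 1).\<close>

lemma exists_small_domain_vector:
  assumes "\<delta> > 0"
  obtains h g where "resolvent_eq z g h" "h 2 = 1" "sq_norm h < \<delta>"
proof -
  note result = that
  have key: thesis
    if f: "\<And>x. (f has_real_derivative f' x) (at x)" "\<And>x. (f' has_real_derivative f'' x) (at x)"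
      "continuous_on UNIV f''" "f 0 = 0" "f' 0 = 0" "a * f 1 - c * f' 1 = 1"
      and le: "\<And>x. x \<in> {0..1} \<Longrightarrow> \<bar>f x\<bar> \<le> M * x ^ p" and M: "M \<ge> 0" "M\<^sup>2 < \<delta> * real (p + 1)"
    for f f' f'' :: "real \<Rightarrow> real" and M p
  proof -
    define h where "h x = (if x = 2 then 1 else complex_of_real (f x))" for x :: real
    obtain g where g: "resolvent_eq z g h"
      using resolvent_eq_of_real_function[OF f, of z] unfolding h_def[abs_def] by blast
    have "((\<lambda>x::real. x ^ p) has_integral (1 ^ (p + 1) / real (p + 1) - 0 ^ (p + 1) / real (p + 1))) {0..1}"
    proof (rule fundamental_theorem_of_calculus)
      fix x :: real
      show "((\<lambda>x. x ^ (p + 1) / real (p + 1)) has_vector_derivative x ^ p) (at x within {0..1})"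
        using DERIV_cdivide[OF DERIV_pow[of "p + 1" x "{0..1}"], of "real (p + 1)"]
        by (simp add: has_real_derivative_iff_has_vector_derivative del: of_nat_Suc)
    qed simp
    then have int: "((\<lambda>x::real. M\<^sup>2 * x ^ p) has_integral M\<^sup>2 * (1 / real (p + 1))) {0..1}"
      by (intro has_integral_mult_right) simp
    have "sq_norm h \<le> integral {0..1} (\<lambda>x. M\<^sup>2 * x ^ p)"
      unfolding sq_norm_def
    proof (rule integral_le)
      show "(\<lambda>x. (cmod (h x))\<^sup>2) integrable_on {0..1}"
        by (intro integrable_continuous_real continuous_intros resolvent_eq_continuous(2)[OF g])
      show "(\<lambda>x. M\<^sup>2 * x ^ p) integrable_on {0..1}" using int by blast
      fix x :: real assume x: "x \<in> {0..1}"
      have "(cmod (h x))\<^sup>2 \<le> (M * x ^ p)\<^sup>2"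
        using le[OF x] x by (intro power_mono) (auto simp: h_def)
      also have "\<dots> = M\<^sup>2 * (x ^ p * x ^ p)" by (simp add: power2_eq_square mult_ac)
      also have "\<dots> \<le> M\<^sup>2 * x ^ p"
        using x by (intro mult_left_mono mult_left_le) (auto simp: power_le_one)
      finally show "(cmod (h x))\<^sup>2 \<le> M\<^sup>2 * x ^ p" .
    qed
    also have "\<dots> = M\<^sup>2 / real (p + 1)" unfolding integral_unique[OF int] by simp
    also have "\<dots> < \<delta>" using M by (simp add: pos_divide_less_eq del: of_nat_add)
    finally show thesis using result[OF g] by (simp add: h_def)
  qed
  define M where "M = (if c = 0 then \<bar>1 / a\<bar> else \<bar>1 / c\<bar>)"
  obtain n where n: "M\<^sup>2 < real n * \<delta>" using reals_Archimedean3[OF assms] by blast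
  \<comment> \<open>p > \<open>n\<close> makes the norm small; the offset 3 keeps the exponents p -
    1 and p - 2 positive, so \<open>f\<close> and \<open>f'\<close> vanish at 0.\<close>
  define p where "p = n + 3"
  have "real n * \<delta> \<le> \<delta> * real (p + 1)" using assms by (simp add: p_def algebra_simps)
  then have Mp: "M\<^sup>2 < \<delta> * real (p + 1)" using n by linarith
  have d: "((\<lambda>x. x ^ (p + 1)) has_real_derivative real (p + 1) * x ^ p) (at x)"
    "((\<lambda>x. x ^ p) has_real_derivative real p * x ^ (p - 1)) (at x)"
    "((\<lambda>x. x ^ (p - 1)) has_real_derivative real (p - 1) * x ^ (p - 2)) (at x)" for x
    using DERIV_pow[of "p + 1" x UNIV] DERIV_pow[of p x UNIV] DERIV_pow[of "p - 1" x UNIV]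
    by (simp_all add: numeral_2_eq_2)
  \<comment> \<open>If c = 0, then a is nonzero and x^p / a has the required value at 1. Otherwise
    (x^p - x^(p+1)) / c vanishes at 1 and has derivative -1 / c there.\<close>
  show thesis
  proof (cases "c = 0")
    case True
    then have a: "a \<noteq> 0" using det_neg by auto
    show thesis
    proof (rule key[of "\<lambda>x. 1 / a * x ^ p" "\<lambda>x. 1 / a * (real p * x ^ (p - 1))"
          "\<lambda>x. 1 / a * (real p * (real (p - 1) * x ^ (p - 2)))" M p])
      show "((\<lambda>x. 1 / a * x ^ p) has_real_derivative 1 / a * (real p * x ^ (p - 1))) (at x)"
        "((\<lambda>x. 1 / a * (real p * x ^ (p - 1))) has_real_derivative
          1 / a * (real p * (real (p - 1) * x ^ (p - 2)))) (at x)" for x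
        by (intro DERIV_cmult d)+
      show "\<bar>1 / a * x ^ p\<bar> \<le> M * x ^ p" if "x \<in> {0..1}" for x
        using that True by (simp add: M_def abs_mult)
    qed (use a True Mp in \<open>auto simp: p_def M_def intro!: continuous_intros\<close>)
  next
    case False
    define k where "k = - 1 / c"
    show thesis
    proof (rule key[of "\<lambda>x. k * (x ^ (p + 1) - x ^ p)" "\<lambda>x. k * (real (p + 1) * x ^ p - real p * x ^ (p - 1))"
          "\<lambda>x. k * (real (p + 1) * (real p * x ^ (p - 1)) - real p * (real (p - 1) * x ^ (p - 2)))" M p])
      show "((\<lambda>x. k * (x ^ (p + 1) - x ^ p)) has_real_derivative
            k * (real (p + 1) * x ^ p - real p * x ^ (p - 1))) (at x)"
        "((\<lambda>x. k * (real (p + 1) * x ^ p - real p * x ^ (p - 1))) has_real_derivative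
            k * (real (p + 1) * (real p * x ^ (p - 1)) - real p * (real (p - 1) * x ^ (p - 2)))) (at x)" for x
        by (intro DERIV_cmult DERIV_diff d)+
      show "\<bar>k * (x ^ (p + 1) - x ^ p)\<bar> \<le> M * x ^ p" if "x \<in> {0..1}" for x
      proof -
        have "x ^ (p + 1) - x ^ p = - (x ^ p * (1 - x))" by (simp add: algebra_simps)
        moreover have "x ^ p * (1 - x) \<le> x ^ p" "0 \<le> x ^ p * (1 - x)" using that by (auto simp: mult_left_le)
        ultimately have "\<bar>x ^ (p + 1) - x ^ p\<bar> \<le> x ^ p" by simp
        then show ?thesis using False by (simp add: abs_mult M_def k_def mult_left_mono divide_right_mono)
      qed
    qed (use False Mp in \<open>auto simp: p_def k_def M_def power_0_left intro!: continuous_intros\<close>)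
  qed
qed

end

context sl_triple_real
begin

text \<open>\<open>E (residual L)\<close> is the scalar component of the remainder over
  \<open>Delta\<close>. Pairing the remainder with a domain vector \<open>h\<close> near (0,1) gives
  this number plus an integral against the small function part of \<open>h\<close>. By symmetry the
  pairing equals that of \<open>G L i\<close> with \<open>g\<close>, which is small when the disc is
  large.\<close>

lemma residual_small:
  assumes e: "e > 0"
  obtains L where "simple_zeros L" "sq_norm (residual L) < e"
proof -
  obtain K where K: "K > 0"
    "\<And>h. continuous_on {0..1} h \<Longrightarrow> indef_form h (Y 0) = 0 \<Longrightarrow> indef_form h (Y 2) = 0 \<Longrightarrow>
        (cmod (h 2))\<^sup>2 \<le> K * E h \<and> sq_norm h \<le> K * E h"
    by (rule E_coercive) (rule that; blast)
  define K3 where "K3 = E (residual {})"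
  have K3: "K3 \<ge> 0" by (simp add: K3_def E_nonneg)
  \<comment> \<open>\<open>n\<close> is the share of each of the two error terms.
    \<open>\<delta>\<close> uses only bounds uniform in \<open>L\<close>, so \<open>h\<close> and
    \<open>g\<close> are fixed before the radius, which depends on \<open>g\<close>, and
    \<open>L\<close> comes last.\<close>
  define n where "n = e / (2 * K)"
  have n: "n > 0" using e K by (simp add: n_def)
  define \<delta> where "\<delta> = n\<^sup>2 / (K * K3 + 1)"
  have KK3: "K * K3 \<ge> 0" using K K3 by simp
  then have \<delta>: "\<delta> > 0" using n by (simp add: \<delta>_def add_nonneg_pos)
  obtain h g where h: "resolvent_eq \<i> g h" "h 2 = 1" "sq_norm h < \<delta>"
    using exists_small_domain_vector[OF \<delta>] .
  note cont = resolvent_eq_continuous[OF h(1)]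
  define Cg where "Cg = sqrt (sq_norm g) + cmod (g 2 / Delta)"
  \<comment> \<open>\<open>T\<close> is the radius at which the estimate of the pairing with
    \<open>g\<close> would equal \<open>n\<close>; the additional 1 in \<open>r\<close> makes it
    strict.\<close>
  define T where "T = 2 * (K * K3) * Cg\<^sup>2 / n\<^sup>2"
  have T: "T \<ge> 0" using KK3 by (simp add: T_def)
  define r where "r = T + 1"
  have r: "r \<ge> 1" using T by (simp add: r_def)
  obtain L where L: "simple_zeros L" "cmod (G L \<i> 2 / Delta) * (r\<^sup>2 + 1) \<le> 2 * r * K3"
    using G_2_bound[OF r] unfolding K3_def .
  have wi: "w \<i> \<noteq> 0" by (rule w_nonzero) simp
  let ?G = "G L \<i>"
  note contG = continuous_G[OF L(1) wi]
  have EG: "E ?G * r \<le> 2 * K3"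
  proof -
    have "E ?G \<le> cmod (?G 2 / Delta)"
      using Im_E_G[OF L(1) wi] abs_Im_le_cmod[of "?G 2 / Delta"] by simp
    then have "E ?G * r\<^sup>2 \<le> cmod (?G 2 / Delta) * (r\<^sup>2 + 1)"
      by (intro mult_mono) auto
    then have "r * (E ?G * r) \<le> r * (2 * K3)"
      using L(2) by (simp add: power2_eq_square mult_ac)
    then show ?thesis using r by (simp add: mult_le_cancel_left)
  qed
  have indef_form_Gg: "cmod (indef_form ?G g) < n"
  proof -
    define s where "s = sqrt (K * E ?G)"
    have s0: "s \<ge> 0" using K E_nonneg by (simp add: s_def)
    have co: "(cmod (?G 2))\<^sup>2 \<le> K * E ?G" "sq_norm ?G \<le> K * E ?G"
      using K(2)[OF contG] G_perp(1)[OF L(1) wi] by auto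
    have "cmod (integral {0..1} (\<lambda>x. ?G x * g x)) \<le> s * sqrt (sq_norm g)"
    proof (rule power2_le_imp_le)
      have "(cmod (integral {0..1} (\<lambda>x. ?G x * g x)))\<^sup>2 \<le> sq_norm ?G * sq_norm g"
        by (intro integral_Cauchy_Schwarz contG cont)
      also have "\<dots> \<le> (K * E ?G) * sq_norm g" using co by (intro mult_right_mono sq_norm_nonneg)
      also have "\<dots> = (s * sqrt (sq_norm g))\<^sup>2"
        using K E_nonneg[of ?G] sq_norm_nonneg[of g] by (simp add: s_def power_mult_distrib)
      finally show "(cmod (integral {0..1} (\<lambda>x. ?G x * g x)))\<^sup>2 \<le> (s * sqrt (sq_norm g))\<^sup>2" .
    qed (use s0 sq_norm_nonneg in auto)
    moreover have "cmod (?G 2) \<le> s" unfolding s_def using co(1) by (rule real_le_rsqrt)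
    then have "cmod (?G 2) * cmod (g 2 / Delta) \<le> s * cmod (g 2 / Delta)" by (rule mult_right_mono) simp
    moreover have "cmod (indef_form ?G g) \<le> cmod (integral {0..1} (\<lambda>x. ?G x * g x)) + cmod (?G 2) * cmod (g 2 / Delta)"
      unfolding indef_form_def using norm_triangle_ineq[of "integral {0..1} (\<lambda>x. ?G x * g x)" "?G 2 * (g 2 / Delta)"]
      by (simp add: norm_mult norm_divide)
    ultimately have le: "cmod (indef_form ?G g) \<le> s * Cg"
      unfolding Cg_def distrib_left by linarith
    have "s * Cg < n"
    proof (rule power2_less_imp_less)
      have "(s * Cg)\<^sup>2 * r = K * Cg\<^sup>2 * (E ?G * r)"
        using K E_nonneg[of ?G] by (simp add: s_def power_mult_distrib mult_ac)
      also have "\<dots> \<le> K * Cg\<^sup>2 * (2 * K3)"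
        using EG K by (intro mult_left_mono) auto
      also have "\<dots> = T * n\<^sup>2" using n by (simp add: T_def)
      also have "\<dots> < r * n\<^sup>2" using n by (simp add: r_def)
      finally show "(s * Cg)\<^sup>2 < n\<^sup>2" using r by (simp add: mult.commute)
    qed (use n in simp)
    with le show ?thesis by simp
  qed
  have ER: "E (residual L) \<le> K3" unfolding K3_def by (rule E_residual_le[OF L(1)])
  have nR: "sq_norm (residual L) \<le> K * E (residual L)"
    using K(2)[OF continuous_residual residual_perp_Y[OF L(1)] residual_perp_Y[OF L(1)]] by simp
  have int: "cmod (integral {0..1} (\<lambda>x. residual L x * h x)) < n"
  proof (rule power2_less_imp_less)
    have "(cmod (integral {0..1} (\<lambda>x. residual L x * h x)))\<^sup>2 \<le> sq_norm (residual L) * sq_norm h"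
      by (intro integral_Cauchy_Schwarz continuous_residual cont)
    also have "\<dots> \<le> (K * K3) * \<delta>"
    proof (rule mult_mono)
      show "sq_norm (residual L) \<le> K * K3" using nR ER K by (meson mult_left_mono less_imp_le order_trans)
    qed (use h KK3 sq_norm_nonneg in auto)
    also have "\<dots> < n\<^sup>2"
      using n KK3 by (simp add: \<delta>_def pos_divide_less_eq add_nonneg_pos algebra_simps)
    finally show "(cmod (integral {0..1} (\<lambda>x. residual L x * h x)))\<^sup>2 < n\<^sup>2" .
  qed (use n in simp)
  have "indef_form (residual L) h = indef_form ?G g"
    using resolvent_eq_form[OF resolvent_eq_residual_G[OF L(1) wi] h(1)] by simp
  moreover have "indef_form (residual L) h = integral {0..1} (\<lambda>x. residual L x * h x) + residual L 2 / Delta"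
    by (simp add: indef_form_def h(2))
  moreover have "indef_form (residual L) (residual L) = residual L 2 / Delta"
    by (intro indef_form_residual_collapse L continuous_residual residual_perp_Y residual_perp_yhat)
  ultimately have "complex_of_real (E (residual L)) = indef_form ?G g - integral {0..1} (\<lambda>x. residual L x * h x)"
    unfolding indef_form_residual_residual[OF L(1)] by (metis add_diff_cancel_left')
  then have "cmod (complex_of_real (E (residual L))) \<le> cmod (indef_form ?G g) + cmod (integral {0..1} (\<lambda>x. residual L x * h x))"
    by (simp only: norm_triangle_ineq4)
  then have "E (residual L) < 2 * n" using indef_form_Gg int E_nonneg by simp
  then have "K * E (residual L) < e" using K by (simp add: n_def pos_less_divide_eq mult.commute)
  with nR have "sq_norm (residual L) < e" by simp
  with L(1) show ?thesis by (rule that)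
qed

end

section \<open>Closed spans of continuous functions in L2(0,1)\<close>

lemma continuous_in_L2:
  assumes "continuous_on {0..1} h"
  shows "h \<in> L2_space" "L2_norm h = sqrt (sq_norm h)"
proof -
  have c: "continuous_on {0<..<1} h" using assms by (rule continuous_on_subset) auto
  have "integrable (lebesgue_on {0..1}) (\<lambda>x. (cmod (h x))\<^sup>2)"
    by (intro continuous_imp_integrable_real continuous_intros assms)
  then have "set_integrable lebesgue {0..1} (\<lambda>x. (cmod (h x))\<^sup>2)"
    by (simp add: integrable_restrict_space set_integrable_def)
  then have "set_integrable lebesgue {0<..<1} (\<lambda>x. (cmod (h x))\<^sup>2)"
    by (rule set_integrable_subset) auto
  then have int: "integrable (lebesgue_on {0<..<1}) (\<lambda>x. (cmod (h x))\<^sup>2)"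
    by (simp add: integrable_restrict_space set_integrable_def)
  show "h \<in> L2_space"
    unfolding L2_space_def using int continuous_imp_measurable_on_sets_lebesgue[OF c] by auto
  have "integral\<^sup>L (lebesgue_on {0<..<1}) (\<lambda>x. (cmod (h x))\<^sup>2) = sq_norm h"
    using lebesgue_integral_eq_integral[OF int] by (simp add: sq_norm_def integral_open_interval_real)
  then show "L2_norm h = sqrt (sq_norm h)" by (simp add: L2_norm_def)
qed

text \<open>Integration against \<open>p\<close> is a bounded functional, so it vanishes on the
  closed span once it vanishes on the generators.\<close>

lemma closed_span_annihilator:
  assumes f: "\<And>m. continuous_on {0..1} (f m)" and p: "continuous_on {0..1} p"
    and ann: "\<And>m. m \<in> J \<Longrightarrow> integral {0..1} (\<lambda>x. p x * f m x) = 0"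
    and n: "f n \<in> closed_span f J"
  shows "integral {0..1} (\<lambda>x. p x * f n x) = 0"
proof (rule ccontr)
  define I where "I = integral {0..1} (\<lambda>x. p x * f n x)"
  define e where "e = cmod I / (sqrt (sq_norm p) + 1)"
  assume "integral {0..1} (\<lambda>x. p x * f n x) \<noteq> 0"
  then have I: "cmod I > 0" by (simp add: I_def)
  have sp: "sqrt (sq_norm p) \<ge> 0" using sq_norm_nonneg by simp
  have e: "e > 0" using I sp by (simp add: e_def add_nonneg_pos)
  then obtain F s where F: "finite F" "F \<subseteq> J" "L2_norm (\<lambda>x. f n x - (\<Sum>m\<in>F. s m * f m x)) < e"
    using n unfolding closed_span_def by blast
  define g where "g x = f n x - (\<Sum>m\<in>F. s m * f m x)" for x
  have g: "continuous_on {0..1} g" unfolding g_def[abs_def] by (intro continuous_intros f)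
  have "integral {0..1} (\<lambda>x. p x * g x) = integral {0..1} (\<lambda>x. p x * f n x - (\<Sum>m\<in>F. s m * (p x * f m x)))"
    by (simp add: g_def right_diff_distrib sum_distrib_left mult_ac)
  also have "\<dots> = I - (\<Sum>m\<in>F. s m * integral {0..1} (\<lambda>x. p x * f m x))"
    unfolding I_def
    by (intro integral_unique has_integral_diff has_integral_sum has_integral_mult_right integrable_integral
        integrable_continuous_real continuous_intros f p F)
  also have "\<dots> = I" using ann F by (simp add: subset_iff)
  finally have "(cmod I)\<^sup>2 \<le> sq_norm p * sq_norm g"
    using integral_Cauchy_Schwarz[OF p g] by simp
  then have "cmod I \<le> sqrt (sq_norm p * sq_norm g)" by (rule real_le_rsqrt)
  also have "\<dots> = sqrt (sq_norm p) * L2_norm g" using continuous_in_L2(2)[OF g] by (simp add: real_sqrt_mult)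
  also have "\<dots> \<le> sqrt (sq_norm p) * e"
    using F(3) sp unfolding g_def[abs_def] by (intro mult_left_mono) auto
  also have "\<dots> < (sqrt (sq_norm p) + 1) * e" using e by simp
  also have "\<dots> = cmod I"
  proof -
    have "sqrt (sq_norm p) + 1 \<noteq> 0" using sp by linarith
    then show ?thesis by (simp add: e_def)
  qed
  finally show False by simp
qed

context sl_triple_real
begin

section \<open>Minimality\<close>

lemma minimal_iff:
  fixes lam :: "nat \<Rightarrow> complex" and k :: nat and C D :: real
  assumes l: "lam k = l" and range: "range lam = {z. w z = 0}"
    and inj: "\<And>m n. m \<notin> {k, k + 1, k + 2} \<Longrightarrow> lam m = lam n \<Longrightarrow> m = n"
    and triple: "lam (k + 1) = l" "lam (k + 2) = l"
  shows "minimal_system (root_function y lam k C D) {n. n \<noteq> k + 1} \<longleftrightarrow> complex_of_real C \<noteq> c1"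
proof -
  let ?f = "root_function y lam k C D" and ?I = "{n. n \<noteq> k + 1}"
  \<comment> \<open>The system lifted to the extended space: it agrees with \<open>?f\<close> on
    [0,1] and carries the scalar components at 2.\<close>
  define fh where "fh n = (if n = k + 1 then (\<lambda>x. Y 1 x + of_real C * Y 0 x)
    else if n = k + 2 then (\<lambda>x. (Y 2 x + of_real C * Y 1 x) + of_real D * Y 0 x) else yhat (lam n))" for n
  have yh: "yhat z x = y x z" "(\<lambda>t. yhat t x) = (\<lambda>t. y x t)" if "x \<in> {0..1}" for x z
    using that by (auto simp: yhat_def)
  have f_fh: "?f n x = fh n x" if "x \<in> {0..1}" for n x
    using yh[OF that] by (simp add: root_function_def fh_def assoc1_def assoc2_def Y_def yder_def l)
  have cfh: "continuous_on {0..1} (fh n)" for n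
    unfolding fh_def by (cases "n = k + 1"; cases "n = k + 2") (auto intro!: continuous_intros)
  have cf: "continuous_on {0..1} (?f n)" for n
    using cfh by (rule continuous_on_eq) (simp add: f_fh)
  have fh_k: "fh k = Y 0" by (simp add: fh_def Y_def[abs_def] yder_0 l)
  have zero: "w (lam n) = 0" for n using range by blast
  have lam_l: "lam n \<noteq> l" if "n \<notin> {k, k + 1, k + 2}" for n
    using inj[OF that, of k] that l by auto
  have idx: "n = k \<or> n = k + 2 \<or> n \<notin> {k, k + 1, k + 2} \<and> fh n = yhat (lam n)" if "n \<in> ?I" for n
    using that by (auto simp: fh_def)
  have indef_form_Y_simple: "indef_form (Y j) (yhat (lam n)) = 0" if "n \<notin> {k, k + 1, k + 2}" "j < 3" for n j
    using indef_form_Y_yhat_eq_0[OF zero lam_l] that by blast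
  have indef_form_fh_k2: "indef_form h (fh (k + 2)) = indef_form h (Y 2) + of_real C * indef_form h (Y 1) + of_real D * indef_form h (Y 0)"
    if h: "continuous_on {0..1} h" for h
  proof -
    have "indef_form (\<lambda>x. 1 * (1 * Y 2 x + of_real C * Y 1 x) + of_real D * Y 0 x) h
        = 1 * indef_form (\<lambda>x. 1 * Y 2 x + of_real C * Y 1 x) h + of_real D * indef_form (Y 0) h"
      by (intro indef_form_linear continuous_intros h)
    also have "indef_form (\<lambda>x. 1 * Y 2 x + of_real C * Y 1 x) h = 1 * indef_form (Y 2) h + of_real C * indef_form (Y 1) h"
      by (intro indef_form_linear continuous_intros h)
    finally show ?thesis by (simp add: fh_def indef_form_commute[of h])
  qed
  define g where "g = indef_form (Y 2) (Y 0)"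
  have g: "g \<noteq> 0" using gram(3) w_coeff_3 Y_0_2 Delta_nonzero by (simp add: g_def)
  have g11: "indef_form (Y 1) (Y 1) = g" by (simp only: g_def gram)
  note comm = indef_form_commute[of "Y 0" "Y 1"] indef_form_commute[of "Y 0" "Y 2"] indef_form_commute[of "Y 1" "Y 2"]
  show ?thesis
  proof
    assume minimal: "minimal_system ?f ?I"
    show "complex_of_real C \<noteq> c1"
    proof
      assume C: "complex_of_real C = c1"
      \<comment> \<open>On [0,1] the vector \<open>unit_at_2\<close> is 0, so a small remainder,
        multiplied by \<open>- w_coeff 3\<close>, is an approximate linear relation. At the critical
        value its part at \<open>l\<close> is \<open>?f (k + 2)\<close> plus a multiple of
        \<open>?f k\<close>.\<close>
      have "?f (k + 2) \<in> closed_span ?f (?I - {k + 2})"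
        unfolding closed_span_def
      proof (intro CollectI conjI allI impI)
        show "?f (k + 2) \<in> L2_space" by (rule continuous_in_L2(1)[OF cf])
        fix e :: real assume e: "e > 0"
        define e' where "e' = (e / cmod (w_coeff 3))\<^sup>2"
        have "e' > 0" using e w_coeff_3 by (simp add: e'_def)
        then obtain L where L: "simple_zeros L" "sq_norm (residual L) < e'" using residual_small by blast
        define ix where "ix m = (SOME n. lam n = m)" for m
        have ix: "lam (ix m) = m" "ix m \<notin> {k, k + 1, k + 2}" if "m \<in> L" for m
        proof -
          have "m \<in> range lam" using range L that by (auto simp: simple_zeros_def)
          then show eq: "lam (ix m) = m" unfolding ix_def by (metis (mono_tags, lifting) imageE someI)
          show "ix m \<notin> {k, k + 1, k + 2}"
            using eq l triple L(1) that by (auto simp: simple_zeros_def)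
        qed
        \<comment> \<open>\<open>of_real D - c0\<close> trades the multiple of \<open>Y 0\<close> in
          the root function for the one in the residue; the other coefficients are residues scaled
          by \<open>- w_coeff 3\<close>.\<close>
        define s where "s n = (if n = k then of_real D - c0 else - w_coeff 3 / deriv w (lam n))" for n
        let ?F = "insert k (ix ` L)"
        have fin: "finite L" using L by (simp add: simple_zeros_def)
        have inj_ix: "inj_on ix L" using ix(1) by (metis inj_onI)
        have k: "k \<notin> ix ` L" using ix(2) by blast
        have eq: "?f (k + 2) x - (\<Sum>m\<in>?F. s m * ?f m x) = - w_coeff 3 * residual L x" if x: "x \<in> {0..1}" for x
        proof -
          have "(\<Sum>m\<in>ix ` L. s m * fh m x) = (\<Sum>m\<in>L. s (ix m) * fh (ix m) x)"
            by (simp add: sum.reindex[OF inj_ix])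
          also have "\<dots> = (\<Sum>m\<in>L. - w_coeff 3 * (1 / deriv w m * yhat m x))"
          proof (rule sum.cong)
            fix m assume "m \<in> L"
            then show "s (ix m) * fh (ix m) x = - w_coeff 3 * (1 / deriv w m * yhat m x)"
              using ix[of m] by (simp add: s_def fh_def)
          qed simp
          also have "\<dots> = - w_coeff 3 * (\<Sum>m\<in>L. 1 / deriv w m * yhat m x)" by (simp only: sum_distrib_left)
          finally have "(\<Sum>m\<in>?F. s m * ?f m x) = (of_real D - c0) * Y 0 x - w_coeff 3 * (\<Sum>m\<in>L. 1 / deriv w m * yhat m x)"
            using fin k f_fh[OF x] by (simp add: s_def fh_k)
          moreover have "?f (k + 2) x = Y 2 x + c1 * Y 1 x + of_real D * Y 0 x"
            using f_fh[OF x] by (simp add: fh_def C)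
          moreover have "unit_at_2 x = 0" using x by (auto simp: unit_at_2_def)
          then have "- w_coeff 3 * residual L x = (Y 2 x + c1 * Y 1 x + c0 * Y 0 x) + w_coeff 3 * (\<Sum>m\<in>L. 1 / deriv w m * yhat m x)"
            using w_coeff_3 by (simp add: residual_def right_diff_distrib)
          ultimately show ?thesis
            by (simp only:) (simp add: algebra_simps)
        qed
        have "sq_norm (\<lambda>x. ?f (k + 2) x - (\<Sum>m\<in>?F. s m * ?f m x)) = (cmod (w_coeff 3))\<^sup>2 * sq_norm (residual L)"
          using sq_norm_cong[OF eq] sq_norm_cmult[of "- w_coeff 3" "residual L"] by simp
        also have "\<dots> < (cmod (w_coeff 3))\<^sup>2 * e'" using L w_coeff_3 by simp
        also have "\<dots> = e\<^sup>2" using w_coeff_3 by (simp add: e'_def power_divide)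
        finally have "L2_norm (\<lambda>x. ?f (k + 2) x - (\<Sum>m\<in>?F. s m * ?f m x)) < e"
          using e by (subst continuous_in_L2(2)) (auto intro!: continuous_intros cf real_less_lsqrt)
        moreover have "?F \<subseteq> ?I - {k + 2}" using ix(2) by auto
        ultimately show "\<exists>F s. finite F \<and> F \<subseteq> ?I - {k + 2} \<and> L2_norm (\<lambda>x. ?f (k + 2) x - (\<Sum>m\<in>F. s m * ?f m x)) < e"
          using fin by (intro exI[of _ ?F] exI[of _ s]) auto
      qed
      then show False using minimal unfolding minimal_system_def by simp
    qed
  next
    assume C: "complex_of_real C \<noteq> c1"
    \<comment> \<open>\<open>U\<close> annihilates the whole system. Orthogonality of
      \<open>Y 1\<close> to \<open>Y 0\<close> and to the simple eigenvectors is automatic and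
      survives adding a multiple of \<open>Y 0\<close>; \<open>p\<close> is the multiple that also
      kills the pairing with \<open>fh (k + 2)\<close>.\<close>
    define p where "p = - of_real C - indef_form (Y 2) (Y 1) / g"
    define U where "U x = Y 1 x + p * Y 0 x" for x
    have cU: "continuous_on {0..1} U" unfolding U_def[abs_def] by (intro continuous_intros)
    have indef_form_U: "indef_form U h = indef_form (Y 1) h + p * indef_form (Y 0) h" if "continuous_on {0..1} h" for h
      using indef_form_linear[of "Y 1" "Y 0" h 1 p] that by (simp add: U_def[abs_def] continuous_intros)
    have U_perp: "indef_form U (fh n) = 0" if n: "n \<in> ?I" for n
      using idx[OF n]
    proof (elim disjE conjE)
      assume "n = k"
      then show ?thesis unfolding fh_k by (simp only: indef_form_U[OF continuous_Y] fh_k gram) simp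
    next
      assume n: "n = k + 2"
      have "indef_form U (Y 2) = indef_form (Y 2) (Y 1) + p * g" "indef_form U (Y 1) = g" "indef_form U (Y 0) = 0"
        unfolding indef_form_U[OF continuous_Y] comm g11 by (simp_all only: g_def gram) simp_all
      then show ?thesis
        unfolding n indef_form_fh_k2[OF cU] using g by (simp add: p_def field_simps)
    next
      assume "n \<notin> {k, k + 1, k + 2}" "fh n = yhat (lam n)"
      then show ?thesis
        using indef_form_Y_simple[of n 0] indef_form_Y_simple[of n 1] by (simp add: indef_form_U[OF continuous_yhat])
    qed
    \<comment> \<open>The critical value enters here: the scalar component of \<open>U\<close> is a
      nonzero multiple of C - c1.\<close>
    have U2: "U 2 \<noteq> 0"
    proof -
      have "indef_form (Y 2) (Y 1) / g = w_coeff 4 / w_coeff 3 + Y 1 2 / Y 0 2"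
        unfolding g_def gram using w_coeff_3 Y_0_2 Delta_nonzero by (simp add: field_simps)
      then have "U 2 = - Y 0 2 * (of_real C - c1)"
        using Y_0_2 by (simp add: U_def p_def c1_def field_simps)
      then show ?thesis using C Y_0_2 by simp
    qed
    \<comment> \<open>Biorthogonal vectors in the extended space. A simple eigenvector is its own
      dual; \<open>Y 0\<close> is dual to \<open>fh (k + 2)\<close>; for \<open>fh k\<close> one
      takes \<open>Y 2\<close>, corrected by the multiple of \<open>Y 0\<close> that makes it
      orthogonal to \<open>fh (k + 2)\<close>.\<close>
    have dual: "\<exists>Z. continuous_on {0..1} Z \<and> (\<forall>m\<in>?I - {n}. indef_form Z (fh m) = 0) \<and> indef_form Z (fh n) \<noteq> 0"
      if n: "n \<in> ?I" for n
      using idx[OF n]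
    proof (elim disjE conjE)
      assume n: "n = k"
      define t where "t = - (indef_form (Y 2) (Y 2) + of_real C * indef_form (Y 2) (Y 1) + of_real D * g) / g"
      define Z where "Z x = Y 2 x + t * Y 0 x" for x
      have cZ: "continuous_on {0..1} Z" unfolding Z_def[abs_def] by (intro continuous_intros)
      have indef_form_Z: "indef_form Z h = indef_form (Y 2) h + t * indef_form (Y 0) h" if "continuous_on {0..1} h" for h
        using indef_form_linear[of "Y 2" "Y 0" h 1 t] that by (simp add: Z_def[abs_def] continuous_intros)
      have Z: "indef_form Z (Y 2) = indef_form (Y 2) (Y 2) + t * g" "indef_form Z (Y 1) = indef_form (Y 2) (Y 1)" "indef_form Z (Y 0) = g"
        unfolding indef_form_Z[OF continuous_Y] comm by (simp_all only: g_def gram) simp_all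
      have "indef_form Z (fh m) = 0" if m: "m \<in> ?I - {n}" for m
      proof -
        have "m \<in> ?I" using m by simp
        from idx[OF this] show ?thesis
        proof (elim disjE conjE)
          assume m: "m = k + 2"
          show ?thesis unfolding m indef_form_fh_k2[OF cZ] Z using g by (simp add: t_def)
        next
          assume "m \<notin> {k, k + 1, k + 2}" "fh m = yhat (lam m)"
          then show ?thesis
            using indef_form_Y_simple[of m 2] indef_form_Y_simple[of m 0] by (simp add: indef_form_Z[OF continuous_yhat])
        qed (use m n in simp)
      qed
      moreover have "indef_form Z (fh n) \<noteq> 0" unfolding n fh_k Z by (rule g)
      ultimately show ?thesis using cZ by blast
    next
      assume n: "n = k + 2"
      have "indef_form (Y 0) (fh m) = 0" if m: "m \<in> ?I - {n}" for m
      proof -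
        have "m \<in> ?I" using m by simp
        from idx[OF this] show ?thesis
        proof (elim disjE conjE)
          assume "m = k"
          then show ?thesis by (simp only: fh_k gram)
        next
          assume "m \<notin> {k, k + 1, k + 2}" "fh m = yhat (lam m)"
          then show ?thesis using indef_form_Y_simple[of m 0] by simp
        qed (use m n in simp)
      qed
      moreover have "indef_form (Y 0) (fh n) = g"
        unfolding n indef_form_fh_k2[OF continuous_Y] comm by (simp only: g_def gram) simp
      ultimately show ?thesis using g continuous_Y by metis
    next
      assume n: "n \<notin> {k, k + 1, k + 2}" "fh n = yhat (lam n)"
      have "indef_form (yhat (lam n)) (fh m) = 0" if m: "m \<in> ?I - {n}" for m
      proof -
        have "m \<in> ?I" using m by simp
        from idx[OF this] show ?thesis
        proof (elim disjE conjE)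
          assume "m = k"
          then show ?thesis using indef_form_Y_simple[OF n(1), of 0] by (simp add: fh_k indef_form_commute)
        next
          assume m: "m = k + 2"
          show ?thesis
            unfolding m indef_form_fh_k2[OF continuous_yhat]
            using indef_form_Y_simple[OF n(1), of 0] indef_form_Y_simple[OF n(1), of 1] indef_form_Y_simple[OF n(1), of 2]
            by (simp add: indef_form_commute[of "yhat _"])
        next
          assume "m \<notin> {k, k + 1, k + 2}" "fh m = yhat (lam m)"
          then show ?thesis using indef_form_yhat_eq_0[OF zero zero, of n m] inj[OF n(1), of m] m by auto
        qed
      qed
      moreover have "indef_form (yhat (lam n)) (fh n) \<noteq> 0"
        unfolding n(2) indef_form_yhat_self[OF zero]
        using zeros_simple[OF zero lam_l[OF n(1)]] yhat_2_nonzero[OF zeros_real[OF zero] zero] Delta_nonzero by simp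
      ultimately show ?thesis using continuous_yhat by blast
    qed
    have "?f n \<notin> closed_span ?f (?I - {n})" if n: "n \<in> ?I" for n
    proof
      assume mem: "?f n \<in> closed_span ?f (?I - {n})"
      obtain Z where Z: "continuous_on {0..1} Z" "\<And>m. m \<in> ?I - {n} \<Longrightarrow> indef_form Z (fh m) = 0" "indef_form Z (fh n) \<noteq> 0"
        using dual[OF n] by blast
      \<comment> \<open>Removing the scalar component turns the dual vector into a functional on \<open>L\<^sub>2(0,1)\<close>.\<close>
      define t where "t = Z 2 / U 2"
      define P where "P x = 1 * Z x + (- t) * U x" for x
      have P: "continuous_on {0..1} P" unfolding P_def[abs_def] by (intro continuous_intros Z cU)
      have P2: "P 2 = 0" using U2 by (simp add: P_def t_def)
      have int: "integral {0..1} (\<lambda>x. P x * ?f m x) = indef_form Z (fh m)" if m: "m \<in> ?I" for m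
      proof -
        have "integral {0..1} (\<lambda>x. P x * ?f m x) = integral {0..1} (\<lambda>x. P x * fh m x)"
          by (intro Henstock_Kurzweil_Integration.integral_cong) (simp add: f_fh)
        also have "\<dots> = indef_form P (fh m)" by (simp add: indef_form_def P2)
        also have "\<dots> = 1 * indef_form Z (fh m) + (- t) * indef_form U (fh m)"
          unfolding P_def[abs_def] by (intro indef_form_linear Z cU cfh)
        finally show ?thesis using U_perp[OF m] by simp
      qed
      have "integral {0..1} (\<lambda>x. P x * ?f n x) = 0"
        by (rule closed_span_annihilator[OF cf P _ mem]) (use int Z(2) in auto)
      then show False using int[OF n] Z(3) by simp
    qed
    then show "minimal_system ?f ?I"
      unfolding minimal_system_def using continuous_in_L2(1)[OF cf] by blast
  qed
qed

end

text \<open>A point with nonzero value excludes the zero function, so a first nonvanishing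
  derivative exists, and its index is the order.\<close>

lemma zorder_imp_higher_deriv:
  assumes f: "f holomorphic_on UNIV" and nz: "f z0 \<noteq> 0" and ord: "zorder f z = int n"
  shows "(deriv ^^ n) f z \<noteq> 0" "i < n \<Longrightarrow> (deriv ^^ i) f z = 0"
proof -
  have an: "f analytic_on {z}" using f by (auto simp: analytic_at)
  have "\<exists>m. (deriv ^^ m) f z \<noteq> 0"
  proof (rule ccontr)
    assume "\<not> ?thesis"
    then have "f z0 = 0"
      by (intro holomorphic_fun_eq_0_on_connected[OF f, of z z0]) auto
    with nz show False by simp
  qed
  define m where "m = (LEAST m. (deriv ^^ m) f z \<noteq> 0)"
  have m: "(deriv ^^ m) f z \<noteq> 0" "i < m \<Longrightarrow> (deriv ^^ i) f z = 0" for i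
    using LeastI_ex[OF \<open>\<exists>m. (deriv ^^ m) f z \<noteq> 0\<close>] not_less_Least unfolding m_def by blast+
  have "zorder f z = int m"
    using zorder_zero_eqI'[OF an, of "int m"] m by simp
  then have "m = n" using ord by simp
  then show "(deriv ^^ n) f z \<noteq> 0" "i < n \<Longrightarrow> (deriv ^^ i) f z = 0" using m by auto
qed

theorem theorem6p2:
  fixes q :: "real \<Rightarrow> real" and \<beta> a b c d C D :: real
    and y :: "real \<Rightarrow> complex \<Rightarrow> complex" and \<omega> :: "complex \<Rightarrow> complex"
    and lam :: "nat \<Rightarrow> complex" and k :: nat
  assumes q_cont: "continuous_on {0..1} q"
    and beta: "0 \<le> \<beta>" "\<beta> < pi"
    and sign: "a * d - b * c < 0"
    and y: "initial_solution q \<beta> y"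
    and omega: "\<omega> = char_fun a b c d y"
    and eigenvalues: "eigenvalue_sequence \<omega> lam"
    and all_real: "\<And>n. lam n \<in> \<real>"
    and triple: "lam (k + 1) = lam k" "lam (k + 2) = lam k" "zorder \<omega> (lam k) = 3"
    and simple: "\<And>n. n \<notin> {k, k + 1, k + 2} \<Longrightarrow> zorder \<omega> (lam n) = 1"
  shows "minimal_system (root_function y lam k C D) {n. n \<noteq> k + 1} \<longleftrightarrow>
         complex_of_real C \<noteq> - (deriv ^^ 4) \<omega> (lam k) / (4 * (deriv ^^ 3) \<omega> (lam k))"
proof -
  interpret sl_char q \<beta> a b c d y
    by unfold_locales (use q_cont sign y in auto)
  have range: "range lam = {z. \<omega> z = 0}"
    and mult: "\<And>z. \<omega> z = 0 \<Longrightarrow> finite {n. lam n = z} \<and> int (card {n. lam n = z}) = zorder \<omega> z"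
    using eigenvalues by (auto simp: eigenvalue_sequence_def)
  have hol: "\<omega> holomorphic_on UNIV" unfolding omega by (rule w_holomorphic)
  have zero: "\<omega> (lam n) = 0" for n using range by blast
  have real: "z \<in> \<real>" if "\<omega> z = 0" for z
    using that range all_real by (metis (mono_tags, lifting) imageE mem_Collect_eq)
  have nz: "\<omega> \<i> \<noteq> 0" using real[of \<i>] by (auto simp: complex_is_Real_iff)
  \<comment> \<open>The three indices k, k + 1, k + 2 already exhaust the multiplicity 3 of the
    triple zero.\<close>
  have distinct: "lam m \<noteq> lam k" if m: "m \<notin> {k, k + 1, k + 2}" for m
  proof
    assume "lam m = lam k"
    then have "{m, k, k + 1, k + 2} \<subseteq> {n. lam n = lam k}" using triple by auto
    then have "card {m, k, k + 1, k + 2} \<le> card {n. lam n = lam k}"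
      using mult[OF zero] by (intro card_mono) auto
    moreover have "card {n. lam n = lam k} = 3" using mult[OF zero, of k] triple(3) by simp
    ultimately show False using m by simp
  qed
  have inj: "m = n" if m: "m \<notin> {k, k + 1, k + 2}" and eq: "lam m = lam n" for m n
  proof -
    have "card {n. lam n = lam m} = 1" using mult[OF zero, of m] simple[OF m] by simp
    then obtain j where j: "{n. lam n = lam m} = {j}" by (rule card_1_singletonE)
    have "m \<in> {n. lam n = lam m}" "n \<in> {n. lam n = lam m}" using eq by simp_all
    then show ?thesis unfolding j by simp
  qed
  have deriv_simple: "deriv \<omega> z \<noteq> 0" if z: "\<omega> z = 0" "z \<noteq> lam k" for z
  proof -
    obtain n where n: "z = lam n" using range z by blast
    then have "n \<notin> {k, k + 1, k + 2}" using z triple by auto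
    then have "zorder \<omega> z = int 1" using simple n by simp
    from zorder_imp_higher_deriv(1)[OF hol nz this] show ?thesis by simp
  qed
  have ord: "zorder \<omega> (lam k) = int 3" using triple by simp
  interpret sl_triple_real q \<beta> a b c d y "lam k"
  proof unfold_locales
    show "(deriv ^^ i) (char_fun a b c d y) (lam k) = 0" if "i < 3" for i
      using zorder_imp_higher_deriv(2)[OF hol nz ord that] by (simp add: omega)
    show "(deriv ^^ 3) (char_fun a b c d y) (lam k) \<noteq> 0"
      using zorder_imp_higher_deriv(1)[OF hol nz ord] by (simp add: omega)
  qed (use all_real real deriv_simple in \<open>auto simp: omega\<close>)
  \<comment> \<open>The factorials in \<open>w_coeff 4\<close> and \<open>w_coeff 3\<close>
    contribute 3! / 4! = 1/4.\<close>
  have c1: "c1 = - (deriv ^^ 4) \<omega> (lam k) / (4 * (deriv ^^ 3) \<omega> (lam k))"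
    using w_3 by (simp add: c1_def w_coeff_def omega fact_numeral field_simps)
  have "minimal_system (root_function y lam k C D) {n. n \<noteq> k + 1} \<longleftrightarrow> complex_of_real C \<noteq> c1"
  proof (rule minimal_iff)
    show "range lam = {z. w z = 0}" using range by (simp add: omega)
    show "m = n" if "m \<notin> {k, k + 1, k + 2}" "lam m = lam n" for m n using that by (rule inj)
  qed (use triple in simp_all)
  then show ?thesis by (simp only: c1)
qed

end
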